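(* Let $\mathcal X$ be a countable domain and let $A$ be an $n$-sample $\rho$-TV indistinguishable $(\alpha,\beta)$-accurate algorithm (for a hypothesis class $\mathcal H\subseteq\{0,1\}^{\mathcal X}$), for some $\rho\in(0,1)$, $\alpha\in(0,1/2)$, $\beta\in\left(0,\frac{2\rho}{\rho+1}-2\sqrt{\frac{2\rho}{\rho+1}}+1\right)$. Then, for any $(\rho',\alpha',\beta')\in(0,1)^3$, there exists a $\rho'$-TV indistinguishable $(\alpha',\beta')$-accurate learner $A'$ (for $\mathcal H$) that requires at most $$O\left(\mathrm{poly}\left(1/\rho,\,1/\alpha',\,\log(1/\beta')\right)\cdot n\right)$$ samples from the data-generating distribution $\mathcal D$.
   Context: An $n$-sample learning rule (algorithm, learner) over $\mathcal X$ is a randomized map $A:(\mathcal X\times\{0,1\})^n\to\{0,1\}^{\mathcal X}$; $A(S)$ is the distribution of its output on $S$. For a distribution $\mathcal D$ over $\mathcal X\times\{0,1\}$, $\mathrm{err}_{\mathcal D}(h)=\Pr_{(x,y)\sim\mathcal D}[h(x)\ne y]$; $\mathcal D$ is realizable with respect to $\mathcal H$ if some $h^*\in\mathcal H$ has $\mathrm{err}_{\mathcal D}(h^* )=0$. $A$ is $n$-sample $(\alpha,\beta)$-accurate for $\mathcal H$ if for every realizable $\mathcal D$, $\Pr[\mathrm{err}_{\mathcal D}(h)>\alpha]\le\beta$, where $S\sim\mathcal D^n$ and $h\sim A(S)$. $A$ is $n$-sample $\rho$-TV indistinguishable if for every distribution $\mathcal D$ over $\mathcal X\times\{0,1\}$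 and independent $S,S'\sim\mathcal D^n$, $\mathbf E_{S,S'}[d_{\mathrm{TV}}(A(S),A(S'))]\le\rho$, where $d_{\mathrm{TV}}$ is total variation distance. *)

theory Defs
  imports "HOL-Probability.Probability"
begin

text \<open>
  The domain is a set \<open>X\<close> (countable in the theorem), labels 0 and 1 are \<open>False\<close> and \<open>True\<close>, and
  hypotheses are the extensional functions \<open>X \<rightarrow>\<^sub>E UNIV\<close>.  Since \<open>X\<close> is countable, every distribution
  on \<open>X \<times> {0,1}\<close> is discrete, hence a \<open>pmf\<close>.  The hypothesis space is uncountable when \<open>X\<close> is infinite,
  so the output of a learner is a probability measure on the product \<open>\<sigma>\<close>-algebra, not a \<open>pmf\<close>.
\<close>

definition hyp_space :: "'x set \<Rightarrow> ('x \<Rightarrow> bool) measure" where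
  "hyp_space X = PiM X (\<lambda>_. count_space UNIV)"

definition data_distribution :: "'x set \<Rightarrow> ('x \<times> bool) pmf \<Rightarrow> bool" where
  "data_distribution X D \<longleftrightarrow> set_pmf D \<subseteq> X \<times> UNIV"

definition err :: "('x \<times> bool) pmf \<Rightarrow> ('x \<Rightarrow> bool) \<Rightarrow> real" where
  "err D h = measure_pmf.prob D {(x, y). h x \<noteq> y}"

definition realizable :: "('x \<Rightarrow> bool) set \<Rightarrow> ('x \<times> bool) pmf \<Rightarrow> bool" where
  "realizable H D \<longleftrightarrow> (\<exists>h\<in>H. err D h = 0)"

text \<open>
  Samples are lists, and \<open>replicate_pmf n D\<close> is the law of an i.i.d. sample of size \<open>n\<close>.  No
  measurability of \<open>A\<close> in the sample is needed, as there are only countably many samples.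
\<close>

type_synonym 'x learner = "('x \<times> bool) list \<Rightarrow> ('x \<Rightarrow> bool) measure"

definition learning_rule :: "'x set \<Rightarrow> nat \<Rightarrow> 'x learner \<Rightarrow> bool" where
  "learning_rule X n A \<longleftrightarrow>
     (\<forall>S. length S = n \<and> set S \<subseteq> X \<times> UNIV \<longrightarrow> A S \<in> space (prob_algebra (hyp_space X)))"

definition accurate ::
  "'x set \<Rightarrow> ('x \<Rightarrow> bool) set \<Rightarrow> nat \<Rightarrow> real \<Rightarrow> real \<Rightarrow> 'x learner \<Rightarrow> bool" where
  "accurate X H n \<alpha> \<beta> A \<longleftrightarrow>
     (\<forall>D. data_distribution X D \<and> realizable H D \<longrightarrow>
        measure_pmf.expectation (replicate_pmf n D)
          (\<lambda>S. measure (A S) {h \<in> space (hyp_space X). err D h > \<alpha>}) \<le> \<beta>)"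

definition tv_dist :: "'a measure \<Rightarrow> 'a measure \<Rightarrow> real" where
  "tv_dist P Q = (SUP E \<in> sets P. \<bar>measure P E - measure Q E\<bar>)"

definition tv_indistinguishable :: "'x set \<Rightarrow> nat \<Rightarrow> real \<Rightarrow> 'x learner \<Rightarrow> bool" where
  "tv_indistinguishable X n \<rho> A \<longleftrightarrow>
     (\<forall>D. data_distribution X D \<longrightarrow>
        measure_pmf.expectation (pair_pmf (replicate_pmf n D) (replicate_pmf n D))
          (\<lambda>(S, S'). tv_dist (A S) (A S')) \<le> \<rho>)"

definition polynomial3 :: "(real \<Rightarrow> real \<Rightarrow> real \<Rightarrow> real) \<Rightarrow> bool" where
  "polynomial3 p \<longleftrightarrow>
     (\<exists>(d::nat) c. \<forall>x y z. p x y z = (\<Sum>i\<le>d. \<Sum>j\<le>d. \<Sum>k\<le>d. c i j k * x ^ i * y ^ j * z ^ k))"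

text \<open>The error event inside \<open>accurate\<close> is measurable, and \<open>tv_dist\<close> is a supremum of a bounded set.\<close>

lemma err_measurable:
  assumes "data_distribution X D"
  shows "err D \<in> borel_measurable (hyp_space X)"
proof -
  let ?N = "count_space (set_pmf D)"
  interpret sigma_finite_measure ?N
    by (rule sigma_finite_measure_count_space_countable) simp
  have eval: "(\<lambda>h. indicator {h. h (fst a) \<noteq> snd a} h * ennreal (pmf D a))
      \<in> borel_measurable (hyp_space X)" if "a \<in> set_pmf D" for a
  proof -
    have "fst a \<in> X" using assms that by (auto simp: data_distribution_def)
    then have [measurable]: "(\<lambda>h. h (fst a)) \<in> hyp_space X \<rightarrow>\<^sub>M count_space UNIV"
      unfolding hyp_space_def by (rule measurable_component_singleton)
    show ?thesis by measurable
  qed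
  have "(\<lambda>h. \<integral>\<^sup>+a. indicator {h. h (fst a) \<noteq> snd a} h * ennreal (pmf D a) \<partial>?N)
      \<in> borel_measurable (hyp_space X)"
  proof (rule borel_measurable_nn_integral)
    show "case_prod (\<lambda>h a. indicator {h. h (fst a) \<noteq> snd a} h * ennreal (pmf D a))
        \<in> borel_measurable (hyp_space X \<Otimes>\<^sub>M ?N)"
      by (subst measurable_pair_swap_iff, rule measurable_pair_measure_countable1) (use eval in auto)
  qed
  then have "(\<lambda>h. enn2real (\<integral>\<^sup>+a. indicator {h. h (fst a) \<noteq> snd a} h * ennreal (pmf D a) \<partial>?N))
      \<in> borel_measurable (hyp_space X)"
    by (rule borel_measurable_enn2real)
  moreover have "err D h = enn2real (\<integral>\<^sup>+a. indicator {h. h (fst a) \<noteq> snd a} h * ennreal (pmf D a) \<partial>?N)"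
    for h
  proof -
    have "emeasure (measure_pmf D) {(x, y). h x \<noteq> y}
        = (\<integral>\<^sup>+a. indicator {(x, y). h x \<noteq> y} a \<partial>measure_pmf D)"
      by simp
    also have "\<dots> = (\<integral>\<^sup>+a. ennreal (pmf D a) * indicator {(x, y). h x \<noteq> y} a \<partial>count_space UNIV)"
      by (rule nn_integral_measure_pmf)
    also have "\<dots> = (\<integral>\<^sup>+a. indicator {h. h (fst a) \<noteq> snd a} h * ennreal (pmf D a) * indicator (set_pmf D) a
        \<partial>count_space UNIV)"
      by (rule nn_integral_cong) (auto simp: indicator_def set_pmf_iff split: prod.splits)
    also have "\<dots> = (\<integral>\<^sup>+a. indicator {h. h (fst a) \<noteq> snd a} h * ennreal (pmf D a) \<partial>?N)"
      by (subst nn_integral_count_space_indicator) auto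
    finally show ?thesis by (simp add: err_def measure_def)
  qed
  ultimately show ?thesis
    by (subst measurable_cong)
qed

lemma tv_dist_bdd_above:
  assumes "prob_space P" "prob_space Q"
  shows "bdd_above ((\<lambda>E. \<bar>measure P E - measure Q E\<bar>) ` sets P)"
proof (rule bdd_aboveI2)
  fix E show "\<bar>measure P E - measure Q E\<bar> \<le> 1"
    using prob_space.prob_le_1[OF assms(1), of E] prob_space.prob_le_1[OF assms(2), of E]
      measure_nonneg[of P E] measure_nonneg[of Q E] by linarith
qed

end

theory Submission
  imports Defs
begin

text \<open>
  The dependence on \<open>\<rho>\<close> disappears: the hypothesis on \<open>\<beta>\<close> gives \<open>\<rho> + \<beta> \<le> 1 - c\<close> with
  \<open>c = 2 (sqrt \<beta> - \<beta>) > 0\<close>.  Over a countable domain all output laws \<open>A S\<close> have densities \<open>f\<^sub>S\<close> with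
  respect to one probability measure.  Drawing a hypothesis from the average of \<open>min f\<^sub>S f\<^sub>S'\<close> over many
  independent pairs of samples gives a learner that is arbitrarily stable and still accurate with
  probability at least \<open>c\<close>; no coupling or shared randomness is needed.  This learner is then boosted on
  reweighted distributions, obtained by rejection sampling.  Both decisions of a round, whether to stop
  and whether to keep the new hypothesis, compare an empirical mean with a threshold through a Lipschitz
  acceptance probability, so they are stable under resampling, and total variation adds up along the
  rounds.  A potential argument bounds the number of useful rounds.
\<close>

text \<open>The averaged learner may fail with probability \<open>1 - c\<close>, which can be close
  to 1, so boosting cannot trust each hypothesis it draws. Hence the test of the new hypothesis: a
  round that draws a useless one usually leaves the votes alone and costs stability only, and a
  larger number of rounds makes up for a small \<open>c\<close>. Confidence and accuracy are thus
  boosted by the same loop.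

  The technical obstacle is measurability. Hypotheses form an uncountable space, and the distance
  between two kernels is a supremum over uncountably many events, so it need not be measurable in
  the hypothesis. The integral of such a function is a lower integral, and exchanging it with a
  discrete average is an inequality in one direction only; the stability estimates are arranged so
  that this direction suffices. Averages over samples live in \<open>ennreal\<close>, which avoids
  integrability conditions. Auxiliary noise is first counted as data and only at the end turned into
  internal randomness of the learner, a change that cannot increase instability.\<close>

section \<open>Total variation distance and kernels\<close>

lemma tv_dist_le:
  assumes "\<And>E. E \<in> sets P \<Longrightarrow> \<bar>measure P E - measure Q E\<bar> \<le> b"
  shows "tv_dist P Q \<le> b"
  unfolding tv_dist_def by (rule cSUP_least) (use assms in auto)

lemma measure_diff_le_tv_dist:
  assumes "prob_space P" "prob_space Q" "E \<in> sets P"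
  shows "\<bar>measure P E - measure Q E\<bar> \<le> tv_dist P Q"
  unfolding tv_dist_def by (rule cSUP_upper[OF assms(3) tv_dist_bdd_above[OF assms(1,2)]])

lemma tv_dist_nonneg: "prob_space P \<Longrightarrow> prob_space Q \<Longrightarrow> 0 \<le> tv_dist P Q"
  using measure_diff_le_tv_dist[of P Q "{}"] by simp

lemma tv_dist_le_1:
  assumes "prob_space P" "prob_space Q"
  shows "tv_dist P Q \<le> 1"
proof (rule tv_dist_le)
  fix E show "\<bar>measure P E - measure Q E\<bar> \<le> 1"
    using prob_space.prob_le_1[OF assms(1), of E] prob_space.prob_le_1[OF assms(2), of E]
      measure_nonneg[of P E] measure_nonneg[of Q E] by linarith
qed

lemma tv_dist_commute: "sets P = sets Q \<Longrightarrow> tv_dist P Q = tv_dist Q P"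
  by (simp add: tv_dist_def abs_minus_commute)

lemma tv_dist_self [simp]: "tv_dist P P = 0"
  unfolding tv_dist_def by (simp, rule cSUP_const) auto

lemma space_prob_algebraD:
  assumes "P \<in> space (prob_algebra M)"
  shows "prob_space P" "sets P = sets M" "space P = space M"
  using assms sets_eq_imp_space_eq by (auto simp: space_prob_algebra)

text \<open>Layer cake: a \<open>[0, 1]\<close>-valued function is the average over thresholds
  \<open>t\<close> in \<open>[0, 1]\<close> of the indicators of its superlevel sets, and each of
  these is an event on which \<open>P\<close> and \<open>Q\<close> differ by at most the
  distance.\<close>

lemma nn_integral_le_tv_dist:
  assumes P: "P \<in> space (prob_algebra M)" and Q: "Q \<in> space (prob_algebra M)"
    and f [measurable]: "f \<in> borel_measurable M" and f01: "\<And>x. x \<in> space M \<Longrightarrow> 0 \<le> f x \<and> f x \<le> (1::real)"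
  shows "(\<integral>\<^sup>+x. ennreal (f x) \<partial>P) \<le> (\<integral>\<^sup>+x. ennreal (f x) \<partial>Q) + ennreal (tv_dist P Q)"
proof -
  note PD = space_prob_algebraD[OF P] and QD = space_prob_algebraD[OF Q]
  define L where "L = restrict_space lborel {0..1::real}"
  have L: "sigma_finite_measure L"
    unfolding L_def by (rule sigma_finite_measure_restrict_space[OF sigma_finite_lborel]) auto
  have [simp]: "space L = {0..1}" by (auto simp: L_def space_restrict_space)
  have [measurable_cong]: "sets L = sets (restrict_space borel {0..1})"
    by (auto simp: L_def sets_restrict_space)
  have [measurable]: "(\<lambda>t. t) \<in> borel_measurable L"
    unfolding L_def by (rule measurable_restrict_space1) simp
  have slice: "(\<integral>\<^sup>+x. indicator {t. t < f x} t \<partial>R) = emeasure R {x\<in>space M. t < f x}"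
    if R: "R \<in> space (prob_algebra M)" for R t
  proof -
    note RD = space_prob_algebraD[OF R]
    have "(\<integral>\<^sup>+x. indicator {t. t < f x} t \<partial>R) = (\<integral>\<^sup>+x. indicator {x\<in>space M. t < f x} x \<partial>R)"
      by (rule nn_integral_cong) (auto simp: indicator_def RD(3))
    also have "\<dots> = emeasure R {x\<in>space M. t < f x}"
      by (rule nn_integral_indicator) (simp add: RD(2))
    finally show ?thesis .
  qed
  have layer: "(\<integral>\<^sup>+x. ennreal (f x) \<partial>R) = (\<integral>\<^sup>+t. emeasure R {x\<in>space M. t < f x} \<partial>L)"
    and layer_measurable: "(\<lambda>t. emeasure R {x\<in>space M. t < f x}) \<in> borel_measurable L"
    if R: "R \<in> space (prob_algebra M)" for R
  proof -
    note RD = space_prob_algebraD[OF R]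
    note [measurable_cong] = RD(2)
    interpret R: prob_space R by (rule RD(1))
    interpret L: sigma_finite_measure L by (rule L)
    interpret pair_sigma_finite R L ..
    have "(\<integral>\<^sup>+x. ennreal (f x) \<partial>R) = (\<integral>\<^sup>+x. \<integral>\<^sup>+t. indicator {t. t < f x} t \<partial>L \<partial>R)"
    proof (rule nn_integral_cong)
      fix x assume "x \<in> space R"
      then have x: "0 \<le> f x" "f x \<le> 1" using f01 RD(3) by auto
      have "(\<integral>\<^sup>+t. indicator {t. t < f x} t \<partial>L) = (\<integral>\<^sup>+t. indicator {t. t < f x} t * indicator {0..1} t \<partial>lborel)"
        unfolding L_def by (rule nn_integral_restrict_space) auto
      also have "\<dots> = (\<integral>\<^sup>+t. indicator {0..<f x} t \<partial>lborel)"
        by (rule nn_integral_cong) (use x in \<open>auto simp: indicator_def\<close>)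
      finally show "ennreal (f x) = (\<integral>\<^sup>+t. indicator {t. t < f x} t \<partial>L)" using x by simp
    qed
    also have "\<dots> = (\<integral>\<^sup>+t. \<integral>\<^sup>+x. indicator {t. t < f x} t \<partial>R \<partial>L)"
      by (rule Fubini'[symmetric]) measurable
    also have "\<dots> = (\<integral>\<^sup>+t. emeasure R {x\<in>space M. t < f x} \<partial>L)"
      using R by (simp add: slice)
    finally show eq: "(\<integral>\<^sup>+x. ennreal (f x) \<partial>R) = (\<integral>\<^sup>+t. emeasure R {x\<in>space M. t < f x} \<partial>L)" .
    show "(\<lambda>t. emeasure R {x\<in>space M. t < f x}) \<in> borel_measurable L"
      unfolding slice[OF R, symmetric] by measurable
  qed
  have "(\<integral>\<^sup>+x. ennreal (f x) \<partial>P) \<le> (\<integral>\<^sup>+t. emeasure Q {x\<in>space M. t < f x} + ennreal (tv_dist P Q) \<partial>L)"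
    unfolding layer[OF P]
  proof (rule nn_integral_mono)
    fix t
    have "{x\<in>space M. t < f x} \<in> sets P" by (simp add: PD(2))
    from measure_diff_le_tv_dist[OF PD(1) QD(1) this]
    have "ennreal (measure P {x\<in>space M. t < f x}) \<le> ennreal (measure Q {x\<in>space M. t < f x} + tv_dist P Q)"
      by (intro ennreal_leI) linarith
    then show "emeasure P {x\<in>space M. t < f x} \<le> emeasure Q {x\<in>space M. t < f x} + ennreal (tv_dist P Q)"
      using PD(1) QD(1) tv_dist_nonneg[OF PD(1) QD(1)]
      by (simp add: finite_measure.emeasure_eq_measure prob_space_def)
  qed
  also have "\<dots> = (\<integral>\<^sup>+x. ennreal (f x) \<partial>Q) + (\<integral>\<^sup>+t. ennreal (tv_dist P Q) \<partial>L)"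
    unfolding layer[OF Q]
    by (rule nn_integral_add) (use layer_measurable[OF Q] in auto)
  also have "(\<integral>\<^sup>+t. ennreal (tv_dist P Q) \<partial>L) = ennreal (tv_dist P Q)"
    by (simp add: L_def emeasure_restrict_space space_restrict_space)
  finally show ?thesis .
qed

text \<open>For a fixed event, first replace \<open>P\<close> by \<open>Q\<close> under the test
  function \<open>measure (K x) E\<close>, then compare the kernels pointwise under
  \<open>Q\<close>. The integrand on the right may be non-measurable; its lower integral still
  dominates, because the difference on a fixed event is measurable and lies below it.\<close>

lemma tv_dist_bind:
  assumes P: "P \<in> space (prob_algebra M)" and Q: "Q \<in> space (prob_algebra M)"
    and K: "K \<in> M \<rightarrow>\<^sub>M prob_algebra N" and K': "K' \<in> M \<rightarrow>\<^sub>M prob_algebra N"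
  shows "ennreal (tv_dist (P \<bind> K) (Q \<bind> K'))
    \<le> ennreal (tv_dist P Q) + (\<integral>\<^sup>+x. ennreal (tv_dist (K x) (K' x)) \<partial>Q)" (is "_ \<le> ?R")
proof (cases "?R = \<top>")
  case False
  note PD = space_prob_algebraD[OF P] and QD = space_prob_algebraD[OF Q]
  have Kx: "K x \<in> space (prob_algebra N)" "K' x \<in> space (prob_algebra N)" if "x \<in> space M" for x
    using that K K' by (auto dest: measurable_space)
  have bp: "P \<bind> K \<in> space (prob_algebra N)" "Q \<bind> K' \<in> space (prob_algebra N)"
    by (auto intro!: prob_space_bind' sets_bind' P Q K K' simp: space_prob_algebra)
  note bD = space_prob_algebraD[OF bp(1)] space_prob_algebraD[OF bp(2)]
  have em: "emeasure (R \<bind> J) E = (\<integral>\<^sup>+x. ennreal (measure (J x) E) \<partial>R)"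
    if R: "R \<in> space (prob_algebra M)" and J: "J \<in> M \<rightarrow>\<^sub>M prob_algebra N" and E: "E \<in> sets N" for R J E
  proof -
    note RD = space_prob_algebraD[OF R]
    have "emeasure (R \<bind> J) E = (\<integral>\<^sup>+x. emeasure (J x) E \<partial>R)"
      using RD by (intro emeasure_bind[OF _ _ E])
        (auto simp: prob_space.not_empty measurable_cong_sets[OF RD(2) refl] intro!: measurable_prob_algebraD J)
    also have "\<dots> = (\<integral>\<^sup>+x. ennreal (measure (J x) E) \<partial>R)"
      using RD J by (intro nn_integral_cong)
        (auto simp: finite_measure.emeasure_eq_measure prob_space_def
            dest!: measurable_space space_prob_algebraD(1))
    finally show ?thesis .
  qed
  have meas [measurable]: "(\<lambda>x. measure (J x) E) \<in> borel_measurable M"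
    if J: "J \<in> M \<rightarrow>\<^sub>M prob_algebra N" and E: "E \<in> sets N" for J E
    by (rule measurable_compose[OF measurable_prob_algebraD[OF J] measurable_measure_subprob_algebra[OF E]])
  have step: "emeasure (R \<bind> J) E \<le> emeasure (R' \<bind> J') E + (ennreal (tv_dist R R') + (\<integral>\<^sup>+x. ennreal \<bar>measure (J x) E - measure (J' x) E\<bar> \<partial>R'))"
    if R: "R \<in> space (prob_algebra M)" "R' \<in> space (prob_algebra M)"
      and J: "J \<in> M \<rightarrow>\<^sub>M prob_algebra N" "J' \<in> M \<rightarrow>\<^sub>M prob_algebra N" and E: "E \<in> sets N" for R J R' J' E
  proof -
    note [measurable_cong] = space_prob_algebraD(2)[OF R(2)]
    note [measurable] = meas[OF J(1) E] meas[OF J(2) E]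
    have "emeasure (R \<bind> J) E \<le> (\<integral>\<^sup>+x. ennreal (measure (J x) E) \<partial>R') + ennreal (tv_dist R R')"
      unfolding em[OF R(1) J(1) E]
      using J(1) by (intro nn_integral_le_tv_dist[OF R meas[OF J(1) E]])
        (auto simp: prob_space.prob_le_1 dest!: measurable_space space_prob_algebraD(1))
    also have "(\<integral>\<^sup>+x. ennreal (measure (J x) E) \<partial>R') \<le> (\<integral>\<^sup>+x. ennreal (measure (J' x) E) + ennreal \<bar>measure (J x) E - measure (J' x) E\<bar> \<partial>R')"
      by (intro nn_integral_mono) (simp flip: ennreal_plus)
    also have "\<dots> = emeasure (R' \<bind> J') E + (\<integral>\<^sup>+x. ennreal \<bar>measure (J x) E - measure (J' x) E\<bar> \<partial>R')"
      unfolding em[OF R(2) J(2) E] by (rule nn_integral_add) measurable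
    finally show ?thesis by (simp add: ac_simps)
  qed
  have I: "(\<integral>\<^sup>+x. ennreal \<bar>measure (K x) E - measure (K' x) E\<bar> \<partial>Q) \<le> (\<integral>\<^sup>+x. ennreal (tv_dist (K x) (K' x)) \<partial>Q)"
    if "E \<in> sets N" for E
    using that space_prob_algebraD[OF Kx(1)] space_prob_algebraD[OF Kx(2)] QD(3)
    by (intro nn_integral_mono ennreal_leI measure_diff_le_tv_dist) auto
  obtain r where r: "?R = ennreal r" "0 \<le> r" using False by (cases ?R) auto
  have "tv_dist (P \<bind> K) (Q \<bind> K') \<le> r"
  proof (rule tv_dist_le)
    fix E assume "E \<in> sets (P \<bind> K)"
    then have E: "E \<in> sets N" using bD by simp
    have 1: "emeasure (P \<bind> K) E \<le> emeasure (Q \<bind> K') E + ?R"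
      by (rule order_trans[OF step[OF P Q K K' E]]) (intro add_mono order_refl I E)
    \<comment> \<open>The reverse direction makes the two replacements in the opposite order, kernel
      first, so that the kernels are again compared under \<open>Q\<close>.\<close>
    have 2: "emeasure (Q \<bind> K') E \<le> emeasure (P \<bind> K) E + ?R"
    proof -
      have "emeasure (Q \<bind> K') E \<le> emeasure (Q \<bind> K) E + (\<integral>\<^sup>+x. ennreal \<bar>measure (K' x) E - measure (K x) E\<bar> \<partial>Q)"
        using step[OF Q Q K' K E] by simp
      also have "\<dots> \<le> (emeasure (P \<bind> K) E + ennreal (tv_dist Q P)) + (\<integral>\<^sup>+x. ennreal \<bar>measure (K' x) E - measure (K x) E\<bar> \<partial>Q)"
        using step[OF Q P K K E] by (intro add_mono) auto
      also have "\<dots> \<le> emeasure (P \<bind> K) E + ?R"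
        unfolding abs_minus_commute[of "measure (K' _) E"] add.assoc
        using tv_dist_commute[of P Q] PD QD I[OF E] by (intro add_mono) auto
      finally show ?thesis .
    qed
    interpret A: prob_space "P \<bind> K" by (rule bD)
    interpret B: prob_space "Q \<bind> K'" by (rule bD)
    have "measure (P \<bind> K) E \<le> measure (Q \<bind> K') E + r"
      using 1 r(2) unfolding r(1) A.emeasure_eq_measure B.emeasure_eq_measure
      by (simp flip: ennreal_plus)
    moreover have "measure (Q \<bind> K') E \<le> measure (P \<bind> K) E + r"
      using 2 r(2) unfolding r(1) A.emeasure_eq_measure B.emeasure_eq_measure
      by (simp flip: ennreal_plus)
    ultimately show "\<bar>measure (P \<bind> K) E - measure (Q \<bind> K') E\<bar> \<le> r" by linarith
  qed
  then show ?thesis unfolding r(1) by (rule ennreal_leI)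
qed simp

section \<open>Lower integrals and exchange with discrete averages\<close>

text \<open>The integral of an arbitrary function is a supremum over simple functions below it.
  Countably many of them reach this supremum, and their pointwise supremum is measurable.\<close>

lemma nn_integral_measurable_minorant:
  obtains g where "g \<in> borel_measurable M" "\<And>x. g x \<le> f x" "(\<integral>\<^sup>+x. g x \<partial>M) = (\<integral>\<^sup>+x. f x \<partial>M)"
proof -
  have ne: "{g. simple_function M g \<and> g \<le> f} \<noteq> {}" by (auto intro!: exI[of _ "\<lambda>_. 0"] simp: le_fun_def)
  from ennreal_SUP_countable_SUP[OF this, of "integral\<^sup>S M"]
  obtain F :: "nat \<Rightarrow> ennreal" where F: "range F \<subseteq> integral\<^sup>S M ` {g. simple_function M g \<and> g \<le> f}"
    "integral\<^sup>N M f = Sup (range F)" by (auto simp: nn_integral_def)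
  have "\<exists>g. simple_function M g \<and> g \<le> f \<and> F i = integral\<^sup>S M g" for i
  proof -
    have "F i \<in> integral\<^sup>S M ` {g. simple_function M g \<and> g \<le> f}" using F(1) by blast
    then show ?thesis by blast
  qed
  then obtain G where G: "\<And>i. simple_function M (G i)" "\<And>i. G i \<le> f" "\<And>i. F i = integral\<^sup>S M (G i)" by metis
  have m [measurable]: "\<And>i. G i \<in> borel_measurable M" using G(1) by (rule borel_measurable_simple_function)
  let ?g = "\<lambda>x. SUP i. G i x"
  have le: "?g x \<le> f x" for x by (rule SUP_least) (rule le_funD[OF G(2)])
  have "integral\<^sup>N M f \<le> (\<integral>\<^sup>+x. ?g x \<partial>M)"
    unfolding F(2)
  proof (rule SUP_least)
    fix i
    have "F i = (\<integral>\<^sup>+x. G i x \<partial>M)" using G by (simp add: nn_integral_eq_simple_integral)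
    also have "\<dots> \<le> (\<integral>\<^sup>+x. ?g x \<partial>M)" by (intro nn_integral_mono SUP_upper) auto
    finally show "F i \<le> (\<integral>\<^sup>+x. ?g x \<partial>M)" .
  qed
  moreover have "(\<integral>\<^sup>+x. ?g x \<partial>M) \<le> integral\<^sup>N M f" by (intro nn_integral_mono le)
  ultimately show thesis using le by (intro that[of ?g]) (auto intro: antisym)
qed

text \<open>On the countable support of \<open>P\<close>, measurability of each section
  \<open>f s\<close> gives joint measurability, so Fubini applies.\<close>

lemma nn_integral_pmf_swap:
  fixes P :: "'a pmf"
  assumes "sigma_finite_measure M" "\<And>s. s \<in> set_pmf P \<Longrightarrow> f s \<in> borel_measurable M"
  shows "(\<integral>\<^sup>+s. \<integral>\<^sup>+x. f s x \<partial>M \<partial>measure_pmf P) = (\<integral>\<^sup>+x. \<integral>\<^sup>+s. f s x \<partial>measure_pmf P \<partial>M)"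
    and "(\<lambda>x. \<integral>\<^sup>+s. f s x \<partial>measure_pmf P) \<in> borel_measurable M"
proof -
  let ?N = "count_space (set_pmf P)"
  interpret M: sigma_finite_measure M by fact
  interpret N: sigma_finite_measure ?N
    by (rule sigma_finite_measure_count_space_countable) simp
  interpret pair_sigma_finite ?N M ..
  have pmf: "(\<integral>\<^sup>+s. g s \<partial>measure_pmf P) = (\<integral>\<^sup>+s. ennreal (pmf P s) * g s \<partial>?N)" for g
  proof -
    have "(\<integral>\<^sup>+s. g s \<partial>measure_pmf P) = (\<integral>\<^sup>+s. ennreal (pmf P s) * g s * indicator (set_pmf P) s \<partial>count_space UNIV)"
      unfolding nn_integral_measure_pmf by (rule nn_integral_cong) (auto simp: indicator_def set_pmf_iff)
    then show ?thesis by (subst nn_integral_count_space_indicator) auto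
  qed
  have jm [measurable]: "case_prod (\<lambda>s x. ennreal (pmf P s) * f s x) \<in> borel_measurable (?N \<Otimes>\<^sub>M M)"
    by (rule measurable_pair_measure_countable1) (use assms in auto)
  have "(\<integral>\<^sup>+s. \<integral>\<^sup>+x. f s x \<partial>M \<partial>measure_pmf P) = (\<integral>\<^sup>+s. \<integral>\<^sup>+x. ennreal (pmf P s) * f s x \<partial>M \<partial>?N)"
    unfolding pmf by (intro nn_integral_cong nn_integral_cmult[symmetric]) (use assms in auto)
  also have "\<dots> = (\<integral>\<^sup>+x. \<integral>\<^sup>+s. ennreal (pmf P s) * f s x \<partial>?N \<partial>M)"
    by (rule Fubini'[OF jm, symmetric])
  finally show "(\<integral>\<^sup>+s. \<integral>\<^sup>+x. f s x \<partial>M \<partial>measure_pmf P) = (\<integral>\<^sup>+x. \<integral>\<^sup>+s. f s x \<partial>measure_pmf P \<partial>M)"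
    unfolding pmf .
  show "(\<lambda>x. \<integral>\<^sup>+s. f s x \<partial>measure_pmf P) \<in> borel_measurable M"
    unfolding pmf
  proof (rule N.borel_measurable_nn_integral)
    show "(\<lambda>(x, s). ennreal (pmf P s) * f s x) \<in> borel_measurable (M \<Otimes>\<^sub>M ?N)"
      by (subst measurable_pair_swap_iff) (use jm in \<open>simp add: case_prod_unfold\<close>)
  qed
qed

text \<open>Lower integrals are only superadditive, so without measurability one inequality
  survives: pass to measurable minorants with the same integrals, exchange those exactly, and
  enlarge again.\<close>

lemma nn_integral_pmf_swap_le:
  assumes "sigma_finite_measure M"
  shows "(\<integral>\<^sup>+s. \<integral>\<^sup>+x. f s x \<partial>M \<partial>measure_pmf P) \<le> (\<integral>\<^sup>+x. \<integral>\<^sup>+s. f s x \<partial>measure_pmf P \<partial>M)"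
proof -
  have "\<exists>g. g \<in> borel_measurable M \<and> (\<forall>x. g x \<le> f s x) \<and> (\<integral>\<^sup>+x. g x \<partial>M) = (\<integral>\<^sup>+x. f s x \<partial>M)" for s
    using nn_integral_measurable_minorant[of M "f s"] by metis
  then obtain g where g: "\<And>s. g s \<in> borel_measurable M" "\<And>s x. g s x \<le> f s x"
    "\<And>s. (\<integral>\<^sup>+x. g s x \<partial>M) = (\<integral>\<^sup>+x. f s x \<partial>M)" by metis
  have "(\<integral>\<^sup>+s. \<integral>\<^sup>+x. f s x \<partial>M \<partial>measure_pmf P) = (\<integral>\<^sup>+x. \<integral>\<^sup>+s. g s x \<partial>measure_pmf P \<partial>M)"
    unfolding g(3)[symmetric] by (rule nn_integral_pmf_swap[OF assms g(1)])
  also have "\<dots> \<le> (\<integral>\<^sup>+x. \<integral>\<^sup>+s. f s x \<partial>measure_pmf P \<partial>M)"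
    by (intro nn_integral_mono g(2))
  finally show ?thesis .
qed

section \<open>Empirical means: deviation and tails\<close>

lemma nn_integral_replicate_pmf_Suc:
  "(\<integral>\<^sup>+xs. F xs \<partial>(replicate_pmf (Suc n) P))
    = (\<integral>\<^sup>+x. \<integral>\<^sup>+xs. F (x # xs) \<partial>(replicate_pmf n P) \<partial>measure_pmf P)"
  by (simp add: nn_integral_return)

definition mean :: "('a \<Rightarrow> real) \<Rightarrow> 'a list \<Rightarrow> real" where
  "mean f xs = sum_list (map f xs) / real (length xs)"

lemma length_replicate_pmf: "xs \<in> set_pmf (replicate_pmf n P) \<Longrightarrow> length xs = n"
  by (simp add: set_replicate_pmf)

lemma sum_list_map_shift: "sum_list (map (\<lambda>x. f x + (c::real)) xs) = sum_list (map f xs) + c * real (length xs)"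
  by (induction xs) (auto simp: algebra_simps)

text \<open>Split off the first entry; by independence the cross term contributes
  \<open>2 * n * m^2\<close>, and the recursion adds up to \<open>n * (n - 1) * m^2\<close>.\<close>

lemma sum_list_second_moment:
  fixes f :: "'a \<Rightarrow> real"
  assumes f0: "\<And>x. 0 \<le> f x" and m: "(\<integral>\<^sup>+x. ennreal (f x) \<partial>measure_pmf P) = ennreal m" "0 \<le> m"
    and q: "(\<integral>\<^sup>+x. ennreal ((f x)\<^sup>2) \<partial>measure_pmf P) = ennreal q" "0 \<le> q"
  shows "(\<integral>\<^sup>+xs. ennreal (sum_list (map f xs)) \<partial>(replicate_pmf n P)) = ennreal (real n * m)"
    and "(\<integral>\<^sup>+xs. ennreal ((sum_list (map f xs))\<^sup>2) \<partial>(replicate_pmf n P))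
      = ennreal (real n * q + real n * (real n - 1) * m\<^sup>2)"
proof (induction n)
  case 0
  case 1 show ?case by (simp add: nn_integral_return)
  case 2 show ?case by (simp add: nn_integral_return)
next
  case (Suc n)
  have s0: "0 \<le> sum_list (map f xs)" for xs using f0 by (induction xs) auto
  case 1
  have "(\<integral>\<^sup>+xs. ennreal (sum_list (map f xs)) \<partial>(replicate_pmf (Suc n) P))
      = (\<integral>\<^sup>+x. \<integral>\<^sup>+xs. ennreal (f x) + ennreal (sum_list (map f xs)) \<partial>(replicate_pmf n P) \<partial>measure_pmf P)"
    unfolding nn_integral_replicate_pmf_Suc using f0 s0 by simp
  also have "\<dots> = ennreal m + ennreal (real n * m)"
    by (simp add: nn_integral_add Suc.IH m)
  finally show ?case using m by (simp add: algebra_simps flip: ennreal_plus)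
  case 2
  have "(\<integral>\<^sup>+xs. ennreal ((sum_list (map f xs))\<^sup>2) \<partial>(replicate_pmf (Suc n) P))
      = (\<integral>\<^sup>+x. \<integral>\<^sup>+xs. ennreal ((f x)\<^sup>2) + (ennreal (2 * f x) * ennreal (sum_list (map f xs)) + ennreal ((sum_list (map f xs))\<^sup>2))
          \<partial>(replicate_pmf n P) \<partial>measure_pmf P)"
    unfolding nn_integral_replicate_pmf_Suc using f0 s0
    by (intro nn_integral_cong) (simp add: power2_sum algebra_simps flip: ennreal_plus ennreal_mult)
  also have "\<dots> = (\<integral>\<^sup>+x. ennreal ((f x)\<^sup>2) + (ennreal (2 * real n * m) * ennreal (f x)
      + ennreal (real n * q + real n * (real n - 1) * m\<^sup>2)) \<partial>measure_pmf P)"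
  proof (rule nn_integral_cong)
    fix x
    have "ennreal (2 * f x) * ennreal (real n * m) = ennreal (2 * real n * m) * ennreal (f x)"
      using f0 m(2) by (simp add: mult_ac flip: ennreal_mult)
    then show "(\<integral>\<^sup>+xs. ennreal ((f x)\<^sup>2) + (ennreal (2 * f x) * ennreal (sum_list (map f xs)) + ennreal ((sum_list (map f xs))\<^sup>2))
        \<partial>(replicate_pmf n P))
      = ennreal ((f x)\<^sup>2) + (ennreal (2 * real n * m) * ennreal (f x)
        + ennreal (real n * q + real n * (real n - 1) * m\<^sup>2))"
      by (simp add: nn_integral_add nn_integral_cmult Suc.IH del: ennreal_plus)
  qed
  also have "\<dots> = ennreal q + (ennreal (2 * real n * m) * ennreal m + ennreal (real n * q + real n * (real n - 1) * m\<^sup>2))"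
    by (simp add: nn_integral_add nn_integral_cmult m q)
  also have "\<dots> = ennreal (q + (2 * real n * m * m + (real n * q + real n * (real n - 1) * m\<^sup>2)))"
  proof -
    have nn: "0 \<le> real n * (real n - 1)" by (cases n) auto
    have "0 \<le> real n * q + real n * (real n - 1) * m\<^sup>2"
      using q(2) by (intro add_nonneg_nonneg mult_nonneg_nonneg[OF nn] mult_nonneg_nonneg) auto
    then show ?thesis using m(2) q(2) by (simp flip: ennreal_plus ennreal_mult)
  qed
  finally show ?case by (simp add: algebra_simps power2_eq_square)
qed

text \<open>Only a second moment is assumed, because the functions to be averaged will be values of
  densities at a point, which are unbounded. Cauchy-Schwarz is used in its linear form
  \<open>|d| <= d^2 / (2 t) + t / 2\<close>.\<close>

lemma mean_deviation_pos:
  fixes f :: "'a \<Rightarrow> real"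
  assumes f0: "\<And>x. 0 \<le> f x" and B: "(\<integral>\<^sup>+x. ennreal ((f x)\<^sup>2) \<partial>measure_pmf P) \<le> ennreal (B\<^sup>2)" "0 < B" and n: "0 < n"
  shows "(\<integral>\<^sup>+xs. ennreal \<bar>mean f xs - measure_pmf.expectation P f\<bar> \<partial>(replicate_pmf n P)) \<le> ennreal (B / sqrt n)"
proof -
  define m where "m = measure_pmf.expectation P f"
  define q where "q = enn2real (\<integral>\<^sup>+x. ennreal ((f x)\<^sup>2) \<partial>measure_pmf P)"
  have q: "(\<integral>\<^sup>+x. ennreal ((f x)\<^sup>2) \<partial>measure_pmf P) = ennreal q" "0 \<le> q" "q \<le> B\<^sup>2"
    using B(1) by (auto simp: q_def less_top[symmetric] top_unique enn2real_leI ennreal_enn2real_if)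
  have int2: "integrable P (\<lambda>x. (f x)\<^sup>2)"
    by (rule integrableI_nn_integral_finite[OF _ _ q(1)]) (use q in auto)
  have int: "integrable P f"
    by (rule measure_pmf.square_integrable_imp_integrable[OF _ int2]) simp
  have m: "(\<integral>\<^sup>+x. ennreal (f x) \<partial>measure_pmf P) = ennreal m" "0 \<le> m"
    using int f0 by (auto simp: m_def nn_integral_eq_integral)
  note mom = sum_list_second_moment[OF f0 m q(1,2), of n]
  let ?R = "measure_pmf (replicate_pmf n P)"
  have s0: "0 \<le> sum_list (map f xs)" for xs using f0 by (induction xs) auto
  have nn: "0 \<le> real n * (real n - 1)" by (cases n) auto
  then have v0: "0 \<le> real n * q + real n * (real n - 1) * m\<^sup>2"
    using q(2) by (intro add_nonneg_nonneg mult_nonneg_nonneg[OF nn] mult_nonneg_nonneg) auto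
  let ?S = "\<lambda>xs. sum_list (map f xs)"
  have i1: "integrable ?R ?S"
    by (rule integrableI_nn_integral_finite[OF _ _ mom(1)]) (use s0 m in auto)
  have e1: "(\<integral>xs. ?S xs \<partial>?R) = real n * m"
    by (rule integral_eq_nn_integral[THEN trans]) (use s0 mom m in auto)
  have i2: "integrable ?R (\<lambda>xs. (?S xs)\<^sup>2)"
    by (rule integrableI_nn_integral_finite[OF _ _ mom(2)]) (use v0 in auto)
  have e2: "(\<integral>xs. (?S xs)\<^sup>2 \<partial>?R) = real n * q + real n * (real n - 1) * m\<^sup>2"
    by (rule integral_eq_nn_integral[THEN trans]) (use s0 mom v0 in auto)
  \<comment> \<open>This choice balances the two terms: the variance of the mean is at most
    \<open>t^2\<close>, so each contributes at most \<open>t / 2\<close>.\<close>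
  define t where "t = B / sqrt n"
  have t: "t > 0" using B n by (simp add: t_def)
  have t2: "t\<^sup>2 = B\<^sup>2 / n" by (simp add: t_def power_divide)
  let ?g = "\<lambda>xs. ((?S xs)\<^sup>2 / (real n)\<^sup>2 - 2 * m / real n * ?S xs + m\<^sup>2) / (2 * t) + t / 2"
  have "(\<integral>\<^sup>+xs. ennreal \<bar>mean f xs - m\<bar> \<partial>?R) \<le> (\<integral>\<^sup>+xs. ennreal (?g xs) \<partial>?R)"
  proof (rule nn_integral_mono_AE, rule AE_pmfI, rule ennreal_leI)
    fix xs assume "xs \<in> set_pmf (replicate_pmf n P)"
    then have l: "length xs = n" by (rule length_replicate_pmf)
    have "2 * t * \<bar>mean f xs - m\<bar> \<le> (mean f xs - m)\<^sup>2 + t\<^sup>2"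
      using sum_squares_bound[of t "\<bar>mean f xs - m\<bar>"] by simp
    then have "\<bar>mean f xs - m\<bar> \<le> ((mean f xs - m)\<^sup>2 + t\<^sup>2) / (2 * t)" using t by (simp add: field_simps)
    also have "\<dots> = ?g xs"
      using n t l by (simp add: mean_def power2_eq_square field_simps)
    finally show "\<bar>mean f xs - m\<bar> \<le> ?g xs" .
  qed
  also have "\<dots> = ennreal (\<integral>xs. ?g xs \<partial>?R)"
  proof (rule nn_integral_eq_integral)
    show "integrable ?R ?g" using i1 i2 by auto
    show "AE xs in ?R. 0 \<le> ?g xs"
    proof (rule AE_I2)
      fix xs
      have "?g xs = (?S xs / real n - m)\<^sup>2 / (2 * t) + t / 2" by (simp add: power2_diff power_divide)
      then show "0 \<le> ?g xs" using t by (simp add: add_nonneg_nonneg)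
    qed
  qed
  also have "(\<integral>xs. ?g xs \<partial>?R) = ((real n * q + real n * (real n - 1) * m\<^sup>2) / (real n)\<^sup>2 - 2 * m / real n * (real n * m) + m\<^sup>2) / (2 * t) + t / 2"
    using i1 i2 by (simp add: e1 e2)
  also have "\<dots> = (q - m\<^sup>2) / n / (2 * t) + t / 2"
    using n t by (simp add: field_simps power2_eq_square)
  also have "\<dots> \<le> B\<^sup>2 / n / (2 * t) + t / 2"
    using q t by (intro add_mono divide_right_mono order_refl) (auto intro: order_trans[of _ q])
  also have "\<dots> = t" unfolding t2[symmetric] using t by (simp add: power2_eq_square)
  finally show ?thesis by (simp add: t_def m_def ennreal_leI)
qed

text \<open>Covers \<open>B = 0\<close> too: enlarging \<open>B\<close> by \<open>e * sqrt n\<close>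
  makes it positive and changes the bound by \<open>e\<close> only.\<close>

lemma mean_deviation:
  fixes f :: "'a \<Rightarrow> real"
  assumes f0: "\<And>x. 0 \<le> f x" and B: "(\<integral>\<^sup>+x. ennreal ((f x)\<^sup>2) \<partial>measure_pmf P) \<le> ennreal (B\<^sup>2)" "0 \<le> B" and n: "0 < n"
  shows "(\<integral>\<^sup>+xs. ennreal \<bar>mean f xs - measure_pmf.expectation P f\<bar> \<partial>(replicate_pmf n P)) \<le> ennreal (B / sqrt n)"
proof (rule ennreal_le_epsilon)
  fix e :: real assume e: "0 < e"
  have "(\<integral>\<^sup>+x. ennreal ((f x)\<^sup>2) \<partial>measure_pmf P) \<le> ennreal ((B + e * sqrt n)\<^sup>2)"
    by (rule order_trans[OF B(1)], rule ennreal_leI, rule power_mono) (use B e in auto)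
  from mean_deviation_pos[OF f0 this _ n]
  have "(\<integral>\<^sup>+xs. ennreal \<bar>mean f xs - measure_pmf.expectation P f\<bar> \<partial>(replicate_pmf n P)) \<le> ennreal ((B + e * sqrt n) / sqrt n)"
    using B e n by (simp add: add_nonneg_pos)
  also have "(B + e * sqrt n) / sqrt n = B / sqrt n + e" using n by (simp add: field_simps)
  finally show "(\<integral>\<^sup>+xs. ennreal \<bar>mean f xs - measure_pmf.expectation P f\<bar> \<partial>(replicate_pmf n P)) \<le> ennreal (B / sqrt n) + ennreal e"
    using B e by simp
qed

lemma mean_two_samples:
  fixes f :: "'a \<Rightarrow> real"
  assumes f0: "\<And>x. 0 \<le> f x" and B: "(\<integral>\<^sup>+x. ennreal ((f x)\<^sup>2) \<partial>measure_pmf P) \<le> ennreal (B\<^sup>2)" "0 \<le> B" and n: "0 < n"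
  shows "(\<integral>\<^sup>+xs. \<integral>\<^sup>+ys. ennreal \<bar>mean f xs - mean f ys\<bar> \<partial>(replicate_pmf n P) \<partial>(replicate_pmf n P))
    \<le> ennreal (2 * B / sqrt n)"
proof -
  let ?R = "measure_pmf (replicate_pmf n P)" and ?m = "measure_pmf.expectation P f"
  have "(\<integral>\<^sup>+xs. \<integral>\<^sup>+ys. ennreal \<bar>mean f xs - mean f ys\<bar> \<partial>?R \<partial>?R)
      \<le> (\<integral>\<^sup>+xs. \<integral>\<^sup>+ys. ennreal \<bar>mean f xs - ?m\<bar> + ennreal \<bar>mean f ys - ?m\<bar> \<partial>?R \<partial>?R)"
    by (intro nn_integral_mono) (simp flip: ennreal_plus)
  also have "\<dots> = (\<integral>\<^sup>+xs. ennreal \<bar>mean f xs - ?m\<bar> \<partial>?R) + (\<integral>\<^sup>+xs. ennreal \<bar>mean f xs - ?m\<bar> \<partial>?R)"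
    by (simp add: nn_integral_add)
  also have "\<dots> \<le> ennreal (B / sqrt n) + ennreal (B / sqrt n)"
    by (intro add_mono mean_deviation assms)
  finally show ?thesis using B by (simp flip: ennreal_plus)
qed

text \<open>Chernoff's method. For values in \<open>[-1, 1]\<close> Hoeffding's lemma bounds the
  centred moment generating function at \<lambda> by \<open>exp (\<lambda>^2 / 2)\<close>, and
  \<lambda> = \<open>t\<close> minimises
  \<lambda>\<open>^2 / 2 -\<close>\<lambda>\<open>* t\<close>.\<close>

lemma mean_upper_tail:
  fixes f :: "'a \<Rightarrow> real"
  assumes f1: "\<And>x. \<bar>f x\<bar> \<le> 1" and t: "0 < t" and n: "0 < n"
  shows "emeasure (measure_pmf (replicate_pmf n P)) {xs. measure_pmf.expectation P f + t \<le> mean f xs} \<le> ennreal (exp (- (real n * t\<^sup>2 / 2)))"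
proof -
  define m where "m = measure_pmf.expectation P f"
  interpret interval_bounded_random_variable P f "-1" 1
    by unfold_locales (use f1 in \<open>auto simp: abs_le_iff minus_le_iff\<close>)
  have H: "(\<integral>\<^sup>+x. ennreal (exp (t * (f x - m))) \<partial>P) \<le> ennreal (exp (t\<^sup>2 / 2))"
    using Hoeffdings_lemma_nn_integral[OF t] by (simp add: m_def)
  have prod: "(\<integral>\<^sup>+xs. ennreal (exp (t * (sum_list (map f xs) - real k * m))) \<partial>(replicate_pmf k P)) \<le> ennreal (exp (real k * (t\<^sup>2 / 2)))" for k
  proof (induction k)
    case (Suc k)
    have "(\<integral>\<^sup>+xs. ennreal (exp (t * (sum_list (map f xs) - real (Suc k) * m))) \<partial>(replicate_pmf (Suc k) P))
      = (\<integral>\<^sup>+x. \<integral>\<^sup>+xs. ennreal (exp (t * (f x - m))) * ennreal (exp (t * (sum_list (map f xs) - real k * m))) \<partial>(replicate_pmf k P) \<partial>measure_pmf P)"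
      unfolding nn_integral_replicate_pmf_Suc
      by (intro nn_integral_cong) (simp add: algebra_simps flip: ennreal_mult exp_add)
    also have "\<dots> = (\<integral>\<^sup>+x. ennreal (exp (t * (f x - m))) \<partial>measure_pmf P) * (\<integral>\<^sup>+xs. ennreal (exp (t * (sum_list (map f xs) - real k * m))) \<partial>(replicate_pmf k P))"
      by (simp add: nn_integral_cmult nn_integral_multc)
    also have "\<dots> \<le> ennreal (exp (t\<^sup>2 / 2)) * ennreal (exp (real k * (t\<^sup>2 / 2)))"
      by (intro mult_mono H Suc.IH) auto
    also have "\<dots> = ennreal (exp (real (Suc k) * (t\<^sup>2 / 2)))"
      by (simp add: algebra_simps flip: ennreal_mult exp_add)
    finally show ?case .
  qed (simp add: nn_integral_return)
  let ?c = "exp (- (real n * t\<^sup>2))"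
  have "emeasure (measure_pmf (replicate_pmf n P)) {xs. m + t \<le> mean f xs}
      = (\<integral>\<^sup>+xs. indicator {xs. m + t \<le> mean f xs} xs \<partial>(replicate_pmf n P))" by simp
  also have "\<dots> \<le> (\<integral>\<^sup>+xs. ennreal ?c * ennreal (exp (t * (sum_list (map f xs) - real n * m))) \<partial>(replicate_pmf n P))"
  proof (rule nn_integral_mono_AE, rule AE_pmfI)
    fix xs assume "xs \<in> set_pmf (replicate_pmf n P)"
    then have l: "length xs = n" by (rule length_replicate_pmf)
    show "indicator {xs. m + t \<le> mean f xs} xs \<le> ennreal ?c * ennreal (exp (t * (sum_list (map f xs) - real n * m)))"
    proof (cases "m + t \<le> mean f xs")
      case True
      then have "real n * (m + t) \<le> sum_list (map f xs)" using n l by (simp add: mean_def field_simps)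
      then have "t * (real n * (m + t)) \<le> t * sum_list (map f xs)" using t by (intro mult_left_mono) auto
      then have "0 \<le> - (real n * t\<^sup>2) + t * (sum_list (map f xs) - real n * m)"
        by (simp add: algebra_simps power2_eq_square)
      then show ?thesis using True by (simp flip: ennreal_mult exp_add)
    qed simp
  qed
  also have "\<dots> \<le> ennreal ?c * ennreal (exp (real n * (t\<^sup>2 / 2)))"
    using prod[of n] by (subst nn_integral_cmult) (auto intro!: mult_left_mono)
  also have "\<dots> = ennreal (exp (- (real n * t\<^sup>2 / 2)))"
    by (simp add: algebra_simps flip: ennreal_mult exp_add)
  finally show ?thesis unfolding m_def .
qed

lemma mean_uminus: "mean (\<lambda>x. - f x) xs = - mean f xs"
proof -
  have "sum_list (map (\<lambda>x. - f x) xs) = - sum_list (map f xs)" by (induction xs) auto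
  then show ?thesis by (simp add: mean_def)
qed

section \<open>Soft threshold tests\<close>

text \<open>A linear ramp from 0 at \<theta>\<open>/2\<close> to 1 at \<theta>. A sharp threshold
  would be unstable for means close to it; the slope \<open>2 / \<theta>\<close> converts
  fluctuations of the mean into instability.\<close>

definition soft_test :: "real \<Rightarrow> real \<Rightarrow> real" where
  "soft_test \<theta> x = max 0 (min 1 (2 * x / \<theta> - 1))"

lemma soft_test_bounds: "0 \<le> soft_test \<theta> x" "soft_test \<theta> x \<le> 1"
  by (auto simp: soft_test_def)

lemma soft_test_lipschitz: "0 < \<theta> \<Longrightarrow> \<bar>soft_test \<theta> x - soft_test \<theta> y\<bar> \<le> 2 / \<theta> * \<bar>x - y\<bar>"
proof -
  assume "0 < \<theta>"
  have "\<bar>soft_test \<theta> x - soft_test \<theta> y\<bar> \<le> \<bar>2 * x / \<theta> - 2 * y / \<theta>\<bar>" unfolding soft_test_def by linarith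
  also have "2 * x / \<theta> - 2 * y / \<theta> = 2 / \<theta> * (x - y)" by (simp add: diff_divide_distrib algebra_simps)
  also have "\<bar>2 / \<theta> * (x - y)\<bar> = 2 / \<theta> * \<bar>x - y\<bar>" using \<open>0 < \<theta>\<close> by (simp only: abs_mult) simp
  finally show ?thesis .
qed

lemma soft_test_low: "0 < \<theta> \<Longrightarrow> x \<le> \<theta> / 2 \<Longrightarrow> soft_test \<theta> x = 0"
  by (simp add: soft_test_def field_simps)

lemma soft_test_high: "0 < \<theta> \<Longrightarrow> \<theta> \<le> x \<Longrightarrow> soft_test \<theta> x = 1"
  by (simp add: soft_test_def field_simps)

text \<open>The ramp starts at \<theta>\<open>/2\<close>, so a positive value needs a deviation of
  \<theta>\<open>/4\<close>, and \<open>(\<theta>/4)^2 / 2 = \<theta>^2 / 32\<close>. The next lemma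
  has the same gap at the upper end, between \<theta> and \<open>5 * \<theta> / 4\<close>.\<close>

lemma soft_test_mean_low:
  fixes f :: "'a \<Rightarrow> real"
  assumes f1: "\<And>x. \<bar>f x\<bar> \<le> 1" and \<theta>: "0 < \<theta>" and n: "0 < n" and m: "measure_pmf.expectation P f \<le> \<theta> / 4"
  shows "(\<integral>\<^sup>+xs. ennreal (soft_test \<theta> (mean f xs)) \<partial>(replicate_pmf n P)) \<le> ennreal (exp (- (real n * \<theta>\<^sup>2 / 32)))"
proof -
  let ?A = "{xs. measure_pmf.expectation P f + \<theta> / 4 \<le> mean f xs}"
  have "(\<integral>\<^sup>+xs. ennreal (soft_test \<theta> (mean f xs)) \<partial>(replicate_pmf n P))
      \<le> (\<integral>\<^sup>+xs. indicator ?A xs \<partial>(replicate_pmf n P))"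
  proof (rule nn_integral_mono)
    fix xs show "ennreal (soft_test \<theta> (mean f xs)) \<le> indicator ?A xs"
      using soft_test_low[OF \<theta>, of "mean f xs"] soft_test_bounds[of \<theta> "mean f xs"] m
      by (cases "mean f xs \<le> \<theta> / 2") (auto simp: indicator_def)
  qed
  also have "\<dots> \<le> ennreal (exp (- (real n * (\<theta> / 4)\<^sup>2 / 2)))"
    using mean_upper_tail[OF f1 _ n, of "\<theta> / 4" P] \<theta> by simp
  finally show ?thesis by (simp add: power_divide)
qed

lemma soft_test_mean_high:
  fixes f :: "'a \<Rightarrow> real"
  assumes f1: "\<And>x. \<bar>f x\<bar> \<le> 1" and \<theta>: "0 < \<theta>" and n: "0 < n" and m: "5 * \<theta> / 4 \<le> measure_pmf.expectation P f"
  shows "(\<integral>\<^sup>+xs. ennreal (1 - soft_test \<theta> (mean f xs)) \<partial>(replicate_pmf n P)) \<le> ennreal (exp (- (real n * \<theta>\<^sup>2 / 32)))"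
proof -
  let ?A = "{xs. measure_pmf.expectation P (\<lambda>x. - f x) + \<theta> / 4 \<le> mean (\<lambda>x. - f x) xs}"
  have "(\<integral>\<^sup>+xs. ennreal (1 - soft_test \<theta> (mean f xs)) \<partial>(replicate_pmf n P))
      \<le> (\<integral>\<^sup>+xs. indicator ?A xs \<partial>(replicate_pmf n P))"
  proof (rule nn_integral_mono)
    fix xs show "ennreal (1 - soft_test \<theta> (mean f xs)) \<le> indicator ?A xs"
      using soft_test_high[OF \<theta>, of "mean f xs"] soft_test_bounds[of \<theta> "mean f xs"] m
      by (cases "\<theta> \<le> mean f xs") (auto simp: indicator_def mean_uminus)
  qed
  also have "\<dots> \<le> ennreal (exp (- (real n * (\<theta> / 4)\<^sup>2 / 2)))"
    using mean_upper_tail[of "\<lambda>x. - f x", OF _ _ n, of "\<theta> / 4" P] \<theta> f1 by simp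
  finally show ?thesis by (simp add: power_divide)
qed

lemma soft_test_mean_stable:
  fixes f :: "'a \<Rightarrow> real"
  assumes f1: "\<And>x. \<bar>f x\<bar> \<le> 1" and \<theta>: "0 < \<theta>" and n: "0 < n"
  shows "(\<integral>\<^sup>+xs. \<integral>\<^sup>+ys. ennreal \<bar>soft_test \<theta> (mean f xs) - soft_test \<theta> (mean f ys)\<bar>
      \<partial>(replicate_pmf n P) \<partial>(replicate_pmf n P)) \<le> ennreal (8 / (\<theta> * sqrt n))"
proof -
  \<comment> \<open>The shift by 1 makes the function nonnegative with values in
    \<open>[0, 2]\<close>, so the deviation bound applies with \<open>B = 2\<close>; it cancels in
    differences of means.\<close>
  let ?R = "measure_pmf (replicate_pmf n P)" and ?f = "\<lambda>x. f x + 1"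
  have shift: "mean ?f xs = mean f xs + 1" if "xs \<in> set_pmf (replicate_pmf n P)" for xs
    using length_replicate_pmf[OF that] n by (simp add: mean_def sum_list_map_shift add_divide_distrib)
  have "(\<integral>\<^sup>+xs. \<integral>\<^sup>+ys. ennreal \<bar>soft_test \<theta> (mean f xs) - soft_test \<theta> (mean f ys)\<bar> \<partial>?R \<partial>?R)
     \<le> (\<integral>\<^sup>+xs. \<integral>\<^sup>+ys. ennreal (2 / \<theta>) * ennreal \<bar>mean ?f xs - mean ?f ys\<bar> \<partial>?R \<partial>?R)"
    using soft_test_lipschitz[OF \<theta>] \<theta>
    by (intro nn_integral_mono_AE AE_pmfI) (simp add: shift ennreal_leI flip: ennreal_mult)
  also have "\<dots> = ennreal (2 / \<theta>) * (\<integral>\<^sup>+xs. \<integral>\<^sup>+ys. ennreal \<bar>mean ?f xs - mean ?f ys\<bar> \<partial>?R \<partial>?R)"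
    by (simp add: nn_integral_cmult)
  also have "\<dots> \<le> ennreal (2 / \<theta>) * ennreal (2 * 2 / sqrt n)"
  proof (intro mult_left_mono mean_two_samples n)
    fix x show "0 \<le> f x + 1" using f1[of x] by linarith
  next
    have "(f x + 1)\<^sup>2 \<le> 2\<^sup>2" for x using f1[of x] by (intro power_mono) linarith+
    then have "(\<integral>\<^sup>+x. ennreal ((f x + 1)\<^sup>2) \<partial>measure_pmf P) \<le> (\<integral>\<^sup>+x. ennreal (2\<^sup>2) \<partial>measure_pmf P)"
      by (intro nn_integral_mono ennreal_leI)
    then show "(\<integral>\<^sup>+x. ennreal ((f x + 1)\<^sup>2) \<partial>measure_pmf P) \<le> ennreal (2\<^sup>2)"
      by (simp del: power2_eq_square)
  qed auto
  also have "\<dots> = ennreal (8 / (\<theta> * sqrt n))" using \<theta> by (simp flip: ennreal_mult)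
  finally show ?thesis .
qed

section \<open>Kernels driven by discrete randomness\<close>

lemma measure_pmf_in_prob_algebra: "measure_pmf p \<in> space (prob_algebra (count_space UNIV))"
  by (auto simp: space_prob_algebra measure_pmf.prob_space_axioms)

lemma measurable_count_space_prob_algebra:
  "(\<And>d. F d \<in> space (prob_algebra M)) \<Longrightarrow> F \<in> count_space UNIV \<rightarrow>\<^sub>M prob_algebra M"
  by simp

lemma bind_in_prob_algebra:
  assumes "P \<in> space (prob_algebra M)" "K \<in> M \<rightarrow>\<^sub>M prob_algebra N"
  shows "P \<bind> K \<in> space (prob_algebra N)"
  using assms by (auto intro!: prob_space_bind' sets_bind' simp: space_prob_algebra)

lemma emeasure_bind_prob_algebra:
  assumes P: "P \<in> space (prob_algebra M)" and K: "K \<in> M \<rightarrow>\<^sub>M prob_algebra N" and E: "E \<in> sets N"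
  shows "emeasure (P \<bind> K) E = (\<integral>\<^sup>+x. emeasure (K x) E \<partial>P)"
  using space_prob_algebraD[OF P] K
  by (intro emeasure_bind[OF _ _ E])
    (auto simp: prob_space.not_empty measurable_cong_sets[OF space_prob_algebraD(2)[OF P] refl] intro!: measurable_prob_algebraD)

lemma bind_pmf_measure_in_prob_algebra:
  assumes "\<And>d. F d \<in> space (prob_algebra M)"
  shows "measure_pmf p \<bind> F \<in> space (prob_algebra M)"
  by (rule bind_in_prob_algebra[OF measure_pmf_in_prob_algebra measurable_count_space_prob_algebra[OF assms]])

lemma emeasure_bind_pmf_measure:
  assumes "\<And>d. F d \<in> space (prob_algebra M)" "E \<in> sets M"
  shows "emeasure (measure_pmf p \<bind> F) E = (\<integral>\<^sup>+d. emeasure (F d) E \<partial>measure_pmf p)"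
  by (rule emeasure_bind_prob_algebra[OF measure_pmf_in_prob_algebra measurable_count_space_prob_algebra[OF assms(1)] assms(2)])

text \<open>The quantity bounded in \<open>tv_indistinguishable\<close>, for an arbitrary discrete
  input in place of a sample. The input may later contain noise as well as data.\<close>

definition instability :: "'d pmf \<Rightarrow> ('d \<Rightarrow> 'm measure) \<Rightarrow> ennreal" where
  "instability P F = (\<integral>\<^sup>+d. \<integral>\<^sup>+d'. ennreal (tv_dist (F d) (F d')) \<partial>measure_pmf P \<partial>measure_pmf P)"

text \<open>Write both mixtures over the product law, one reading the first and the other the second
  coordinate: the bound is that of the independent coupling.\<close>

lemma tv_dist_bind_pmf:
  fixes F :: "'d \<Rightarrow> 'm measure"
  assumes F: "\<And>d. F d \<in> space (prob_algebra M)"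
  shows "ennreal (tv_dist (measure_pmf p \<bind> F) (measure_pmf q \<bind> F))
    \<le> (\<integral>\<^sup>+d. \<integral>\<^sup>+d'. ennreal (tv_dist (F d) (F d')) \<partial>measure_pmf q \<partial>measure_pmf p)"
proof -
  note mF = measurable_count_space_prob_algebra[of F M, OF F]
  have "measure_pmf (map_pmf f r) \<bind> F = measure_pmf r \<bind> (\<lambda>x. F (f x))" for f :: "'d \<times> 'd \<Rightarrow> 'd" and r
    unfolding map_pmf_rep_eq by (rule bind_distr[OF _ measurable_prob_algebraD[OF mF]]) auto
  from this[of fst "pair_pmf p q"] this[of snd "pair_pmf p q"]
  have eq: "measure_pmf p \<bind> F = measure_pmf (pair_pmf p q) \<bind> (\<lambda>x. F (fst x))"
    "measure_pmf q \<bind> F = measure_pmf (pair_pmf p q) \<bind> (\<lambda>x. F (snd x))"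
    by (simp_all add: map_fst_pair_pmf map_snd_pair_pmf)
  show ?thesis unfolding eq
    using tv_dist_bind[OF measure_pmf_in_prob_algebra measure_pmf_in_prob_algebra
        measurable_count_space_prob_algebra[of "\<lambda>x. F (fst x)" M] measurable_count_space_prob_algebra[of "\<lambda>x. F (snd x)" M],
        of "pair_pmf p q" "pair_pmf p q"] F
    by (simp add: nn_integral_pair_pmf')
qed

text \<open>A learner that generates the input of \<open>F\<close> internally from its sample is at
  least as stable as \<open>F\<close> is on that input: mixing before comparing can only lower the
  distance.\<close>

lemma instability_bind_pmf:
  assumes F: "\<And>d. F d \<in> space (prob_algebra M)"
  shows "instability P (\<lambda>s. measure_pmf (G s) \<bind> F) \<le> instability (bind_pmf P G) F"
proof -
  have "instability P (\<lambda>s. measure_pmf (G s) \<bind> F)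
    \<le> (\<integral>\<^sup>+s. \<integral>\<^sup>+s'. \<integral>\<^sup>+d. \<integral>\<^sup>+d'. ennreal (tv_dist (F d) (F d')) \<partial>measure_pmf (G s') \<partial>measure_pmf (G s) \<partial>measure_pmf P \<partial>measure_pmf P)"
    unfolding instability_def by (intro nn_integral_mono tv_dist_bind_pmf[OF F])
  also have "\<dots> = (\<integral>\<^sup>+s. \<integral>\<^sup>+d. \<integral>\<^sup>+s'. \<integral>\<^sup>+d'. ennreal (tv_dist (F d) (F d')) \<partial>measure_pmf (G s') \<partial>measure_pmf P \<partial>measure_pmf (G s) \<partial>measure_pmf P)"
    by (intro nn_integral_cong nn_integral_pmf_swap(1))
      (auto intro: prob_space_imp_sigma_finite measure_pmf.prob_space_axioms)
  finally show ?thesis by (simp add: instability_def)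
qed

section \<open>Rejection sampling\<close>

lemma nn_integral_if_accepted:
  fixes P :: "'a pmf"
  assumes "set_pmf P \<inter> Collect a \<noteq> {}"
  shows "(\<integral>\<^sup>+x. (if a x then u x else W) \<partial>measure_pmf P)
    = emeasure (measure_pmf P) (Collect a) * (\<integral>\<^sup>+x. u x \<partial>(cond_pmf P (Collect a)))
      + W * emeasure (measure_pmf P) (- Collect a)"
proof -
  have pos: "emeasure (measure_pmf P) (Collect a) \<noteq> 0"
    using assms by (auto simp: measure_pmf.emeasure_eq_measure measure_pmf_zero_iff)
  have "(\<integral>\<^sup>+x. (if a x then u x else W) \<partial>measure_pmf P)
     = (\<integral>\<^sup>+x. u x * indicator (Collect a) x + W * indicator (- Collect a) x \<partial>measure_pmf P)"
    by (intro nn_integral_cong) (auto simp: indicator_def)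
  also have "\<dots> = (\<integral>\<^sup>+x. u x * indicator (Collect a) x \<partial>measure_pmf P) + W * emeasure (measure_pmf P) (- Collect a)"
    by (simp add: nn_integral_add nn_integral_cmult)
  also have "(\<integral>\<^sup>+x. u x * indicator (Collect a) x \<partial>measure_pmf P)
     = emeasure (measure_pmf P) (Collect a) * (\<integral>\<^sup>+x. u x \<partial>(cond_pmf P (Collect a)))"
    using pos unfolding cond_pmf.rep_eq[OF assms]
    by (subst nn_integral_uniform_measure)
      (auto simp: ennreal_times_divide mult.commute[of "emeasure _ _"] mult_divide_eq_ennreal)
  finally show ?thesis .
qed

text \<open>The first \<open>m\<close> accepted entries of an i.i.d. sequence are i.i.d. from the
  conditional law. Runs with fewer than \<open>m\<close> acceptances count as 0, hence the
  inequality.\<close>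

lemma nn_integral_take_filter_le:
  fixes P :: "'a pmf"
  assumes ne: "set_pmf P \<inter> Collect a \<noteq> {}"
  shows "(\<integral>\<^sup>+xs. (if m \<le> length (filter a xs) then F (take m (filter a xs)) else 0) \<partial>(replicate_pmf N P))
    \<le> (\<integral>\<^sup>+T. F T \<partial>(replicate_pmf m (cond_pmf P (Collect a))))"
proof (induction N arbitrary: m F)
  case 0
  show ?case by (cases m) (auto simp: nn_integral_return)
next
  case (Suc N)
  show ?case
  proof (cases m)
    case 0
    then show ?thesis by (simp add: nn_integral_return measure_pmf.emeasure_space_1)
  next
    case (Suc m')
    let ?C = "cond_pmf P (Collect a)"
    let ?u = "\<lambda>x. \<integral>\<^sup>+T. F (x # T) \<partial>(replicate_pmf m' ?C)"
    let ?W = "\<integral>\<^sup>+x. ?u x \<partial>measure_pmf ?C"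
    have W: "(\<integral>\<^sup>+T. F T \<partial>(replicate_pmf m ?C)) = ?W"
      unfolding Suc nn_integral_replicate_pmf_Suc ..
    have "(\<integral>\<^sup>+xs. (if m \<le> length (filter a xs) then F (take m (filter a xs)) else 0) \<partial>(replicate_pmf (Suc N) P))
       \<le> (\<integral>\<^sup>+x. (if a x then ?u x else ?W) \<partial>measure_pmf P)"
      unfolding nn_integral_replicate_pmf_Suc
    proof (rule nn_integral_mono)
      fix x
      show "(\<integral>\<^sup>+xs. (if m \<le> length (filter a (x # xs)) then F (take m (filter a (x # xs))) else 0) \<partial>(replicate_pmf N P))
          \<le> (if a x then ?u x else ?W)"
        using Suc.IH[of m' "\<lambda>T. F (x # T)"] Suc.IH[of m F] W by (auto simp: Suc cong: if_cong)
    qed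
    \<comment> \<open>An accepted first entry has the conditional law, so it averages to
      \<open>?W\<close>; a rejected one leaves the same problem with one draw less, again bounded by
      \<open>?W\<close>.\<close>
    also have "\<dots> = emeasure (measure_pmf P) (Collect a) * ?W + ?W * emeasure (measure_pmf P) (- Collect a)"
      by (rule nn_integral_if_accepted[OF ne])
    also have "\<dots> = ?W * (emeasure (measure_pmf P) (Collect a) + emeasure (measure_pmf P) (- Collect a))"
      by (simp add: distrib_right mult.commute)
    also have "emeasure (measure_pmf P) (Collect a) + emeasure (measure_pmf P) (- Collect a) = 1"
      by (subst plus_emeasure) auto
    finally show ?thesis unfolding W by simp
  qed
qed

section \<open>Laws generated from plain examples\<close>

text \<open>\<open>G\<close> is chosen before \<open>D\<close>: it may randomize, but learns about
  \<open>D\<close> only through the \<open>m\<close> examples. This is what allows a learner to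
  perform the sampling itself.\<close>

definition simulable :: "nat \<Rightarrow> ('a pmf \<Rightarrow> 'd pmf) \<Rightarrow> bool" where
  "simulable m P \<longleftrightarrow> (\<exists>G. \<forall>D. P D = bind_pmf (replicate_pmf m D) G)"

lemma simulable_replicate_pmf: "simulable n (replicate_pmf n)"
  unfolding simulable_def by (rule exI[of _ return_pmf]) (simp add: bind_return_pmf')

lemma simulable_noise: "simulable 1 (\<lambda>D. pair_pmf D U)"
  unfolding simulable_def pair_pmf_def
  by (rule exI[of _ "\<lambda>xs. bind_pmf U (\<lambda>y. return_pmf (hd xs, y))"]) (simp add: bind_assoc_pmf bind_return_pmf)

lemma simulable_pair:
  assumes "simulable a P" "simulable b Q"
  shows "simulable (a + b) (\<lambda>D. pair_pmf (P D) (Q D))"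
proof -
  obtain G H where G: "\<And>D. P D = bind_pmf (replicate_pmf a D) G" and H: "\<And>D. Q D = bind_pmf (replicate_pmf b D) H"
    using assms unfolding simulable_def by metis
  have "pair_pmf (P D) (Q D) = bind_pmf (replicate_pmf (a + b) D) (\<lambda>xs. pair_pmf (G (take a xs)) (H (drop a xs)))" for D
  proof -
    have "bind_pmf (replicate_pmf (a + b) D) (\<lambda>xs. pair_pmf (G (take a xs)) (H (drop a xs)))
      = bind_pmf (replicate_pmf a D) (\<lambda>xs. bind_pmf (replicate_pmf b D) (\<lambda>ys. pair_pmf (G (take a (xs @ ys))) (H (drop a (xs @ ys)))))"
      by (simp add: replicate_pmf_distrib bind_assoc_pmf bind_return_pmf)
    also have "\<dots> = bind_pmf (replicate_pmf a D) (\<lambda>xs. bind_pmf (replicate_pmf b D) (\<lambda>ys. pair_pmf (G xs) (H ys)))"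
      by (intro bind_pmf_cong refl) (simp add: length_replicate_pmf)
    also have "\<dots> = pair_pmf (P D) (Q D)"
      unfolding G H pair_pmf_def bind_assoc_pmf
      by (intro bind_pmf_cong refl) (rule bind_commute_pmf)
    finally show ?thesis ..
  qed
  then show ?thesis unfolding simulable_def by blast
qed

lemma simulable_map: "simulable a P \<Longrightarrow> simulable a (\<lambda>D. map_pmf f (P D))"
  unfolding simulable_def by (metis map_bind_pmf)

lemma simulable_replicate:
  assumes "simulable a P"
  shows "simulable (k * a) (\<lambda>D. replicate_pmf k (P D))"
proof (induction k)
  case 0
  show ?case unfolding simulable_def by (rule exI[of _ "\<lambda>_. return_pmf []"]) simp
next
  case (Suc k)
  have "simulable (a + k * a) (\<lambda>D. map_pmf (\<lambda>(x, xs). x # xs) (pair_pmf (P D) (replicate_pmf k (P D))))"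
    by (rule simulable_map[OF simulable_pair[OF assms Suc.IH]])
  moreover have "map_pmf (\<lambda>(x, xs). x # xs) (pair_pmf (P D) (replicate_pmf k (P D))) = replicate_pmf (Suc k) (P D)" for D
    by (simp add: pair_pmf_def map_bind_pmf)
  ultimately show ?case by simp
qed

section \<open>Mixtures of two laws\<close>

definition mix :: "real \<Rightarrow> 'm measure \<Rightarrow> 'm measure \<Rightarrow> 'm measure" where
  "mix p P Q = measure_pmf (bernoulli_pmf p) \<bind> (\<lambda>b. if b then P else Q)"

lemma mix_in_prob_algebra:
  "P \<in> space (prob_algebra M) \<Longrightarrow> Q \<in> space (prob_algebra M) \<Longrightarrow> mix p P Q \<in> space (prob_algebra M)"
  unfolding mix_def by (rule bind_pmf_measure_in_prob_algebra) auto

lemma emeasure_mix: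
  assumes "P \<in> space (prob_algebra M)" "Q \<in> space (prob_algebra M)" "0 \<le> p" "p \<le> 1" "E \<in> sets M"
  shows "emeasure (mix p P Q) E = ennreal p * emeasure P E + ennreal (1 - p) * emeasure Q E"
  unfolding mix_def using assms
  by (subst emeasure_bind_pmf_measure[where M=M]) (auto simp: mult.commute)

lemma measure_mix:
  assumes "P \<in> space (prob_algebra M)" "Q \<in> space (prob_algebra M)" "0 \<le> p" "p \<le> 1" "E \<in> sets M"
  shows "measure (mix p P Q) E = p * measure P E + (1 - p) * measure Q E"
proof -
  interpret P: prob_space P by (rule space_prob_algebraD[OF assms(1)])
  interpret Q: prob_space Q by (rule space_prob_algebraD[OF assms(2)])
  show ?thesis
    unfolding measure_def[of "mix p P Q"] emeasure_mix[OF assms] using assms(3,4)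
    by (simp add: P.emeasure_eq_measure Q.emeasure_eq_measure flip: ennreal_mult ennreal_plus)
qed

lemma measurable_mix:
  assumes p [measurable]: "p \<in> borel_measurable S" and p01: "\<And>s. 0 \<le> p s" "\<And>s. p s \<le> 1"
    and K: "K \<in> S \<rightarrow>\<^sub>M prob_algebra M" and L: "L \<in> S \<rightarrow>\<^sub>M prob_algebra M"
  shows "(\<lambda>s. mix (p s) (K s) (L s)) \<in> S \<rightarrow>\<^sub>M prob_algebra M"
proof (rule measurable_prob_algebraI)
  have sp: "K s \<in> space (prob_algebra M)" "L s \<in> space (prob_algebra M)" if "s \<in> space S" for s
    using that K L by (auto dest: measurable_space)
  note mx = space_prob_algebraD[OF mix_in_prob_algebra[OF sp]]
  show "prob_space (mix (p s) (K s) (L s))" if "s \<in> space S" for s using mx(1) that by blast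
  show "(\<lambda>s. mix (p s) (K s) (L s)) \<in> S \<rightarrow>\<^sub>M subprob_algebra M"
  proof (rule measurable_subprob_algebra)
    fix E assume E: "E \<in> sets M"
    have [measurable]: "(\<lambda>s. emeasure (K s) E) \<in> borel_measurable S" "(\<lambda>s. emeasure (L s) E) \<in> borel_measurable S"
      using measurable_compose[OF measurable_prob_algebraD[OF K] measurable_emeasure_subprob_algebra[OF E]]
        measurable_compose[OF measurable_prob_algebraD[OF L] measurable_emeasure_subprob_algebra[OF E]] by auto
    show "(\<lambda>s. emeasure (mix (p s) (K s) (L s)) E) \<in> borel_measurable S"
      by (subst measurable_cong[OF emeasure_mix[OF sp p01 E]]) auto
  qed (auto simp: mx(1,2) prob_space_imp_subprob_space)
qed

text \<open>Change the coin and the components separately. The coin acts on a difference of two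
  probabilities, at most 1 in absolute value, so it costs \<bar>\<open>p - p'\<close>\<bar>
  once.\<close>

lemma tv_dist_mix:
  assumes P: "P \<in> space (prob_algebra M)" "P' \<in> space (prob_algebra M)"
    and Q: "Q \<in> space (prob_algebra M)" "Q' \<in> space (prob_algebra M)"
    and p: "0 \<le> p" "p \<le> 1" "0 \<le> p'" "p' \<le> 1"
  shows "tv_dist (mix p P Q) (mix p' P' Q') \<le> \<bar>p - p'\<bar> + p * tv_dist P P' + (1 - p) * tv_dist Q Q'"
proof (rule tv_dist_le)
  fix E assume "E \<in> sets (mix p P Q)"
  then have E: "E \<in> sets M" using space_prob_algebraD(2)[OF mix_in_prob_algebra[OF P(1) Q(1)]] by simp
  note D = space_prob_algebraD[OF P(1)] space_prob_algebraD[OF P(2)] space_prob_algebraD[OF Q(1)] space_prob_algebraD[OF Q(2)]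
  have 1: "p * \<bar>measure P E - measure P' E\<bar> \<le> p * tv_dist P P'"
    by (intro mult_left_mono measure_diff_le_tv_dist p) (use D E in auto)
  have 2: "(1 - p) * \<bar>measure Q E - measure Q' E\<bar> \<le> (1 - p) * tv_dist Q Q'"
    by (intro mult_left_mono measure_diff_le_tv_dist p) (use D E p in auto)
  have "\<bar>measure P' E - measure Q' E\<bar> \<le> 1"
    using prob_space.prob_le_1[OF D(4), of E] prob_space.prob_le_1[OF D(10), of E]
      measure_nonneg[of P' E] measure_nonneg[of Q' E] by linarith
  then have 3: "\<bar>(p - p') * (measure P' E - measure Q' E)\<bar> \<le> \<bar>p - p'\<bar>"
    unfolding abs_mult by (intro mult_left_le) auto
  have "measure (mix p P Q) E - measure (mix p' P' Q') E
    = p * (measure P E - measure P' E) + (1 - p) * (measure Q E - measure Q' E) + (p - p') * (measure P' E - measure Q' E)"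
    unfolding measure_mix[OF P(1) Q(1) p(1,2) E] measure_mix[OF P(2) Q(2) p(3,4) E] by (simp add: algebra_simps)
  also have "\<bar>\<dots>\<bar> \<le> p * \<bar>measure P E - measure P' E\<bar> + (1 - p) * \<bar>measure Q E - measure Q' E\<bar> + \<bar>(p - p') * (measure P' E - measure Q' E)\<bar>"
    using p by (intro order_trans[OF abs_triangle_ineq] add_mono) (auto simp: abs_mult)
  finally show "\<bar>measure (mix p P Q) E - measure (mix p' P' Q') E\<bar> \<le> \<bar>p - p'\<bar> + p * tv_dist P P' + (1 - p) * tv_dist Q Q'"
    using 1 2 3 by linarith
qed

text \<open>The distance of the first components may be weighted by \<open>p\<close> or by
  \<open>p'\<close>, so it disappears when either is 0. This lets a boosting round disregard samples
  on which it certainly stops.\<close>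

lemma tv_dist_mix_same:
  assumes P: "P \<in> space (prob_algebra M)" "P' \<in> space (prob_algebra M)" and Q: "Q \<in> space (prob_algebra M)"
    and p: "0 \<le> p" "p \<le> 1" "0 \<le> p'" "p' \<le> 1"
  shows "tv_dist (mix p P Q) (mix p' P' Q) \<le> \<bar>p - p'\<bar> + (if 0 < p \<and> 0 < p' then tv_dist P P' else 0)"
proof -
  note D = space_prob_algebraD[OF P(1)] space_prob_algebraD[OF P(2)]
  have t0: "0 \<le> tv_dist P P'" by (rule tv_dist_nonneg) (use D in auto)
  have a: "tv_dist (mix p P Q) (mix p' P' Q) \<le> \<bar>p - p'\<bar> + p * tv_dist P P'"
    using tv_dist_mix[OF P Q Q p] by simp
  have "tv_dist (mix p P Q) (mix p' P' Q) = tv_dist (mix p' P' Q) (mix p P Q)"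
    using space_prob_algebraD(2)[OF mix_in_prob_algebra[OF P(1) Q]] space_prob_algebraD(2)[OF mix_in_prob_algebra[OF P(2) Q]]
    by (intro tv_dist_commute) simp
  also have "\<dots> \<le> \<bar>p - p'\<bar> + p' * tv_dist P P'"
    using tv_dist_mix[OF P(2,1) Q Q p(3,4,1,2)] tv_dist_commute[of P P'] D by (simp add: abs_minus_commute)
  finally have b: "tv_dist (mix p P Q) (mix p' P' Q) \<le> \<bar>p - p'\<bar> + p' * tv_dist P P'" .
  have "p * tv_dist P P' \<le> tv_dist P P'" using p t0 by (simp add: mult_left_le_one_le)
  then show ?thesis using a b p by (auto simp: less_le split: if_splits)
qed

section \<open>Common densities and the averaged overlap\<close>

text \<open>A countable mixture of all the laws with positive weights dominates each of them, and
  Radon-Nikodym gives the densities. They are made 0 off \<open>I\<close> so that later formulas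
  make sense for every index.\<close>

lemma common_density:
  fixes A :: "'i \<Rightarrow> 'm measure"
  assumes I: "countable I" "I \<noteq> {}" and A: "\<And>i. i \<in> I \<Longrightarrow> A i \<in> space (prob_algebra M)"
  obtains \<mu> f where "\<mu> \<in> space (prob_algebra M)" "\<And>i. f i \<in> borel_measurable M" "\<And>i x. 0 \<le> (f i x :: real)"
    "\<And>i. i \<in> I \<Longrightarrow> A i = density \<mu> (\<lambda>x. ennreal (f i x))" "\<And>i x. i \<notin> I \<Longrightarrow> f i x = 0"
proof -
  define J where "J n = A (from_nat_into I n)" for n
  have J: "J n \<in> space (prob_algebra M)" for n
    unfolding J_def by (rule A) (rule from_nat_into[OF I(2)])
  define \<mu> where "\<mu> = measure_pmf (geometric_pmf (1/2)) \<bind> J"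
  have \<mu>: "\<mu> \<in> space (prob_algebra M)" unfolding \<mu>_def by (rule bind_pmf_measure_in_prob_algebra[OF J])
  note \<mu>D = space_prob_algebraD[OF \<mu>]
  interpret \<mu>: prob_space \<mu> by (rule \<mu>D)
  have ac: "absolutely_continuous \<mu> (A i)" if i: "i \<in> I" for i
    unfolding absolutely_continuous_def
  proof
    fix N assume "N \<in> null_sets \<mu>"
    then have N: "N \<in> sets M" "emeasure \<mu> N = 0" by (auto simp: \<mu>D)
    obtain n where n: "A i = J n" using from_nat_into_surj[OF I(1) i] by (auto simp: J_def)
    have "(\<integral>\<^sup>+n. emeasure (J n) N \<partial>(geometric_pmf (1/2))) = 0"
      using N(2) unfolding \<mu>_def emeasure_bind_pmf_measure[OF J N(1)] .
    then have "AE n in measure_pmf (geometric_pmf (1/2)). emeasure (J n) N = 0"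
      by (simp add: nn_integral_0_iff_AE)
    then have "emeasure (J n) N = 0" by (simp add: AE_measure_pmf_iff set_pmf_geometric)
    then show "N \<in> null_sets (A i)" using N(1) n space_prob_algebraD(2)[OF J, of n] by auto
  qed
  define f where "f i x = (if i \<in> I then enn2real (RN_deriv \<mu> (A i) x) else 0)" for i x
  have RN [measurable]: "RN_deriv \<mu> (A i) \<in> borel_measurable M" for i
    using borel_measurable_RN_deriv[of \<mu> "A i"] by (simp add: measurable_cong_sets[OF \<mu>D(2) refl])
  have [measurable]: "f i \<in> borel_measurable M" for i
    unfolding f_def by measurable
  have "A i = density \<mu> (\<lambda>x. ennreal (f i x))" if i: "i \<in> I" for i
  proof -
    note AD = space_prob_algebraD[OF A[OF i]]
    have "A i = density \<mu> (RN_deriv \<mu> (A i))"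
      by (rule \<mu>.density_RN_deriv[symmetric]) (use ac i AD \<mu>D in auto)
    also have "\<dots> = density \<mu> (\<lambda>x. ennreal (f i x))"
    proof (rule density_cong)
      have "AE x in \<mu>. RN_deriv \<mu> (A i) x \<noteq> \<infinity>"
        by (rule \<mu>.RN_deriv_finite) (use ac i AD \<mu>D in \<open>auto intro: prob_space_imp_sigma_finite\<close>)
      then show "AE x in \<mu>. RN_deriv \<mu> (A i) x = ennreal (f i x)"
        by eventually_elim (use i in \<open>simp add: f_def less_top\<close>)
    qed (auto simp: measurable_cong_sets[OF \<mu>D(2) refl])
    finally show ?thesis .
  qed
  then show thesis by (intro that[of \<mu> f] \<mu>) (auto simp: f_def)
qed

lemma nn_integral_mean:
  assumes g: "\<And>x. 0 \<le> g x" and k: "0 < k"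
  shows "(\<integral>\<^sup>+xs. ennreal (mean g xs) \<partial>(replicate_pmf k P)) = (\<integral>\<^sup>+x. ennreal (g x) \<partial>measure_pmf P)"
proof -
  have s0: "0 \<le> sum_list (map g xs)" for xs using g by (induction xs) auto
  have S: "(\<integral>\<^sup>+xs. ennreal (sum_list (map g xs)) \<partial>(replicate_pmf n P)) = of_nat n * (\<integral>\<^sup>+x. ennreal (g x) \<partial>measure_pmf P)" for n
  proof (induction n)
    case (Suc n)
    have "(\<integral>\<^sup>+xs. ennreal (sum_list (map g xs)) \<partial>(replicate_pmf (Suc n) P))
      = (\<integral>\<^sup>+x. \<integral>\<^sup>+xs. ennreal (g x) + ennreal (sum_list (map g xs)) \<partial>(replicate_pmf n P) \<partial>measure_pmf P)"
      unfolding nn_integral_replicate_pmf_Suc using g s0 by simp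
    also have "\<dots> = (\<integral>\<^sup>+x. ennreal (g x) \<partial>measure_pmf P) + of_nat n * (\<integral>\<^sup>+x. ennreal (g x) \<partial>measure_pmf P)"
      by (simp add: nn_integral_add Suc.IH)
    finally show ?case by (simp add: distrib_right)
  qed (simp add: nn_integral_return)
  have "(\<integral>\<^sup>+xs. ennreal (mean g xs) \<partial>(replicate_pmf k P))
    = (\<integral>\<^sup>+xs. ennreal (1 / real k) * ennreal (sum_list (map g xs)) \<partial>(replicate_pmf k P))"
    using s0 by (intro nn_integral_cong_AE AE_pmfI) (simp add: mean_def length_replicate_pmf flip: ennreal_mult)
  also have "\<dots> = ennreal (1 / real k) * (of_nat k * (\<integral>\<^sup>+x. ennreal (g x) \<partial>measure_pmf P))"
    by (simp add: nn_integral_cmult S)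
  also have "\<dots> = (\<integral>\<^sup>+x. ennreal (g x) \<partial>measure_pmf P)"
    using k by (simp add: ennreal_of_nat_eq_real_of_nat flip: mult.assoc ennreal_mult)
  finally show ?thesis .
qed

text \<open>The \<open>L^1\<close> bound without the factor 1/2, which would only improve
  constants.\<close>

lemma tv_dist_density_le:
  assumes [measurable]: "g \<in> borel_measurable \<mu>" "g' \<in> borel_measurable \<mu>"
    and g: "\<And>x. 0 \<le> g x" "\<And>x. 0 \<le> (g' x :: real)"
    and p: "prob_space (density \<mu> g)" "prob_space (density \<mu> g')"
  shows "ennreal (tv_dist (density \<mu> g) (density \<mu> g')) \<le> (\<integral>\<^sup>+x. ennreal \<bar>g x - g' x\<bar> \<partial>\<mu>)" (is "_ \<le> ?R")
proof (cases ?R)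
  case (real r)
  interpret A: prob_space "density \<mu> g" by (rule p)
  interpret B: prob_space "density \<mu> g'" by (rule p)
  have le: "emeasure (density \<mu> a) E \<le> emeasure (density \<mu> b) E + (\<integral>\<^sup>+x. ennreal \<bar>a x - b x\<bar> \<partial>\<mu>)"
    if [measurable]: "E \<in> sets \<mu>" "a \<in> borel_measurable \<mu>" "b \<in> borel_measurable \<mu>" and b: "\<And>x. 0 \<le> b x" for a b :: "_ \<Rightarrow> real" and E
  proof -
    have "emeasure (density \<mu> a) E \<le> (\<integral>\<^sup>+x. ennreal (b x) * indicator E x + ennreal \<bar>a x - b x\<bar> \<partial>\<mu>)"
      using b by (subst emeasure_density, simp, simp, intro nn_integral_mono)
        (auto simp: indicator_def ennreal_leI simp flip: ennreal_plus)
    then show ?thesis by (subst (asm) nn_integral_add) (auto simp: emeasure_density)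
  qed
  have "tv_dist (density \<mu> g) (density \<mu> g') \<le> r"
  proof (rule tv_dist_le)
    fix E assume "E \<in> sets (density \<mu> g)"
    then have E: "E \<in> sets \<mu>" by simp
    have "measure (density \<mu> g) E \<le> measure (density \<mu> g') E + r"
      using le[OF E, of g g'] g real by (simp add: A.emeasure_eq_measure B.emeasure_eq_measure flip: ennreal_plus)
    moreover have "measure (density \<mu> g') E \<le> measure (density \<mu> g) E + r"
      using le[OF E, of g' g] g real by (simp add: A.emeasure_eq_measure B.emeasure_eq_measure abs_minus_commute flip: ennreal_plus)
    ultimately show "\<bar>measure (density \<mu> g) E - measure (density \<mu> g') E\<bar> \<le> r" by linarith
  qed
  then show ?thesis using real by (simp add: ennreal_leI)
qed simp

text \<open>
  The learner averages, over \<open>k\<close> independent pairs of samples, the overlaps \<open>min f\<^sub>S f\<^sub>S'\<close> of the output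
  densities; the missing mass goes to a default hypothesis.  At a fixed point \<open>x\<close> the second moment of
  the overlap is at most the squared mean of \<open>f\<^sub>S x\<close>, because \<open>(min f\<^sub>S f\<^sub>S')\<^sup>2 \<le> f\<^sub>S f\<^sub>S'\<close> and the two
  samples are independent; hence the averages have \<open>L\<^sup>1\<close> deviation of order \<open>1 / sqrt k\<close>.
\<close>

lemma overlap_average:
  fixes A :: "'s \<Rightarrow> 'm measure"
  assumes I: "countable I" and A: "\<And>i. i \<in> I \<Longrightarrow> A i \<in> space (prob_algebra M)"
    and h0: "h0 \<in> space M" and k: "0 < k"
  obtains B where "\<And>ps. B ps \<in> space (prob_algebra M)"
    "\<And>P. set_pmf P \<subseteq> I \<Longrightarrow> instability (replicate_pmf k (pair_pmf P P)) B \<le> ennreal (8 / sqrt k)"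
    "\<And>P E. set_pmf P \<subseteq> I \<Longrightarrow> E \<in> sets M \<Longrightarrow>
      (\<integral>\<^sup>+ps. emeasure (B ps) E \<partial>(replicate_pmf k (pair_pmf P P)))
        \<le> instability P A + (\<integral>\<^sup>+S. emeasure (A S) E \<partial>measure_pmf P)"
proof -
  \<comment> \<open>The default hypothesis joins the family as index \<open>None\<close>. Its point
    mass thereby gets a density for the same \<mu>, and the index set is nonempty even when
    \<open>I\<close> is empty.\<close>
  define A' where "A' = case_option (return M h0) A"
  have r0: "return M h0 \<in> space (prob_algebra M)"
    using h0 by (auto simp: space_prob_algebra prob_space_return)
  obtain \<mu> f' where \<mu>: "\<mu> \<in> space (prob_algebra M)" and f': "\<And>i. f' i \<in> borel_measurable M" "\<And>i x. 0 \<le> (f' i x :: real)"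
    "\<And>i. i \<in> insert None (Some ` I) \<Longrightarrow> A' i = density \<mu> (\<lambda>x. ennreal (f' i x))"
    "\<And>i x. i \<notin> insert None (Some ` I) \<Longrightarrow> f' i x = 0"
    by (rule common_density[of "insert None (Some ` I)" A' M]) (use I A r0 in \<open>auto simp: A'_def\<close>)
  note \<mu>D = space_prob_algebraD[OF \<mu>]
  interpret \<mu>: prob_space \<mu> by (rule \<mu>D)
  have sf: "sigma_finite_measure \<mu>" ..
  note [measurable_cong] = \<mu>D(2)
  define f f0 where "f S = f' (Some S)" and "f0 = f' None" for S
  have f [measurable]: "f S \<in> borel_measurable M" and f_nn: "0 \<le> f S x" for S x
    using f' by (auto simp: f_def)
  have fA: "A S = density \<mu> (f S)" if "S \<in> I" for S using f'(3)[of "Some S"] that by (simp add: A'_def f_def)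
  have f_out: "f S x = 0" if "S \<notin> I" for S x using f'(4)[of "Some S"] that by (auto simp: f_def)
  have f0 [measurable]: "f0 \<in> borel_measurable M" and f0_nn: "0 \<le> f0 x" for x
    using f' by (auto simp: f0_def)
  have f0D: "return M h0 = density \<mu> f0" using f'(3)[of None] by (simp add: A'_def f0_def)
  have f0_1: "(\<integral>\<^sup>+x. ennreal (f0 x) \<partial>\<mu>) = 1"
  proof -
    have "emeasure (return M h0) (space M) = (\<integral>\<^sup>+x. ennreal (f0 x) * indicator (space M) x \<partial>\<mu>)"
      unfolding f0D by (subst emeasure_density) (auto simp: \<mu>D)
    also have "\<dots> = (\<integral>\<^sup>+x. ennreal (f0 x) \<partial>\<mu>)" by (intro nn_integral_cong) (auto simp: \<mu>D)
    finally show ?thesis using h0 by simp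
  qed
  have f_1: "(\<integral>\<^sup>+x. ennreal (f S x) \<partial>\<mu>) = (if S \<in> I then 1 else 0)" for S
  proof (cases "S \<in> I")
    case True
    note AD = space_prob_algebraD[OF A[OF True]]
    have "emeasure (A S) (space M) = (\<integral>\<^sup>+x. ennreal (f S x) * indicator (space M) x \<partial>\<mu>)"
      unfolding fA[OF True] by (subst emeasure_density) (auto simp: \<mu>D)
    also have "\<dots> = (\<integral>\<^sup>+x. ennreal (f S x) \<partial>\<mu>)" by (intro nn_integral_cong) (auto simp: \<mu>D)
    finally show ?thesis using prob_space.emeasure_space_1[OF AD(1)] AD(3) True by simp
  qed (simp add: f_out)
  \<comment> \<open>The mass of the overlap; for two indices in \<open>I\<close> its defect
    \<open>1 - w p\<close> is the total variation distance.\<close>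
  define w where "w p = (\<integral>x. min (f (fst p) x) (f (snd p) x) \<partial>\<mu>)" for p
  have w: "(\<integral>\<^sup>+x. ennreal (min (f (fst p) x) (f (snd p) x)) \<partial>\<mu>) = ennreal (w p)" "0 \<le> w p" "w p \<le> 1" for p
  proof -
    have le: "(\<integral>\<^sup>+x. ennreal (min (f (fst p) x) (f (snd p) x)) \<partial>\<mu>) \<le> (\<integral>\<^sup>+x. ennreal (f (fst p) x) \<partial>\<mu>)"
      by (intro nn_integral_mono ennreal_leI) auto
    also have "\<dots> \<le> 1" by (simp add: f_1)
    finally have le: "(\<integral>\<^sup>+x. ennreal (min (f (fst p) x) (f (snd p) x)) \<partial>\<mu>) \<le> 1" .
    have "integrable \<mu> (\<lambda>x. min (f (fst p) x) (f (snd p) x))"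
      by (rule integrableI_nonneg) (use le in \<open>auto simp: f_nn intro: le_less_trans\<close>)
    then show eq: "(\<integral>\<^sup>+x. ennreal (min (f (fst p) x) (f (snd p) x)) \<partial>\<mu>) = ennreal (w p)"
      unfolding w_def by (intro nn_integral_eq_integral) (auto simp: f_nn)
    show "0 \<le> w p" unfolding w_def by (intro integral_nonneg_AE) (auto simp: f_nn)
    show "w p \<le> 1" using le unfolding eq by simp
  qed
  \<comment> \<open>Adding the defect times the default density gives total mass 1. This holds for
    every pair: off \<open>I\<close> the overlap is 0 and all mass is on the default.\<close>
  define q where "q p x = min (f (fst p) x) (f (snd p) x) + (1 - w p) * f0 x" for p x
  have q [measurable]: "q p \<in> borel_measurable M" for p unfolding q_def by measurable
  have q_nn: "0 \<le> q p x" for p x unfolding q_def using w(3) f_nn f0_nn by simp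
  have q_split: "ennreal (q p x) = ennreal (min (f (fst p) x) (f (snd p) x)) + ennreal (1 - w p) * ennreal (f0 x)" for p x
    unfolding q_def using w(3)[of p] f_nn f0_nn[of x] by (simp flip: ennreal_mult)
  have q_1: "(\<integral>\<^sup>+x. ennreal (q p x) \<partial>\<mu>) = 1" for p
    unfolding q_split using w[of p]
    by (simp add: nn_integral_add nn_integral_cmult f0_1 flip: ennreal_plus)
  define Q where "Q p E = (\<integral>x. q p x * indicator E x \<partial>\<mu>)" for p E
  have Q: "(\<integral>\<^sup>+x. ennreal (q p x) * indicator E x \<partial>\<mu>) = ennreal (Q p E)" and Q_nn: "0 \<le> Q p E"
    and Qi: "integrable \<mu> (\<lambda>x. q p x * indicator E x)"
    if [measurable]: "E \<in> sets M" for p E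
  proof -
    have eq: "ennreal (q p x) * indicator E x = ennreal (q p x * indicator E x)" for x by (simp add: indicator_def)
    have "(\<integral>\<^sup>+x. ennreal (q p x * indicator E x) \<partial>\<mu>) \<le> (\<integral>\<^sup>+x. ennreal (q p x) \<partial>\<mu>)"
      by (intro nn_integral_mono ennreal_leI) (auto simp: indicator_def q_nn)
    then have lt: "(\<integral>\<^sup>+x. ennreal (q p x * indicator E x) \<partial>\<mu>) < \<infinity>" by (auto simp: q_1 intro: le_less_trans)
    show i: "integrable \<mu> (\<lambda>x. q p x * indicator E x)"
      by (rule integrableI_nonneg) (use lt in \<open>auto simp: q_nn\<close>)
    show "(\<integral>\<^sup>+x. ennreal (q p x) * indicator E x \<partial>\<mu>) = ennreal (Q p E)"
      unfolding eq Q_def by (rule nn_integral_eq_integral[OF i]) (auto simp: q_nn)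
    show "0 \<le> Q p E" unfolding Q_def by (rule integral_nonneg_AE) (auto simp: q_nn)
  qed
  have mean_meas [measurable]: "(\<lambda>x. mean (\<lambda>p. q p x) ps) \<in> borel_measurable M" for ps
  proof -
    have "(\<lambda>x. sum_list (map (\<lambda>p. q p x) ps)) \<in> borel_measurable M" by (induction ps) auto
    then show ?thesis by (simp add: mean_def)
  qed
  have mean_nn: "0 \<le> mean (\<lambda>p. q p x) ps" for ps x
    unfolding mean_def by (intro divide_nonneg_nonneg sum_list_nonneg) (auto simp: q_nn)
  have mean_E: "emeasure (density \<mu> (\<lambda>x. mean (\<lambda>p. q p x) ps)) E = ennreal (mean (\<lambda>p. Q p E) ps)"
    if E [measurable]: "E \<in> sets M" for ps E
  proof -
    have i: "integrable \<mu> (\<lambda>x. sum_list (map (\<lambda>p. q p x * indicator E x) ps))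
      \<and> (\<integral>x. sum_list (map (\<lambda>p. q p x * indicator E x) ps) \<partial>\<mu>) = sum_list (map (\<lambda>p. Q p E) ps)" for ps
      using Qi[OF E] by (induction ps) (auto simp: Q_def)
    have eq: "mean (\<lambda>p. q p x) ps * indicator E x = sum_list (map (\<lambda>p. q p x * indicator E x) ps) / real (length ps)" for x
      by (simp add: mean_def sum_list_mult_const)
    have "emeasure (density \<mu> (\<lambda>x. mean (\<lambda>p. q p x) ps)) E = (\<integral>\<^sup>+x. ennreal (mean (\<lambda>p. q p x) ps * indicator E x) \<partial>\<mu>)"
      by (subst emeasure_density) (auto simp: indicator_def \<mu>D intro!: nn_integral_cong)
    also have "\<dots> = ennreal (\<integral>x. mean (\<lambda>p. q p x) ps * indicator E x \<partial>\<mu>)"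
    proof (rule nn_integral_eq_integral)
      show "integrable \<mu> (\<lambda>x. mean (\<lambda>p. q p x) ps * indicator E x)" unfolding eq using i by simp
    qed (simp add: mean_nn)
    also have "(\<integral>x. mean (\<lambda>p. q p x) ps * indicator E x \<partial>\<mu>) = mean (\<lambda>p. Q p E) ps"
      unfolding eq using i by (simp add: mean_def)
    finally show ?thesis .
  qed
  define B where "B ps = (if length ps = k then density \<mu> (\<lambda>x. mean (\<lambda>p. q p x) ps) else return M h0)" for ps
  have QM: "Q p (space M) = 1" for p
  proof -
    have "ennreal (Q p (space M)) = (\<integral>\<^sup>+x. ennreal (q p x) \<partial>\<mu>)"
      unfolding Q[OF sets.top, symmetric] by (intro nn_integral_cong) (simp add: \<mu>D)
    then show ?thesis using Q_nn[OF sets.top] by (simp add: q_1)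
  qed
  have dens: "density \<mu> (\<lambda>x. mean (\<lambda>p. q p x) ps) \<in> space (prob_algebra M)" if "length ps = k" for ps
    unfolding space_prob_algebra
  proof (intro CollectI conjI prob_spaceI)
    have "map (\<lambda>p. Q p (space M)) ps = replicate k 1" using that by (simp add: QM map_replicate_const)
    then have "mean (\<lambda>p. Q p (space M)) ps = 1" using that k by (simp add: mean_def sum_list_replicate)
    then show "emeasure (density \<mu> (\<lambda>x. mean (\<lambda>p. q p x) ps)) (space (density \<mu> (\<lambda>x. mean (\<lambda>p. q p x) ps))) = 1"
      using mean_E[OF sets.top, of ps] by (simp add: \<mu>D)
  qed (simp add: \<mu>D)
  show thesis
  proof
    show "B ps \<in> space (prob_algebra M)" for ps using dens r0 by (simp add: B_def)
  next
    fix P assume P: "set_pmf P \<subseteq> I"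
    define R where "R = replicate_pmf k (pair_pmf P P)"
    define fb where "fb x = (\<integral>\<^sup>+S. ennreal (f S x) \<partial>measure_pmf P)" for x
    have fb_meas [measurable]: "fb \<in> borel_measurable M"
    proof -
      have "fb \<in> borel_measurable \<mu>" unfolding fb_def by (rule nn_integral_pmf_swap(2)[OF sf]) simp
      then show ?thesis by (simp add: measurable_cong_sets[OF \<mu>D(2) refl])
    qed
    have fb_1: "(\<integral>\<^sup>+x. fb x \<partial>\<mu>) = 1"
    proof -
      have "(\<integral>\<^sup>+x. fb x \<partial>\<mu>) = (\<integral>\<^sup>+S. \<integral>\<^sup>+x. ennreal (f S x) \<partial>\<mu> \<partial>measure_pmf P)"
        unfolding fb_def by (rule nn_integral_pmf_swap(1)[OF sf, symmetric]) simp
      also have "\<dots> = (\<integral>\<^sup>+S. 1 \<partial>measure_pmf P)"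
        by (intro nn_integral_cong_AE AE_pmfI) (use P in \<open>auto simp: f_1\<close>)
      finally show ?thesis by simp
    qed
    \<comment> \<open>With the default term included, \<open>(a + b)^2 <= 2 a^2 + 2 b^2\<close>
      bounds the second moment by \<open>2 * (fb x)^2 + 2 * (f0 x)^2\<close>, hence the choice of
      \<open>?B\<close> below. Where \<open>fb x\<close> is infinite the claim is trivial.\<close>
    have point: "(\<integral>\<^sup>+ps. \<integral>\<^sup>+ps'. ennreal \<bar>mean (\<lambda>p. q p x) ps - mean (\<lambda>p. q p x) ps'\<bar> \<partial>measure_pmf R \<partial>measure_pmf R)
        \<le> ennreal (2 / sqrt k) * (2 * (fb x + ennreal (f0 x)))" for x
    proof (cases "fb x")
      case (real b)
      let ?B = "2 * (b + f0 x)"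
      have "(\<integral>\<^sup>+p. ennreal ((q p x)\<^sup>2) \<partial>(pair_pmf P P))
        \<le> (\<integral>\<^sup>+p. ennreal (2 * (f (fst p) x * f (snd p) x) + 2 * (f0 x)\<^sup>2) \<partial>(pair_pmf P P))"
      proof (intro nn_integral_mono ennreal_leI)
        fix p
        let ?m = "min (f (fst p) x) (f (snd p) x)"
        have "?m * ?m \<le> f (fst p) x * f (snd p) x" by (intro mult_mono) (auto simp: f_nn)
        moreover have "q p x \<le> ?m + f0 x"
          unfolding q_def using w[of p] f0_nn[of x] by (simp add: mult_left_le_one_le)
        then have "(q p x)\<^sup>2 \<le> (?m + f0 x)\<^sup>2" using q_nn by (intro power_mono)
        moreover have "(?m + f0 x)\<^sup>2 \<le> 2 * (?m * ?m) + 2 * (f0 x)\<^sup>2"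
          using sum_squares_bound[of ?m "f0 x"] by (simp add: power2_eq_square algebra_simps)
        ultimately show "(q p x)\<^sup>2 \<le> 2 * (f (fst p) x * f (snd p) x) + 2 * (f0 x)\<^sup>2" by linarith
      qed
      also have "\<dots> = (\<integral>\<^sup>+S. \<integral>\<^sup>+S'. 2 * ennreal (f S x) * ennreal (f S' x) + ennreal (2 * (f0 x)\<^sup>2) \<partial>measure_pmf P \<partial>measure_pmf P)"
        unfolding nn_integral_pair_pmf'
        by (intro nn_integral_cong) (simp add: f_nn ennreal_mult mult.assoc)
      also have "\<dots> = 2 * fb x * fb x + ennreal (2 * (f0 x)\<^sup>2)"
        by (simp add: nn_integral_add nn_integral_cmult nn_integral_multc flip: fb_def)
      also have "\<dots> = ennreal (2 * b * b + 2 * (f0 x)\<^sup>2)"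
        using real by (simp add: ennreal_mult)
      also have "\<dots> \<le> ennreal (?B\<^sup>2)"
        using real f0_nn[of x] by (intro ennreal_leI) (simp add: power2_eq_square algebra_simps)
      finally have "(\<integral>\<^sup>+p. ennreal ((q p x)\<^sup>2) \<partial>(pair_pmf P P)) \<le> ennreal (?B\<^sup>2)" .
      from mean_two_samples[OF q_nn this _ k] real f0_nn[of x]
      have "(\<integral>\<^sup>+ps. \<integral>\<^sup>+ps'. ennreal \<bar>mean (\<lambda>p. q p x) ps - mean (\<lambda>p. q p x) ps'\<bar> \<partial>measure_pmf R \<partial>measure_pmf R)
        \<le> ennreal (2 * ?B / sqrt k)" by (simp add: R_def)
      also have "2 * ?B / sqrt k = 2 / sqrt k * ?B" by simp
      also have "ennreal (2 / sqrt k * ?B) = ennreal (2 / sqrt k) * (2 * (fb x + ennreal (f0 x)))"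
        using real f0_nn[of x] by (subst ennreal_mult) (auto simp: ennreal_mult)
      finally show ?thesis .
    qed (use k in \<open>simp add: ennreal_mult_top\<close>)
    have "instability R B \<le> (\<integral>\<^sup>+ps. \<integral>\<^sup>+ps'. \<integral>\<^sup>+x. ennreal \<bar>mean (\<lambda>p. q p x) ps - mean (\<lambda>p. q p x) ps'\<bar> \<partial>\<mu> \<partial>measure_pmf R \<partial>measure_pmf R)"
      unfolding instability_def
    proof (intro nn_integral_mono_AE AE_pmfI)
      fix ps ps' assume "ps \<in> set_pmf R" "ps' \<in> set_pmf R"
      then have l: "length ps = k" "length ps' = k" by (auto simp: R_def length_replicate_pmf)
      show "ennreal (tv_dist (B ps) (B ps')) \<le> (\<integral>\<^sup>+x. ennreal \<bar>mean (\<lambda>p. q p x) ps - mean (\<lambda>p. q p x) ps'\<bar> \<partial>\<mu>)"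
        using space_prob_algebraD(1)[OF dens[OF l(1)]] space_prob_algebraD(1)[OF dens[OF l(2)]] l
        by (simp add: B_def) (intro tv_dist_density_le; simp add: mean_nn)
    qed
    \<comment> \<open>The integral over \<mu> is moved outside past both sample averages. The
      pointwise bound then integrates to a finite total because \<open>fb\<close> and
      \<open>f0\<close> both have mass 1.\<close>
    also have "\<dots> \<le> (\<integral>\<^sup>+ps. \<integral>\<^sup>+x. \<integral>\<^sup>+ps'. ennreal \<bar>mean (\<lambda>p. q p x) ps - mean (\<lambda>p. q p x) ps'\<bar> \<partial>measure_pmf R \<partial>\<mu> \<partial>measure_pmf R)"
      by (intro nn_integral_mono nn_integral_pmf_swap_le sf)
    also have "\<dots> \<le> (\<integral>\<^sup>+x. \<integral>\<^sup>+ps. \<integral>\<^sup>+ps'. ennreal \<bar>mean (\<lambda>p. q p x) ps - mean (\<lambda>p. q p x) ps'\<bar> \<partial>measure_pmf R \<partial>measure_pmf R \<partial>\<mu>)"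
      by (intro nn_integral_pmf_swap_le sf)
    also have "\<dots> \<le> (\<integral>\<^sup>+x. ennreal (2 / sqrt k) * (2 * (fb x + ennreal (f0 x))) \<partial>\<mu>)"
      by (intro nn_integral_mono point)
    also have "\<dots> = ennreal (2 / sqrt k) * (2 * (1 + 1))"
      by (simp add: nn_integral_add nn_integral_cmult fb_1 f0_1)
    also have "\<dots> = ennreal (8 / sqrt k)"
    proof -
      have "(2 * (1 + 1) :: ennreal) = ennreal 4" by simp
      moreover have "ennreal (2 / sqrt k) * ennreal 4 = ennreal (2 / sqrt k * 4)" by (rule ennreal_mult[symmetric]) auto
      ultimately show ?thesis by (simp only:) (simp only: times_divide_eq_left, simp)
    qed
    finally show "instability (replicate_pmf k (pair_pmf P P)) B \<le> ennreal (8 / sqrt k)" by (simp add: R_def)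
  next
    fix P E assume P: "set_pmf P \<subseteq> I" and E [measurable]: "E \<in> sets M"
    have "(\<integral>\<^sup>+ps. emeasure (B ps) E \<partial>(replicate_pmf k (pair_pmf P P)))
       = (\<integral>\<^sup>+ps. ennreal (mean (\<lambda>p. Q p E) ps) \<partial>(replicate_pmf k (pair_pmf P P)))"
      by (intro nn_integral_cong_AE AE_pmfI) (simp add: B_def length_replicate_pmf mean_E[OF E])
    also have "\<dots> = (\<integral>\<^sup>+p. ennreal (Q p E) \<partial>(pair_pmf P P))"
      by (rule nn_integral_mean[OF Q_nn[OF E] k])
    also have "\<dots> \<le> (\<integral>\<^sup>+S. \<integral>\<^sup>+S'. ennreal (tv_dist (A S) (A S')) + emeasure (A S) E \<partial>measure_pmf P \<partial>measure_pmf P)"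
      unfolding nn_integral_pair_pmf'
    proof (intro nn_integral_mono_AE AE_pmfI)
      fix S S' assume "S \<in> set_pmf P" "S' \<in> set_pmf P"
      then have S: "S \<in> I" "S' \<in> I" using P by auto
      note D = space_prob_algebraD[OF A[OF S(1)]] and D' = space_prob_algebraD[OF A[OF S(2)]]
      \<comment> \<open>The event that separates the two laws best: \<open>A S\<close> exceeds
        \<open>A S'\<close> on it by exactly \<open>1 - w (S, S')\<close>.\<close>
      define U where "U = {x \<in> space M. f S' x < f S x}"
      have U [measurable]: "U \<in> sets M" unfolding U_def by measurable
      have "emeasure (A S) U + ennreal (w (S, S')) = (\<integral>\<^sup>+x. ennreal (f S x) * indicator U x + ennreal (min (f S x) (f S' x)) \<partial>\<mu>)"
        using w(1)[of "(S, S')"] by (simp add: fA[OF S(1)] emeasure_density nn_integral_add)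
      also have "\<dots> = (\<integral>\<^sup>+x. ennreal (f S' x) * indicator U x + ennreal (f S x) \<partial>\<mu>)"
        by (intro nn_integral_cong) (auto simp: U_def indicator_def \<mu>D min_def ac_simps)
      also have "\<dots> = emeasure (A S') U + 1"
        using S by (simp add: fA[OF S(2)] emeasure_density nn_integral_add f_1)
      finally have "measure (A S) U + w (S, S') = measure (A S') U + 1"
        using D(1) D'(1) w(2)[of "(S, S')"]
        by (simp add: finite_measure.emeasure_eq_measure prob_space_def flip: ennreal_plus ennreal_1)
      then have tv: "1 - w (S, S') \<le> tv_dist (A S) (A S')"
        using measure_diff_le_tv_dist[OF D(1) D'(1), of U] D(2) by auto
      have "ennreal (Q (S, S') E) = (\<integral>\<^sup>+x. ennreal (q (S, S') x) * indicator E x \<partial>\<mu>)" by (rule Q[OF E, symmetric])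
      \<comment> \<open>The overlap lies below \<open>f S\<close>, so it hits \<open>E\<close> no
        more often than \<open>A S\<close>; the default part is charged in full, and its mass is at
        most the distance of the two outputs.\<close>
      also have "\<dots> \<le> (\<integral>\<^sup>+x. ennreal (1 - w (S, S')) * ennreal (f0 x) + ennreal (f S x) * indicator E x \<partial>\<mu>)"
        unfolding q_split
        by (intro nn_integral_mono) (auto simp: indicator_def ac_simps intro!: add_mono ennreal_leI)
      also have "\<dots> = ennreal (1 - w (S, S')) + emeasure (A S) E"
        by (simp add: nn_integral_add nn_integral_cmult f0_1 fA[OF S(1)] emeasure_density)
      also have "\<dots> \<le> ennreal (tv_dist (A S) (A S')) + emeasure (A S) E"
        by (intro add_mono ennreal_leI tv order_refl)
      finally show "ennreal (Q (S, S') E) \<le> ennreal (tv_dist (A S) (A S')) + emeasure (A S) E" .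
    qed
    also have "\<dots> = instability P A + (\<integral>\<^sup>+S. emeasure (A S) E \<partial>measure_pmf P)"
      by (simp add: nn_integral_add instability_def)
    finally show "(\<integral>\<^sup>+ps. emeasure (B ps) E \<partial>(replicate_pmf k (pair_pmf P P)))
        \<le> instability P A + (\<integral>\<^sup>+S. emeasure (A S) E \<partial>measure_pmf P)" .
  qed
qed

section \<open>Identities for discrete sampling and for bind\<close>

lemma map_replicate_pmf: "replicate_pmf n (map_pmf f P) = map_pmf (map f) (replicate_pmf n P)"
  by (induction n) (simp_all add: map_pmf_def bind_assoc_pmf bind_return_pmf)

lemma nn_integral_pmf_commute:
  "(\<integral>\<^sup>+x. \<integral>\<^sup>+y. f x y \<partial>measure_pmf Q \<partial>measure_pmf P) = (\<integral>\<^sup>+y. \<integral>\<^sup>+x. f x y \<partial>measure_pmf P \<partial>measure_pmf Q)"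
  by (rule nn_integral_pmf_swap(1)) (auto intro: prob_space_imp_sigma_finite measure_pmf.prob_space_axioms)

lemma nn_integral_pair_pair_pmf:
  "(\<integral>\<^sup>+u. \<integral>\<^sup>+u'. f u u' \<partial>(pair_pmf P Q) \<partial>(pair_pmf P Q))
    = (\<integral>\<^sup>+p. \<integral>\<^sup>+p'. \<integral>\<^sup>+q. \<integral>\<^sup>+q'. f (p, q) (p', q') \<partial>measure_pmf Q \<partial>measure_pmf Q \<partial>measure_pmf P \<partial>measure_pmf P)"
  unfolding nn_integral_pair_pmf' by (subst nn_integral_pmf_commute) (rule refl)

lemma instability_map_pmf: "instability (map_pmf g P) F = instability P (\<lambda>x. F (g x))"
  by (simp add: instability_def)

lemma nn_integral_pmf_const_le:
  "(\<And>x. x \<in> set_pmf P \<Longrightarrow> f x \<le> c) \<Longrightarrow> (\<integral>\<^sup>+x. f x \<partial>measure_pmf P) \<le> c"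
  by (rule order_trans[OF nn_integral_mono_AE[of f "\<lambda>_. c"]]) (auto simp: AE_measure_pmf_iff)

lemma measurable_bind_prob_algebra:
  assumes f: "f \<in> S \<rightarrow>\<^sub>M prob_algebra N" and g: "(\<lambda>x. g (fst x) (snd x)) \<in> S \<Otimes>\<^sub>M N \<rightarrow>\<^sub>M prob_algebra R"
  shows "(\<lambda>x. bind (f x) (g x)) \<in> S \<rightarrow>\<^sub>M prob_algebra R"
proof (rule measurable_prob_algebraI)
  show "(\<lambda>x. f x \<bind> g x) \<in> S \<rightarrow>\<^sub>M subprob_algebra R"
    by (rule measurable_bind[OF measurable_prob_algebraD[OF f] measurable_prob_algebraD[OF g]])
  fix x assume x: "x \<in> space S"
  have "g x \<in> N \<rightarrow>\<^sub>M prob_algebra R"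
    using measurable_compose[OF measurable_Pair1'[OF x] g] by simp
  then show "prob_space (f x \<bind> g x)"
    using bind_in_prob_algebra[of "f x" N "g x" R] measurable_space[OF f x] space_prob_algebraD(1) by blast
qed

text \<open>
  The boosting state is a vote count \<open>v\<close>.  An example comes with a uniform noise variable \<open>j \<in> {1..K}\<close>,
  and is accepted with probability \<open>(K - v)/K\<close>, clamped to \<open>[0, 1]\<close>, where \<open>v\<close> is the vote in favour of
  its label.
\<close>

definition vote :: "('x \<Rightarrow> int) \<Rightarrow> 'x \<times> bool \<Rightarrow> int" where
  "vote v z = (if snd z then v (fst z) else - v (fst z))"

definition margin :: "('x \<Rightarrow> bool) \<Rightarrow> 'x \<times> bool \<Rightarrow> int" where
  "margin h z = (if h (fst z) = snd z then 1 else - 1)"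

definition accepts :: "nat \<Rightarrow> ('x \<Rightarrow> int) \<Rightarrow> ('x \<times> bool) \<times> nat \<Rightarrow> bool" where
  "accepts K v e \<longleftrightarrow> vote v (fst e) + int (snd e) \<le> int K"

definition add_vote :: "'x set \<Rightarrow> ('x \<Rightarrow> int) \<Rightarrow> ('x \<Rightarrow> bool) \<Rightarrow> 'x \<Rightarrow> int" where
  "add_vote X v h = (\<lambda>x\<in>X. v x + (if h x then 1 else - 1))"

definition majority :: "'x set \<Rightarrow> ('x \<Rightarrow> int) \<Rightarrow> 'x \<Rightarrow> bool" where
  "majority X v = (\<lambda>x\<in>X. 0 < v x)"

definition vote_space :: "'x set \<Rightarrow> ('x \<Rightarrow> int) measure" where
  "vote_space X = PiM X (\<lambda>_. count_space UNIV)"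

section \<open>Measurability of the voting operations\<close>

text \<open>Off \<open>X\<close> the functions of the product space are all
  \<open>undefined\<close>, so evaluation is constant there.\<close>

lemma measurable_PiM_eval:
  "(\<lambda>v. v x) \<in> PiM X (\<lambda>_. count_space UNIV) \<rightarrow>\<^sub>M count_space UNIV"
proof (cases "x \<in> X")
  case False
  then have "v x = undefined" if "v \<in> space (PiM X (\<lambda>_. count_space UNIV))" for v :: "'a \<Rightarrow> 'b"
    using that by (auto simp: space_PiM PiE_def extensional_def)
  then show ?thesis by (subst measurable_cong[where g = "\<lambda>_. undefined"]) auto
qed (rule measurable_component_singleton)

lemma measurable_vote_eval: "(\<lambda>v. v x) \<in> vote_space X \<rightarrow>\<^sub>M count_space UNIV"
  unfolding vote_space_def by (rule measurable_PiM_eval)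

lemma measurable_hyp_eval: "(\<lambda>h. h x) \<in> hyp_space X \<rightarrow>\<^sub>M count_space UNIV"
  unfolding hyp_space_def by (rule measurable_PiM_eval)

lemma measurable_accepts: "(\<lambda>v. accepts K v e) \<in> vote_space X \<rightarrow>\<^sub>M count_space UNIV"
proof -
  have "(\<lambda>a. (if snd (fst e) then a else - a) + int (snd e) \<le> int K) \<in> count_space UNIV \<rightarrow>\<^sub>M count_space UNIV"
    by simp
  from measurable_compose[OF measurable_vote_eval this] show ?thesis unfolding accepts_def vote_def .
qed

lemma measurable_margin: "(\<lambda>h. margin h z) \<in> hyp_space X \<rightarrow>\<^sub>M count_space UNIV"
proof -
  have "(\<lambda>b. if b = snd z then 1 else - 1) \<in> count_space UNIV \<rightarrow>\<^sub>M count_space UNIV" by simp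
  from measurable_compose[OF measurable_hyp_eval this] show ?thesis unfolding margin_def .
qed

lemma measurable_add_vote:
  "(\<lambda>p. add_vote X (fst p) (snd p)) \<in> vote_space X \<Otimes>\<^sub>M hyp_space X \<rightarrow>\<^sub>M vote_space X"
proof -
  have "(\<lambda>p. fst p x + (if snd p x then 1 else - 1)) \<in> vote_space X \<Otimes>\<^sub>M hyp_space X \<rightarrow>\<^sub>M count_space (UNIV :: int set)" for x
  proof -
    have [measurable]: "(\<lambda>p. fst p x) \<in> vote_space X \<Otimes>\<^sub>M hyp_space X \<rightarrow>\<^sub>M count_space UNIV"
      "(\<lambda>p. snd p x) \<in> vote_space X \<Otimes>\<^sub>M hyp_space X \<rightarrow>\<^sub>M count_space UNIV"
      by (rule measurable_compose[OF measurable_fst measurable_vote_eval],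
          rule measurable_compose[OF measurable_snd measurable_hyp_eval])
    show ?thesis by measurable
  qed
  then show ?thesis unfolding add_vote_def vote_space_def by (intro measurable_restrict)
qed

lemma measurable_majority: "majority X \<in> vote_space X \<rightarrow>\<^sub>M hyp_space X"
  unfolding majority_def[abs_def] hyp_space_def
  by (intro measurable_restrict measurable_compose[OF measurable_vote_eval]) simp

lemma measurable_filter_accepts: "(\<lambda>v. filter (accepts K v) L) \<in> vote_space X \<rightarrow>\<^sub>M count_space UNIV"
proof (induction L)
  case (Cons e L)
  have eq: "filter (accepts K v) (e # L) = (if accepts K v e then e # filter (accepts K v) L else filter (accepts K v) L)" for v
    by simp
  have c: "(\<lambda>v. e # filter (accepts K v) L) \<in> vote_space X \<rightarrow>\<^sub>M count_space UNIV"
    by (rule measurable_compose[OF Cons]) simp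
  show ?case unfolding eq
    by (intro measurable_If c Cons) (use measurable_accepts[of K e X] in \<open>simp add: pred_def\<close>)
qed simp

section \<open>The boosting procedure\<close>

text \<open>\<open>B\<close> is the weak learner, to be run on \<open>m\<close> accepted examples.
  The condition on \<open>m\<close> ties the stop test to the rejection sampler: the test is
  positive only if a fraction above \<open>\<theta>\<^sub>1 / 2\<close> of the \<open>N\<close>
  examples is accepted, which leaves at least \<open>m\<close> of them.\<close>

locale boosting =
  fixes X :: "'x set" and B :: "'x learner" and m N K :: nat and \<theta>\<^sub>1 \<theta>\<^sub>2 :: real
  assumes B: "\<And>T. B T \<in> space (prob_algebra (hyp_space X))"
    and N: "0 < N" and \<theta>\<^sub>1: "0 < \<theta>\<^sub>1" and \<theta>\<^sub>2: "0 < \<theta>\<^sub>2" and m: "2 * real m \<le> real N * \<theta>\<^sub>1" and K: "0 < K"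
begin

definition kept :: "('x \<Rightarrow> int) \<Rightarrow> (('x \<times> bool) \<times> nat) list \<Rightarrow> ('x \<times> bool) list" where
  "kept v L = map fst (take m (filter (accepts K v) L))"

definition weight :: "('x \<Rightarrow> int) \<Rightarrow> ('x \<times> bool) \<times> nat \<Rightarrow> real" where
  "weight v e = (if accepts K v e then 1 else 0)"

text \<open>The advantage is not normalised by the acceptance probability. In this form its mean can
  be estimated from all \<open>N\<close> examples, and it is the expected drop of the potential up
  to a boundary term.\<close>

definition edge :: "('x \<Rightarrow> int) \<Rightarrow> ('x \<Rightarrow> bool) \<Rightarrow> ('x \<times> bool) \<times> nat \<Rightarrow> real" where
  "edge v h e = weight v e * real_of_int (margin h (fst e))"

definition go_prob :: "('x \<Rightarrow> int) \<Rightarrow> (('x \<times> bool) \<times> nat) list \<Rightarrow> real" where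
  "go_prob v L = soft_test \<theta>\<^sub>1 (mean (weight v) L)"

definition add_prob :: "('x \<Rightarrow> int) \<Rightarrow> ('x \<Rightarrow> bool) \<Rightarrow> (('x \<times> bool) \<times> nat) list \<Rightarrow> real" where
  "add_prob v h L = soft_test \<theta>\<^sub>2 (mean (edge v h) L)"

text \<open>A round uses two independent lists. The first serves the stop test and the training, so
  that passing the test guarantees enough training examples; the second judges the hypothesis and
  must be independent of it.\<close>

fun boost :: "('x \<Rightarrow> int) \<Rightarrow> ((('x \<times> bool) \<times> nat) list \<times> (('x \<times> bool) \<times> nat) list) list \<Rightarrow> ('x \<Rightarrow> bool) measure" where
  "boost v [] = return (hyp_space X) (majority X v)"
| "boost v (c # cs) = mix (go_prob v (fst c))
     (B (kept v (fst c)) \<bind> (\<lambda>h. mix (add_prob v h (snd c)) (boost (add_vote X v h) cs) (boost v cs)))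
     (return (hyp_space X) (majority X v))"

lemma go_prob_bounds: "0 \<le> go_prob v L" "go_prob v L \<le> 1"
  and add_prob_bounds: "0 \<le> add_prob v h L" "add_prob v h L \<le> 1"
  by (simp_all add: go_prob_def add_prob_def soft_test_bounds)

lemma weight_bounds: "\<bar>weight v e\<bar> \<le> 1" and edge_bounds: "\<bar>edge v h e\<bar> \<le> 1"
  by (auto simp: weight_def edge_def margin_def)

lemma measurable_weight [measurable]: "(\<lambda>v. weight v e) \<in> borel_measurable (vote_space X)"
  unfolding weight_def using measurable_accepts[of K e X] by measurable

lemma measurable_go_prob: "(\<lambda>v. go_prob v L) \<in> borel_measurable (vote_space X)"
proof -
  have "(\<lambda>v. sum_list (map (weight v) L)) \<in> borel_measurable (vote_space X)" by (induction L) auto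
  then show ?thesis unfolding go_prob_def mean_def soft_test_def by measurable
qed

lemma measurable_add_prob:
  "(\<lambda>p. add_prob (fst p) (snd p) L) \<in> borel_measurable (vote_space X \<Otimes>\<^sub>M hyp_space X)"
proof -
  have [measurable]: "(\<lambda>p. edge (fst p) (snd p) e) \<in> borel_measurable (vote_space X \<Otimes>\<^sub>M hyp_space X)" for e
    unfolding edge_def
    using measurable_compose[OF measurable_fst measurable_weight[of e], of "hyp_space X"]
      measurable_compose[OF measurable_snd measurable_margin[of "fst e" X], of "vote_space X"] by measurable
  have "(\<lambda>p. sum_list (map (edge (fst p) (snd p)) L)) \<in> borel_measurable (vote_space X \<Otimes>\<^sub>M hyp_space X)"
    by (induction L) auto
  then show ?thesis unfolding add_prob_def mean_def soft_test_def by measurable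
qed

lemma measurable_B_kept: "(\<lambda>v. B (kept v L)) \<in> vote_space X \<rightarrow>\<^sub>M prob_algebra (hyp_space X)"
proof -
  have "(\<lambda>L. B (map fst (take m L))) \<in> count_space UNIV \<rightarrow>\<^sub>M prob_algebra (hyp_space X)"
    using B by (intro measurable_count_space_prob_algebra)
  from measurable_compose[OF measurable_filter_accepts this] show ?thesis by (simp add: kept_def)
qed

lemma measurable_boost: "(\<lambda>v. boost v cs) \<in> vote_space X \<rightarrow>\<^sub>M prob_algebra (hyp_space X)"
proof (induction cs)
  case Nil
  show ?case using measurable_compose[OF measurable_majority measurable_return_prob_space] by simp
next
  case (Cons c cs)
  have r: "(\<lambda>v. return (hyp_space X) (majority X v)) \<in> vote_space X \<rightarrow>\<^sub>M prob_algebra (hyp_space X)"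
    by (rule measurable_compose[OF measurable_majority measurable_return_prob_space])
  have "(\<lambda>p. mix (add_prob (fst p) (snd p) (snd c)) (boost (add_vote X (fst p) (snd p)) cs) (boost (fst p) cs))
     \<in> vote_space X \<Otimes>\<^sub>M hyp_space X \<rightarrow>\<^sub>M prob_algebra (hyp_space X)"
    by (intro measurable_mix measurable_add_prob add_prob_bounds
        measurable_compose[OF measurable_add_vote Cons] measurable_compose[OF measurable_fst Cons])
  from measurable_bind_prob_algebra[OF measurable_B_kept this, of "fst c"]
  show ?case unfolding boost.simps by (intro measurable_mix measurable_go_prob go_prob_bounds r)
qed

lemma boost_in_prob_algebra: "v \<in> space (vote_space X) \<Longrightarrow> boost v cs \<in> space (prob_algebra (hyp_space X))"
  using measurable_space[OF measurable_boost] .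

lemma add_vote_in_space: "add_vote X v h \<in> space (vote_space X)"
  by (simp add: add_vote_def vote_space_def space_PiM)

lemma majority_in_space: "majority X v \<in> space (hyp_space X)"
  by (simp add: majority_def hyp_space_def space_PiM)

lemma return_majority: "return (hyp_space X) (majority X v) \<in> space (prob_algebra (hyp_space X))"
  by (simp add: space_prob_algebra prob_space_return majority_in_space)

definition continue where
  "continue v L cs h = mix (add_prob v h L) (boost (add_vote X v h) cs) (boost v cs)"

lemma boost_Cons: "boost v (c # cs) = mix (go_prob v (fst c)) (B (kept v (fst c)) \<bind> continue v (snd c) cs)
    (return (hyp_space X) (majority X v))"
  by (simp add: continue_def[abs_def])

lemma measurable_continue:
  assumes v: "v \<in> space (vote_space X)"
  shows "continue v L cs \<in> hyp_space X \<rightarrow>\<^sub>M prob_algebra (hyp_space X)"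
proof -
  have p: "(\<lambda>h. (v, h)) \<in> hyp_space X \<rightarrow>\<^sub>M vote_space X \<Otimes>\<^sub>M hyp_space X" by (rule measurable_Pair1'[OF v])
  show ?thesis unfolding continue_def[abs_def]
    using measurable_compose[OF p measurable_add_prob[of L]] measurable_compose[OF measurable_compose[OF p measurable_add_vote] measurable_boost[of cs]]
    by (intro measurable_mix add_prob_bounds measurable_const boost_in_prob_algebra[OF v]) simp_all
qed

lemma length_le_if_go_prob:
  assumes L: "length L = N" and go: "0 < go_prob v L"
  shows "m \<le> length (filter (accepts K v) L)"
proof (rule ccontr)
  assume "\<not> ?thesis"
  then have lt: "real (length (filter (accepts K v) L)) \<le> real m" by simp
  have "sum_list (map (weight v) L) = real (length (filter (accepts K v) L))"
    by (induction L) (auto simp: weight_def)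
  then have "mean (weight v) L \<le> real m / real N"
    using lt L by (simp add: mean_def divide_right_mono)
  also have "\<dots> \<le> \<theta>\<^sub>1 / 2" using m N by (simp add: field_simps)
  finally have "go_prob v L = 0" unfolding go_prob_def by (rule soft_test_low[OF \<theta>\<^sub>1])
  with go show False by simp
qed

text \<open>Guarantees that the conditional law of accepted examples is meaningful whenever a round
  can go on.\<close>

lemma filter_accepts_nonempty_support:
  assumes "L \<in> set_pmf (replicate_pmf N E)" "0 < go_prob v L"
  shows "set_pmf E \<inter> Collect (accepts K v) \<noteq> {}"
proof
  assume "set_pmf E \<inter> Collect (accepts K v) = {}"
  then have w: "weight v e = 0" if "e \<in> set L" for e
    using that assms(1) by (auto simp: weight_def set_replicate_pmf)
  have "map (weight v) L = map (\<lambda>_. 0) L" using w by (intro map_cong) auto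
  then have "sum_list (map (weight v) L) = 0" by (simp only: sum_list_0)
  then have "mean (weight v) L = 0" by (simp add: mean_def)
  then have "go_prob v L = 0" unfolding go_prob_def using \<theta>\<^sub>1 by (intro soft_test_low) auto
  with assms(2) show False by simp
qed

definition reweighted :: "(('x \<times> bool) \<times> nat) pmf \<Rightarrow> ('x \<Rightarrow> int) \<Rightarrow> ('x \<times> bool) pmf" where
  "reweighted E v = map_pmf fst (cond_pmf E (Collect (accepts K v)))"

text \<open>Samples that may go on contain \<open>m\<close> accepted examples, so
  \<open>kept\<close> is never too short there, and the rejection sampling bound applies.\<close>

lemma nn_integral_kept_le:
  assumes ne: "set_pmf E \<inter> Collect (accepts K v) \<noteq> {}"
  shows "(\<integral>\<^sup>+L. (if 0 < go_prob v L then F (kept v L) else 0) \<partial>(replicate_pmf N E))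
    \<le> (\<integral>\<^sup>+T. F T \<partial>(replicate_pmf m (reweighted E v)))"
proof -
  have "(\<integral>\<^sup>+L. (if 0 < go_prob v L then F (kept v L) else 0) \<partial>(replicate_pmf N E))
     \<le> (\<integral>\<^sup>+L. (if m \<le> length (filter (accepts K v) L) then F (map fst (take m (filter (accepts K v) L))) else 0) \<partial>(replicate_pmf N E))"
    using length_le_if_go_prob by (intro nn_integral_mono_AE AE_pmfI) (auto simp: kept_def length_replicate_pmf)
  also have "\<dots> \<le> (\<integral>\<^sup>+T. F (map fst T) \<partial>(replicate_pmf m (cond_pmf E (Collect (accepts K v)))))"
    by (rule nn_integral_take_filter_le[OF ne])
  finally show ?thesis by (simp add: reweighted_def map_replicate_pmf)
qed

definition round_law :: "(('x \<times> bool) \<times> nat) pmf \<Rightarrow> ((('x \<times> bool) \<times> nat) list \<times> (('x \<times> bool) \<times> nat) list) pmf" where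
  "round_law E = pair_pmf (replicate_pmf N E) (replicate_pmf N E)"

section \<open>Stability of boosting\<close>

text \<open>Replace the two training samples one after the other by i.i.d. samples from the
  reweighted law. If no example can be accepted, no sample goes on and the integral is 0.\<close>

lemma first_stage_stable:
  assumes stable: "set_pmf E \<inter> Collect (accepts K v) \<noteq> {} \<Longrightarrow> instability (replicate_pmf m (reweighted E v)) B \<le> s"
  shows "(\<integral>\<^sup>+L. \<integral>\<^sup>+L'. (if 0 < go_prob v L \<and> 0 < go_prob v L' then ennreal (tv_dist (B (kept v L)) (B (kept v L'))) else 0)
    \<partial>(replicate_pmf N E) \<partial>(replicate_pmf N E)) \<le> s" (is "?I \<le> s")
proof (cases "set_pmf E \<inter> Collect (accepts K v) = {}")
  case True
  then have "go_prob v L = 0" if "L \<in> set_pmf (replicate_pmf N E)" for L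
    using filter_accepts_nonempty_support[OF that] go_prob_bounds(1)[of v L] by force
  then show ?thesis by (intro nn_integral_pmf_const_le) auto
next
  case False
  let ?R = "replicate_pmf m (reweighted E v)"
  have "?I = (\<integral>\<^sup>+L. (if 0 < go_prob v L then (\<integral>\<^sup>+L'. (if 0 < go_prob v L' then ennreal (tv_dist (B (kept v L)) (B (kept v L'))) else 0)
    \<partial>(replicate_pmf N E)) else 0) \<partial>(replicate_pmf N E))"
    by (intro nn_integral_cong) auto
  also have "\<dots> \<le> (\<integral>\<^sup>+L. (if 0 < go_prob v L then (\<integral>\<^sup>+T'. ennreal (tv_dist (B (kept v L)) (B T'))
    \<partial>measure_pmf ?R) else 0) \<partial>(replicate_pmf N E))"
    by (intro nn_integral_mono) (use nn_integral_kept_le[OF False] in auto)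
  also have "\<dots> \<le> instability ?R B"
    unfolding instability_def by (rule nn_integral_kept_le[OF False])
  finally show ?thesis using stable[OF False] by simp
qed

text \<open>A round costs the instabilities of the stop test, of the weak learner and of the edge
  test. After these are paid, both runs may be compared from the same votes, and the remaining data
  are independent of them, so the induction hypothesis applies to each possible vote count.\<close>

lemma instability_boost_le:
  assumes stable: "\<And>v. v \<in> space (vote_space X) \<Longrightarrow> set_pmf E \<inter> Collect (accepts K v) \<noteq> {} \<Longrightarrow>
      instability (replicate_pmf m (reweighted E v)) B \<le> ennreal s"
    and s: "0 \<le> s" and v: "v \<in> space (vote_space X)"
  shows "instability (replicate_pmf k (round_law E)) (boost v)
    \<le> ennreal (real k * (8 / (\<theta>\<^sub>1 * sqrt N) + s + 8 / (\<theta>\<^sub>2 * sqrt N)))"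
  using v
proof (induction k arbitrary: v)
  case 0
  then show ?case by (simp add: instability_def nn_integral_return)
next
  case (Suc k)
  define d1 d2 where "d1 = 8 / (\<theta>\<^sub>1 * sqrt N)" and "d2 = 8 / (\<theta>\<^sub>2 * sqrt N)"
  define t where "t = real k * (d1 + s + d2)"
  have nn: "0 \<le> d1" "0 \<le> d2" "0 \<le> t" using \<theta>\<^sub>1 \<theta>\<^sub>2 s by (auto simp: d1_def d2_def t_def)
  define C where "C = replicate_pmf k (round_law E)"
  define R where "R = replicate_pmf N E"
  have IH: "(\<integral>\<^sup>+cs. \<integral>\<^sup>+cs'. ennreal (tv_dist (boost u cs) (boost u cs')) \<partial>measure_pmf C \<partial>measure_pmf C) \<le> ennreal t"
    if "u \<in> space (vote_space X)" for u
    using Suc.IH[OF that] by (simp add: instability_def C_def t_def d1_def d2_def)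
  note v = Suc.prems
  \<comment> \<open>Bounds the distance of two continuations that drew the same \<open>h\<close>.
    Here \<open>q\<close> consists of the second list of the round and of all later rounds; its
    average over \<open>q\<close> and \<open>q'\<close> is bounded uniformly in
    \<open>h\<close>.\<close>
  define \<phi> where "\<phi> h q q' = ennreal \<bar>add_prob v h (fst q) - add_prob v h (fst q')\<bar>
      + (ennreal (add_prob v h (fst q)) * ennreal (tv_dist (boost (add_vote X v h) (snd q)) (boost (add_vote X v h) (snd q')))
      + ennreal (1 - add_prob v h (fst q)) * ennreal (tv_dist (boost v (snd q)) (boost v (snd q'))))" for h q q'
  have \<phi>: "(\<integral>\<^sup>+q. \<integral>\<^sup>+q'. \<phi> h q q' \<partial>(pair_pmf R C) \<partial>(pair_pmf R C)) \<le> ennreal (d2 + t)" for h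
  proof -
    have "(\<integral>\<^sup>+q. \<integral>\<^sup>+q'. \<phi> h q q' \<partial>(pair_pmf R C) \<partial>(pair_pmf R C))
      = (\<integral>\<^sup>+L. \<integral>\<^sup>+L'. ennreal \<bar>add_prob v h L - add_prob v h L'\<bar>
         + (ennreal (add_prob v h L) * (\<integral>\<^sup>+cs. \<integral>\<^sup>+cs'. ennreal (tv_dist (boost (add_vote X v h) cs) (boost (add_vote X v h) cs')) \<partial>measure_pmf C \<partial>measure_pmf C)
         + ennreal (1 - add_prob v h L) * (\<integral>\<^sup>+cs. \<integral>\<^sup>+cs'. ennreal (tv_dist (boost v cs) (boost v cs')) \<partial>measure_pmf C \<partial>measure_pmf C))
         \<partial>measure_pmf R \<partial>measure_pmf R)"
      unfolding nn_integral_pair_pair_pmf \<phi>_def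
      by (simp add: nn_integral_add nn_integral_cmult)
    also have "\<dots> \<le> (\<integral>\<^sup>+L. \<integral>\<^sup>+L'. ennreal \<bar>add_prob v h L - add_prob v h L'\<bar>
         + (ennreal (add_prob v h L) * ennreal t + ennreal (1 - add_prob v h L) * ennreal t) \<partial>measure_pmf R \<partial>measure_pmf R)"
      by (intro nn_integral_mono add_mono mult_left_mono order_refl IH v add_vote_in_space) auto
    also have "\<dots> = (\<integral>\<^sup>+L. \<integral>\<^sup>+L'. ennreal \<bar>add_prob v h L - add_prob v h L'\<bar> + ennreal t \<partial>measure_pmf R \<partial>measure_pmf R)"
    proof -
      have "ennreal (add_prob v h L) * ennreal t + ennreal (1 - add_prob v h L) * ennreal t = ennreal t" for L
      proof -
        have "ennreal (add_prob v h L) + ennreal (1 - add_prob v h L) = 1"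
          using add_prob_bounds[of v h L] by (simp flip: ennreal_plus)
        then show ?thesis by (simp flip: distrib_right)
      qed
      then show ?thesis by simp
    qed
    also have "\<dots> = (\<integral>\<^sup>+L. \<integral>\<^sup>+L'. ennreal \<bar>add_prob v h L - add_prob v h L'\<bar> \<partial>measure_pmf R \<partial>measure_pmf R) + ennreal t"
      by (simp add: nn_integral_add)
    also have "\<dots> \<le> ennreal d2 + ennreal t"
      unfolding add_prob_def R_def d2_def
      by (intro add_right_mono soft_test_mean_stable edge_bounds \<theta>\<^sub>2 N)
    finally show ?thesis using nn by simp
  qed
  have point: "ennreal (tv_dist (boost v ((L, fst q) # snd q)) (boost v ((L', fst q') # snd q')))
     \<le> ennreal \<bar>go_prob v L - go_prob v L'\<bar>
      + (if 0 < go_prob v L \<and> 0 < go_prob v L' then ennreal (tv_dist (B (kept v L)) (B (kept v L'))) else 0)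
      + (\<integral>\<^sup>+h. \<phi> h q q' \<partial>B (kept v L'))" for L L' q q'
  proof -
    let ?P = "B (kept v L) \<bind> continue v (fst q) (snd q)" and ?P' = "B (kept v L') \<bind> continue v (fst q') (snd q')"
    have bind: "?P \<in> space (prob_algebra (hyp_space X))" "?P' \<in> space (prob_algebra (hyp_space X))"
      by (intro bind_in_prob_algebra[OF B] measurable_continue v)+
    have "tv_dist (boost v ((L, fst q) # snd q)) (boost v ((L', fst q') # snd q'))
      \<le> \<bar>go_prob v L - go_prob v L'\<bar> + (if 0 < go_prob v L \<and> 0 < go_prob v L' then tv_dist ?P ?P' else 0)"
      unfolding boost_Cons fst_conv snd_conv
      by (rule tv_dist_mix_same[OF bind return_majority go_prob_bounds go_prob_bounds])
    then have "ennreal (tv_dist (boost v ((L, fst q) # snd q)) (boost v ((L', fst q') # snd q')))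
      \<le> ennreal \<bar>go_prob v L - go_prob v L'\<bar> + (if 0 < go_prob v L \<and> 0 < go_prob v L' then ennreal (tv_dist ?P ?P') else 0)"
      using tv_dist_nonneg[OF space_prob_algebraD(1)[OF bind(1)] space_prob_algebraD(1)[OF bind(2)]]
      by (auto intro: ennreal_leI simp flip: ennreal_plus split: if_splits)
    moreover have "ennreal (tv_dist ?P ?P') \<le> ennreal (tv_dist (B (kept v L)) (B (kept v L'))) + (\<integral>\<^sup>+h. \<phi> h q q' \<partial>B (kept v L'))"
    proof (rule order_trans[OF tv_dist_bind[OF B B measurable_continue[OF v] measurable_continue[OF v]]], intro add_left_mono nn_integral_mono)
      fix h
      have "tv_dist (continue v (fst q) (snd q) h) (continue v (fst q') (snd q') h)
        \<le> \<bar>add_prob v h (fst q) - add_prob v h (fst q')\<bar>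
         + add_prob v h (fst q) * tv_dist (boost (add_vote X v h) (snd q)) (boost (add_vote X v h) (snd q'))
         + (1 - add_prob v h (fst q)) * tv_dist (boost v (snd q)) (boost v (snd q'))"
        unfolding continue_def
        by (rule tv_dist_mix[where M = "hyp_space X"])
          (intro boost_in_prob_algebra add_vote_in_space v add_prob_bounds)+
      moreover have "0 \<le> tv_dist (boost u cs) (boost u cs')" if "u \<in> space (vote_space X)" for u cs cs'
        using boost_in_prob_algebra[OF that] by (intro tv_dist_nonneg space_prob_algebraD(1))
      ultimately show "ennreal (tv_dist (continue v (fst q) (snd q) h) (continue v (fst q') (snd q') h)) \<le> \<phi> h q q'"
        using add_prob_bounds[of v h "fst q"] v add_vote_in_space[of v h] unfolding \<phi>_def
        by (simp add: ennreal_leI add.assoc flip: ennreal_mult ennreal_plus)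
    qed
    moreover have "x \<le> a + (if c then z else 0) + w" if "x \<le> a + (if c then y else 0)" "y \<le> z + w" for x y z a w :: ennreal and c
    proof (cases c)
      case True
      have "x \<le> a + y" using that(1) True by simp
      also have "\<dots> \<le> a + (z + w)" by (intro add_left_mono that(2))
      finally show ?thesis using True by (simp add: add.assoc)
    next
      case False
      have "x \<le> a" using that(1) False by simp
      also have "a \<le> a + w" by simp
      finally show ?thesis using False by simp
    qed
    ultimately show ?thesis by blast
  qed
  \<comment> \<open>The law of \<open>h\<close> depends on the first list only, so \<open>h\<close>
    can be integrated last, after \<open>q\<close> and \<open>q'\<close>. As \<phi> need not be
    measurable in \<open>h\<close>, this is the one-sided exchange.\<close>
  have swap: "(\<integral>\<^sup>+q. \<integral>\<^sup>+q'. (\<integral>\<^sup>+h. \<phi> h q q' \<partial>B T) \<partial>(pair_pmf R C) \<partial>(pair_pmf R C)) \<le> ennreal (d2 + t)" for T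
  proof -
    note BD = space_prob_algebraD[OF B[of T]]
    have sf: "sigma_finite_measure (B T)" using BD(1) by (rule prob_space_imp_sigma_finite)
    have "(\<integral>\<^sup>+q. \<integral>\<^sup>+q'. (\<integral>\<^sup>+h. \<phi> h q q' \<partial>B T) \<partial>(pair_pmf R C) \<partial>(pair_pmf R C))
      \<le> (\<integral>\<^sup>+q. (\<integral>\<^sup>+h. \<integral>\<^sup>+q'. \<phi> h q q' \<partial>(pair_pmf R C) \<partial>B T) \<partial>(pair_pmf R C))"
      by (intro nn_integral_mono nn_integral_pmf_swap_le sf)
    also have "\<dots> \<le> (\<integral>\<^sup>+h. \<integral>\<^sup>+q. \<integral>\<^sup>+q'. \<phi> h q q' \<partial>(pair_pmf R C) \<partial>(pair_pmf R C) \<partial>B T)"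
      by (intro nn_integral_pmf_swap_le sf)
    also have "\<dots> \<le> (\<integral>\<^sup>+h. ennreal (d2 + t) \<partial>B T)" by (intro nn_integral_mono \<phi>)
    also have "\<dots> = ennreal (d2 + t)" using prob_space.emeasure_space_1[OF BD(1)] by simp
    finally show ?thesis .
  qed
  \<comment> \<open>The data are regrouped so that the first list, which determines the law of
    \<open>h\<close>, is separated from everything that is used after \<open>h\<close> is
    drawn.\<close>
  have law: "replicate_pmf (Suc k) (round_law E) = map_pmf (\<lambda>u. (fst u, fst (snd u)) # snd (snd u)) (pair_pmf R (pair_pmf R C))"
    by (simp add: round_law_def C_def R_def pair_pmf_def map_pmf_def bind_assoc_pmf bind_return_pmf)
  have "instability (replicate_pmf (Suc k) (round_law E)) (boost v)
    = (\<integral>\<^sup>+L. \<integral>\<^sup>+L'. \<integral>\<^sup>+q. \<integral>\<^sup>+q'. ennreal (tv_dist (boost v ((L, fst q) # snd q)) (boost v ((L', fst q') # snd q')))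
        \<partial>(pair_pmf R C) \<partial>(pair_pmf R C) \<partial>measure_pmf R \<partial>measure_pmf R)"
    unfolding law instability_map_pmf unfolding instability_def nn_integral_pair_pair_pmf[where P = R and Q = "pair_pmf R C"]
    by (simp only: fst_conv snd_conv)
  also have "\<dots> \<le> (\<integral>\<^sup>+L. \<integral>\<^sup>+L'. \<integral>\<^sup>+q. \<integral>\<^sup>+q'. ennreal \<bar>go_prob v L - go_prob v L'\<bar>
      + (if 0 < go_prob v L \<and> 0 < go_prob v L' then ennreal (tv_dist (B (kept v L)) (B (kept v L'))) else 0)
      + (\<integral>\<^sup>+h. \<phi> h q q' \<partial>B (kept v L')) \<partial>(pair_pmf R C) \<partial>(pair_pmf R C) \<partial>measure_pmf R \<partial>measure_pmf R)"
    by (intro nn_integral_mono point)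
  also have "\<dots> = (\<integral>\<^sup>+L. \<integral>\<^sup>+L'. ennreal \<bar>go_prob v L - go_prob v L'\<bar>
      + (if 0 < go_prob v L \<and> 0 < go_prob v L' then ennreal (tv_dist (B (kept v L)) (B (kept v L'))) else 0)
      + (\<integral>\<^sup>+q. \<integral>\<^sup>+q'. (\<integral>\<^sup>+h. \<phi> h q q' \<partial>B (kept v L')) \<partial>(pair_pmf R C) \<partial>(pair_pmf R C)) \<partial>measure_pmf R \<partial>measure_pmf R)"
    by (simp add: nn_integral_add)
  also have "\<dots> \<le> (\<integral>\<^sup>+L. \<integral>\<^sup>+L'. ennreal \<bar>go_prob v L - go_prob v L'\<bar>
      + (if 0 < go_prob v L \<and> 0 < go_prob v L' then ennreal (tv_dist (B (kept v L)) (B (kept v L'))) else 0)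
      + ennreal (d2 + t) \<partial>measure_pmf R \<partial>measure_pmf R)"
    by (intro nn_integral_mono add_left_mono swap)
  also have "\<dots> = (\<integral>\<^sup>+L. \<integral>\<^sup>+L'. ennreal \<bar>go_prob v L - go_prob v L'\<bar> \<partial>measure_pmf R \<partial>measure_pmf R)
      + (\<integral>\<^sup>+L. \<integral>\<^sup>+L'. (if 0 < go_prob v L \<and> 0 < go_prob v L' then ennreal (tv_dist (B (kept v L)) (B (kept v L'))) else 0) \<partial>measure_pmf R \<partial>measure_pmf R)
      + ennreal (d2 + t)"
    by (simp add: nn_integral_add)
  also have "\<dots> \<le> ennreal d1 + ennreal s + ennreal (d2 + t)"
  proof (intro add_mono order_refl)
    show "(\<integral>\<^sup>+L. \<integral>\<^sup>+L'. ennreal \<bar>go_prob v L - go_prob v L'\<bar> \<partial>measure_pmf R \<partial>measure_pmf R) \<le> ennreal d1"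
      unfolding go_prob_def R_def d1_def by (intro soft_test_mean_stable weight_bounds \<theta>\<^sub>1 N)
  qed (unfold R_def, intro first_stage_stable stable v)
  also have "\<dots> = ennreal (real (Suc k) * (d1 + s + d2))"
    using nn s by (simp add: t_def algebra_simps flip: ennreal_plus)
  finally show ?case by (simp add: d1_def d2_def)
qed

end

section \<open>Accuracy of boosting: reweighting and the potential\<close>

lemma err_eq_0_iff: "err D h = 0 \<longleftrightarrow> (\<forall>z\<in>set_pmf D. h (fst z) = snd z)"
  unfolding err_def measure_pmf_zero_iff by auto

context boosting
begin

definition noisy :: "('x \<times> bool) pmf \<Rightarrow> (('x \<times> bool) \<times> nat) pmf" where
  "noisy D = pair_pmf D (pmf_of_set {1..K})"

text \<open>A hinge in the vote, at least 1 exactly on accepted examples. There a correct vote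
  lowers it by 1 and a wrong one raises it by 1, so the mean is a discrete antiderivative of the
  acceptance probability.\<close>

definition potential :: "('x \<times> bool) pmf \<Rightarrow> ('x \<Rightarrow> int) \<Rightarrow> real" where
  "potential D v = measure_pmf.expectation (noisy D) (\<lambda>e. real_of_int (max 0 (int K + 1 - vote v (fst e) - int (snd e))))"

lemma set_noisy: "set_pmf (noisy D) = set_pmf D \<times> {1..K}"
  using K by (simp add: noisy_def)

lemma expectation_weight: "measure_pmf.expectation (noisy D) (weight v) = measure_pmf.prob (noisy D) (Collect (accepts K v))"
proof -
  have "weight v = indicator (Collect (accepts K v))" by (auto simp: weight_def indicator_def)
  then show ?thesis by simp
qed

lemma expectation_edge:
  "measure_pmf.expectation (noisy D) (edge v h) = measure_pmf.prob (noisy D) (Collect (accepts K v))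
    - 2 * measure_pmf.prob (noisy D) (Collect (accepts K v) \<inter> {e. h (fst (fst e)) \<noteq> snd (fst e)})"
proof -
  have "edge v h = (\<lambda>e. indicator (Collect (accepts K v)) e - 2 * indicator (Collect (accepts K v) \<inter> {e. h (fst (fst e)) \<noteq> snd (fst e)}) e)"
    by (auto simp: edge_def weight_def margin_def indicator_def fun_eq_iff)
  moreover have "measure_pmf.expectation p (\<lambda>e. indicator A e - 2 * indicator A' e) = measure_pmf.prob p A - 2 * measure_pmf.prob p A'"
    for p :: "(('x \<times> bool) \<times> nat) pmf" and A A'
    by (subst Bochner_Integration.integral_diff)
      (auto intro!: integrable_real_indicator simp: measure_pmf.emeasure_eq_measure)
  ultimately show ?thesis by simp
qed

text \<open>A misclassified example has vote at most 0, however ties are broken, so it is accepted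
  for every noise value up to \<open>K\<close>. A small acceptance rate therefore certifies a small
  error, and stopping is safe.\<close>

lemma err_majority_le:
  assumes "data_distribution X D"
  shows "err D (majority X v) \<le> measure_pmf.expectation (noisy D) (weight v)"
proof -
  have "D = map_pmf fst (noisy D)" by (simp add: noisy_def map_fst_pair_pmf)
  then have "err D (majority X v) = measure_pmf.prob (map_pmf fst (noisy D)) {(x, y). majority X v x \<noteq> y}"
    by (simp add: err_def)
  also have "\<dots> = measure_pmf.prob (noisy D) (fst -` {(x, y). majority X v x \<noteq> y})" by simp
  also have "\<dots> \<le> measure_pmf.prob (noisy D) (Collect (accepts K v))"
  proof (rule measure_pmf.finite_measure_mono_AE)
    show "AE e in measure_pmf (noisy D). e \<in> fst -` {(x, y). majority X v x \<noteq> y} \<longrightarrow> e \<in> Collect (accepts K v)"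
    proof (rule AE_pmfI)
      fix e assume "e \<in> set_pmf (noisy D)"
      then have "fst (fst e) \<in> X" "snd e \<le> K" using assms by (auto simp: set_noisy data_distribution_def)
      then show "e \<in> fst -` {(x, y). majority X v x \<noteq> y} \<longrightarrow> e \<in> Collect (accepts K v)"
        by (auto simp: accepts_def vote_def majority_def split: prod.splits)
    qed
  qed simp
  finally show ?thesis by (simp add: expectation_weight)
qed

lemma err_reweighted:
  assumes ne: "set_pmf (noisy D) \<inter> Collect (accepts K v) \<noteq> {}"
  shows "err (reweighted (noisy D) v) h = measure_pmf.prob (noisy D) (Collect (accepts K v) \<inter> {e. h (fst (fst e)) \<noteq> snd (fst e)})
    / measure_pmf.prob (noisy D) (Collect (accepts K v))"
proof -
  have pos: "emeasure (measure_pmf (noisy D)) (Collect (accepts K v)) \<noteq> 0"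
    using ne by (auto simp: measure_pmf.emeasure_eq_measure measure_pmf_zero_iff)
  have wrong: "fst -` {(x, y). h x \<noteq> y} = {e. h (fst (fst e)) \<noteq> snd (fst e)}" by (auto split: prod.splits)
  have "err (reweighted (noisy D) v) h
    = measure (uniform_measure (measure_pmf (noisy D)) (Collect (accepts K v))) {e. h (fst (fst e)) \<noteq> snd (fst e)}"
    unfolding err_def reweighted_def measure_map_pmf wrong cond_pmf.rep_eq[OF ne] ..
  then show ?thesis using pos by (simp add: measure_uniform_measure)
qed

lemma set_reweighted_subset:
  assumes "set_pmf (noisy D) \<inter> Collect (accepts K v) \<noteq> {}"
  shows "set_pmf (reweighted (noisy D) v) \<subseteq> set_pmf D"
  using assms by (auto simp: reweighted_def set_noisy)

lemma data_distribution_reweighted: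
  assumes "data_distribution X D" "set_pmf (noisy D) \<inter> Collect (accepts K v) \<noteq> {}"
  shows "data_distribution X (reweighted (noisy D) v)"
  using set_reweighted_subset[OF assms(2)] assms(1) by (auto simp: data_distribution_def)

lemma realizable_reweighted:
  assumes "realizable H D" "set_pmf (noisy D) \<inter> Collect (accepts K v) \<noteq> {}"
  shows "realizable H (reweighted (noisy D) v)"
  using set_reweighted_subset[OF assms(2)] assms(1) by (auto simp: realizable_def err_eq_0_iff)

text \<open>The edge is the accepted mass minus twice its misclassified part, and the latter is at
  most \<alpha> times the accepted mass.\<close>

lemma edge_ge_if_accurate:
  assumes ne: "set_pmf (noisy D) \<inter> Collect (accepts K v) \<noteq> {}" and acc: "err (reweighted (noisy D) v) h \<le> \<alpha>"
  shows "(1 - 2 * \<alpha>) * measure_pmf.expectation (noisy D) (weight v) \<le> measure_pmf.expectation (noisy D) (edge v h)"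
proof -
  have "measure_pmf.prob (noisy D) (Collect (accepts K v)) > 0"
    using ne by (auto simp: zero_less_measure_iff measure_pmf_zero_iff)
  with acc have "measure_pmf.prob (noisy D) (Collect (accepts K v) \<inter> {e. h (fst (fst e)) \<noteq> snd (fst e)})
    \<le> \<alpha> * measure_pmf.prob (noisy D) (Collect (accepts K v))"
    by (simp add: err_reweighted[OF ne] field_simps)
  then show ?thesis by (simp add: expectation_weight expectation_edge algebra_simps)
qed

text \<open>For each example at most one of the \<open>K\<close> equally likely noise values lies on
  the boundary. There the example is rejected, yet a wrong vote lifts the hinge from 0 to 1; this is
  the only error when the edge is read as the drop of the potential.\<close>

lemma prob_noise_boundary: "measure_pmf.prob (noisy D) {e. g (fst e) + int (snd e) = int K + 1} \<le> 1 / K"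
proof -
  have "emeasure (measure_pmf (noisy D)) {e. g (fst e) + int (snd e) = int K + 1}
    = (\<integral>\<^sup>+z. \<integral>\<^sup>+j. indicator {j. g z + int j = int K + 1} j \<partial>(pmf_of_set {1..K}) \<partial>measure_pmf D)"
  proof -
    have "emeasure (measure_pmf (noisy D)) {e. g (fst e) + int (snd e) = int K + 1}
      = (\<integral>\<^sup>+e. indicator {e. g (fst e) + int (snd e) = int K + 1} e \<partial>(pair_pmf D (pmf_of_set {1..K})))"
      by (simp add: noisy_def)
    also have "\<dots> = (\<integral>\<^sup>+z. \<integral>\<^sup>+j. indicator {j. g z + int j = int K + 1} j \<partial>(pmf_of_set {1..K}) \<partial>measure_pmf D)"
      unfolding nn_integral_pair_pmf' by (intro nn_integral_cong) (simp split: split_indicator)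
    finally show ?thesis .
  qed
  also have "\<dots> \<le> ennreal (1 / real K)"
  proof (rule nn_integral_pmf_const_le)
    fix z
    have "emeasure (measure_pmf (pmf_of_set {1..K})) {j. g z + int j = int K + 1}
      \<le> emeasure (measure_pmf (pmf_of_set {1..K})) {nat (int K + 1 - g z)}"
      by (intro emeasure_mono) auto
    also have "\<dots> \<le> ennreal (1 / real K)"
      using K by (simp add: emeasure_pmf_single indicator_def)
    finally show "(\<integral>\<^sup>+j. indicator {j. g z + int j = int K + 1} j \<partial>(pmf_of_set {1..K})) \<le> ennreal (1 / real K)"
      by simp
  qed
  finally show ?thesis by (simp add: measure_pmf.emeasure_eq_measure)
qed

text \<open>Ensures integrability of the hinge, which is unbounded in the vote; it is kept under
  adding a hypothesis.\<close>

definition bounded_votes :: "('x \<Rightarrow> int) \<Rightarrow> bool" where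
  "bounded_votes v \<longleftrightarrow> (\<exists>b. \<forall>x\<in>X. \<bar>v x\<bar> \<le> b)"

lemma bounded_votes_add_vote: "bounded_votes v \<Longrightarrow> bounded_votes (add_vote X v h)"
proof -
  assume "bounded_votes v"
  then obtain b where b: "\<And>x. x \<in> X \<Longrightarrow> \<bar>v x\<bar> \<le> b" by (auto simp: bounded_votes_def)
  have "\<bar>add_vote X v h x\<bar> \<le> b + 1" if "x \<in> X" for x
  proof -
    have "add_vote X v h x = v x + 1 \<or> add_vote X v h x = v x - 1" using that by (simp add: add_vote_def)
    then show ?thesis using b[OF that] by linarith
  qed
  then show ?thesis unfolding bounded_votes_def by blast
qed

lemma potential_nonneg: "0 \<le> potential D v"
  unfolding potential_def by (intro integral_nonneg_AE) auto

lemma potential_0_le: "potential D (\<lambda>x\<in>X. 0) \<le> K" if "data_distribution X D"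
  unfolding potential_def
proof (rule measure_pmf.integral_le_const)
  have b: "real_of_int (max 0 (int K + 1 - vote (\<lambda>x\<in>X. 0) (fst e) - int (snd e))) \<le> K"
    if "e \<in> set_pmf (noisy D)" for e
  proof -
    have "fst (fst e) \<in> X" "1 \<le> snd e" using that \<open>data_distribution X D\<close> by (auto simp: set_noisy data_distribution_def)
    then show ?thesis by (simp add: vote_def)
  qed
  show "integrable (measure_pmf (noisy D)) (\<lambda>e. real_of_int (max 0 (int K + 1 - vote (\<lambda>x\<in>X. 0) (fst e) - int (snd e))))"
    by (rule measure_pmf.integrable_const_bound[where B = K]) (use b in \<open>auto simp: AE_measure_pmf_iff\<close>)
  show "AE e in measure_pmf (noisy D). real_of_int (max 0 (int K + 1 - vote (\<lambda>x\<in>X. 0) (fst e) - int (snd e))) \<le> K"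
    using b by (auto simp: AE_measure_pmf_iff)
qed

text \<open>On accepted examples the hinge changes by exactly minus the margin. On rejected ones it
  stays 0, except on the boundary, where it grows by at most 1.\<close>

lemma potential_add_vote_le:
  assumes D: "data_distribution X D" and v: "bounded_votes v"
  shows "potential D (add_vote X v h) \<le> potential D v - measure_pmf.expectation (noisy D) (edge v h) + 1 / K"
proof -
  let ?p = "\<lambda>v e. real_of_int (max 0 (int K + 1 - vote v (fst e) - int (snd e)))"
  let ?A = "{e. vote v (fst e) + int (snd e) = int K + 1}"
  have int: "integrable (measure_pmf (noisy D)) (?p u)" if "bounded_votes u" for u
  proof -
    from that obtain b where b: "\<And>x. x \<in> X \<Longrightarrow> \<bar>u x\<bar> \<le> b" by (auto simp: bounded_votes_def)
    have "norm (?p u e) \<le> real_of_int (int K + 1 + \<bar>b\<bar>)" if "e \<in> set_pmf (noisy D)" for e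
    proof -
      have "fst (fst e) \<in> X" using that D by (auto simp: set_noisy data_distribution_def)
      from b[OF this] have "max 0 (int K + 1 - vote u (fst e) - int (snd e)) \<le> int K + 1 + \<bar>b\<bar>"
        by (auto simp: vote_def)
      then show ?thesis by simp
    qed
    then show ?thesis by (intro measure_pmf.integrable_const_bound) (auto simp: AE_measure_pmf_iff)
  qed
  have ie: "integrable (measure_pmf (noisy D)) (edge v h)"
    by (rule measure_pmf.integrable_const_bound[where B = 1]) (use edge_bounds in auto)
  have iA: "integrable (measure_pmf (noisy D)) (indicator ?A :: _ \<Rightarrow> real)"
    by (intro integrable_real_indicator) (auto simp: measure_pmf.emeasure_eq_measure)
  have "potential D (add_vote X v h) \<le> (\<integral>e. ?p v e - edge v h e + indicator ?A e \<partial>measure_pmf (noisy D))"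
    unfolding potential_def
  proof (rule integral_mono_AE[OF int[OF bounded_votes_add_vote[OF v]]])
    show "integrable (measure_pmf (noisy D)) (\<lambda>e. ?p v e - edge v h e + indicator ?A e)"
      by (intro Bochner_Integration.integrable_add Bochner_Integration.integrable_diff int[OF v] ie iA)
    show "AE e in measure_pmf (noisy D). ?p (add_vote X v h) e \<le> ?p v e - edge v h e + indicator ?A e"
    proof (rule AE_pmfI)
      fix e assume "e \<in> set_pmf (noisy D)"
      then have x: "fst (fst e) \<in> X" using D by (auto simp: set_noisy data_distribution_def)
      have v': "vote (add_vote X v h) (fst e) = vote v (fst e) + margin h (fst e)"
        using x by (auto simp: vote_def add_vote_def margin_def)
      have "margin h (fst e) = 1 \<or> margin h (fst e) = - 1" by (auto simp: margin_def)
      then show "?p (add_vote X v h) e \<le> ?p v e - edge v h e + indicator ?A e"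
        unfolding v' by (auto simp: edge_def weight_def accepts_def indicator_def max_def)
    qed
  qed
  also have "\<dots> = potential D v - measure_pmf.expectation (noisy D) (edge v h) + measure_pmf.prob (noisy D) ?A"
    using int[OF v] ie iA by (subst Bochner_Integration.integral_add, simp, simp, subst Bochner_Integration.integral_diff)
      (simp_all add: potential_def)
  also have "\<dots> \<le> potential D v - measure_pmf.expectation (noisy D) (edge v h) + 1 / K"
    using prob_noise_boundary[of D "vote v"] by simp
  finally show ?thesis .
qed

text \<open>
  A round halves \<open>2 powr (K * potential D v)\<close> with probability at least \<open>c\<close>, because a hypothesis that is
  accurate for the reweighted distribution has a large edge.  The failure probability is therefore
  bounded by this weight times \<open>(1 - c / 2)^k\<close>, plus the probability that some test misleads.
\<close>

lemma boost_failure_le: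
  fixes \<alpha> \<alpha>' c :: real
  assumes D: "data_distribution X D" and real: "realizable H D"
    and weak: "\<And>D. data_distribution X D \<Longrightarrow> realizable H D \<Longrightarrow>
      (\<integral>\<^sup>+T. emeasure (B T) {h \<in> space (hyp_space X). \<alpha> < err D h} \<partial>(replicate_pmf m D)) \<le> ennreal (1 - c)"
    and c: "0 < c" "c \<le> 1" and \<alpha>: "\<alpha> < 1 / 2"
    and \<theta>: "5 * \<theta>\<^sub>1 / 4 \<le> \<alpha>'" "5 * \<theta>\<^sub>2 / 4 \<le> (1 - 2 * \<alpha>) * (\<theta>\<^sub>1 / 4)" "\<theta>\<^sub>2 \<le> \<theta>\<^sub>1" "2 / real K \<le> \<theta>\<^sub>2 / 4"
    and \<delta>: "exp (- (real N * \<theta>\<^sub>2\<^sup>2 / 32)) \<le> \<delta>"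
    and v: "v \<in> space (vote_space X)" "bounded_votes v"
  shows "(\<integral>\<^sup>+cs. emeasure (boost v cs) {h \<in> space (hyp_space X). \<alpha>' < err D h} \<partial>(replicate_pmf k (round_law (noisy D))))
    \<le> ennreal (2 * \<delta> * real k + 2 powr (real K * potential D v) * (1 - c / 2) ^ k)"
  using v
proof (induction k arbitrary: v)
  let ?bad = "{h \<in> space (hyp_space X). \<alpha>' < err D h}"
  case 0
  have "emeasure (boost v []) ?bad \<le> 1"
    using boost_in_prob_algebra[OF 0(1), of "[]"]
    by (intro prob_space.emeasure_le_1 space_prob_algebraD(1))
  \<comment> \<open>With no round left the bound is trivial: the potential is nonnegative, so its
    weight is at least 1.\<close>
  also have "1 \<le> ennreal (2 powr (real K * potential D v))"
    using potential_nonneg[of D v] by (simp add: ge_one_powr_ge_zero)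
  finally show ?case by (simp add: nn_integral_return)
next
  let ?bad = "{h \<in> space (hyp_space X). \<alpha>' < err D h}"
  case (Suc k)
  note v = Suc.prems
  have bad: "?bad \<in> sets (hyp_space X)" using err_measurable[OF D] by measurable
  define E where "E = noisy D"
  define R where "R = replicate_pmf N E"
  define C where "C = replicate_pmf k (round_law E)"
  define a where "a = measure_pmf.expectation E (weight v)"
  define W where "W = 2 powr (real K * potential D v) * (1 - c / 2) ^ k"
  have W0: "0 \<le> W" using c by (simp add: W_def)
  have \<delta>0: "0 < \<delta>" by (rule less_le_trans[OF _ \<delta>]) simp
  have \<delta>1: "exp (- (real N * \<theta>\<^sub>1\<^sup>2 / 32)) \<le> \<delta>"
  proof (rule order_trans[OF _ \<delta>])
    have "\<theta>\<^sub>2\<^sup>2 \<le> \<theta>\<^sub>1\<^sup>2" using \<theta>\<^sub>2 \<theta>(3) by (intro power_mono) auto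
    then show "exp (- (real N * \<theta>\<^sub>1\<^sup>2 / 32)) \<le> exp (- (real N * \<theta>\<^sub>2\<^sup>2 / 32))" by (simp add: mult_left_mono)
  qed
  define X' where "X' u = (\<integral>\<^sup>+cs. emeasure (boost u cs) ?bad \<partial>measure_pmf C)" for u
  have IH: "X' u \<le> ennreal (2 * \<delta> * real k + 2 powr (real K * potential D u) * (1 - c / 2) ^ k)"
    if "u \<in> space (vote_space X)" "bounded_votes u" for u
    using Suc.IH[OF that] by (simp add: X'_def C_def E_def)
  have em1: "emeasure (boost u cs) ?bad \<le> 1" if "u \<in> space (vote_space X)" for u cs
    using boost_in_prob_algebra[OF that, of cs] by (intro prob_space.emeasure_le_1 space_prob_algebraD(1))
  have X1: "X' u \<le> 1" if "u \<in> space (vote_space X)" for u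
    unfolding X'_def by (intro nn_integral_pmf_const_le em1 that)
  define Z where "Z h = (\<integral>\<^sup>+q. emeasure (continue v (fst q) (snd q) h) ?bad \<partial>(pair_pmf R C))" for h
  have bindM: "B (kept v L) \<bind> continue v L2 cs \<in> space (prob_algebra (hyp_space X))" for L L2 cs
    by (intro bind_in_prob_algebra[OF B] measurable_continue v)
  have law: "replicate_pmf (Suc k) (round_law E) = map_pmf (\<lambda>u. (fst u, fst (snd u)) # snd (snd u)) (pair_pmf R (pair_pmf R C))"
    by (simp add: round_law_def C_def R_def pair_pmf_def map_pmf_def bind_assoc_pmf bind_return_pmf)
  have stopE: "emeasure (return (hyp_space X) (majority X v)) ?bad = indicator ?bad (majority X v)"
    using bad by (rule emeasure_return)
  have "(\<integral>\<^sup>+cs. emeasure (boost v cs) ?bad \<partial>(replicate_pmf (Suc k) (round_law E)))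
    = (\<integral>\<^sup>+L. \<integral>\<^sup>+q. ennreal (go_prob v L) * (\<integral>\<^sup>+h. emeasure (continue v (fst q) (snd q) h) ?bad \<partial>B (kept v L))
        + ennreal (1 - go_prob v L) * indicator ?bad (majority X v) \<partial>(pair_pmf R C) \<partial>measure_pmf R)"
    unfolding law nn_integral_map_pmf nn_integral_pair_pmf'[where A = R] boost_Cons fst_conv snd_conv
    by (subst emeasure_mix[OF bindM return_majority go_prob_bounds bad])
      (simp only: stopE emeasure_bind_prob_algebra[OF B measurable_continue[OF v(1)] bad])
  also have "\<dots> = (\<integral>\<^sup>+L. ennreal (go_prob v L) * (\<integral>\<^sup>+q. \<integral>\<^sup>+h. emeasure (continue v (fst q) (snd q) h) ?bad \<partial>B (kept v L) \<partial>(pair_pmf R C))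
        + ennreal (1 - go_prob v L) * indicator ?bad (majority X v) \<partial>measure_pmf R)"
    by (simp add: nn_integral_add nn_integral_cmult)
  also have "\<dots> \<le> (\<integral>\<^sup>+L. ennreal (go_prob v L) * (\<integral>\<^sup>+h. Z h \<partial>B (kept v L))
        + ennreal (1 - go_prob v L) * indicator ?bad (majority X v) \<partial>measure_pmf R)"
    unfolding Z_def
    by (intro nn_integral_mono add_right_mono mult_left_mono nn_integral_pmf_swap_le
        prob_space_imp_sigma_finite space_prob_algebraD(1)[OF B]) auto
  also have "\<dots> = (\<integral>\<^sup>+L. ennreal (go_prob v L) * (\<integral>\<^sup>+h. Z h \<partial>B (kept v L)) \<partial>measure_pmf R)
      + (\<integral>\<^sup>+L. ennreal (1 - go_prob v L) \<partial>measure_pmf R) * indicator ?bad (majority X v)"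
    by (simp add: nn_integral_add nn_integral_multc)
  finally have main: "(\<integral>\<^sup>+cs. emeasure (boost v cs) ?bad \<partial>(replicate_pmf (Suc k) (round_law E)))
    \<le> (\<integral>\<^sup>+L. ennreal (go_prob v L) * (\<integral>\<^sup>+h. Z h \<partial>B (kept v L)) \<partial>measure_pmf R)
      + (\<integral>\<^sup>+L. ennreal (1 - go_prob v L) \<partial>measure_pmf R) * indicator ?bad (majority X v)" .
  have Z_eq: "Z h = (\<integral>\<^sup>+L. ennreal (add_prob v h L) * X' (add_vote X v h) + ennreal (1 - add_prob v h L) * X' v \<partial>measure_pmf R)" for h
  proof -
    have "Z h = (\<integral>\<^sup>+L. \<integral>\<^sup>+cs. ennreal (add_prob v h L) * emeasure (boost (add_vote X v h) cs) ?bad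
        + ennreal (1 - add_prob v h L) * emeasure (boost v cs) ?bad \<partial>measure_pmf C \<partial>measure_pmf R)"
      unfolding Z_def nn_integral_pair_pmf' continue_def fst_conv snd_conv
      by (subst emeasure_mix[OF boost_in_prob_algebra[OF add_vote_in_space] boost_in_prob_algebra[OF v(1)] add_prob_bounds bad]) simp
    then show ?thesis by (simp add: nn_integral_add nn_integral_cmult X'_def)
  qed
  have split1: "ennreal p * z + ennreal (1 - p) * z = z" if "0 \<le> p" "p \<le> 1" for p z
  proof -
    have "ennreal p + ennreal (1 - p) = 1" using that by (simp flip: ennreal_plus)
    then show ?thesis by (simp flip: distrib_right)
  qed
  have Z1: "Z h \<le> 1" for h
    unfolding Z_eq
  proof (rule nn_integral_pmf_const_le)
    fix L
    have "ennreal (add_prob v h L) * X' (add_vote X v h) + ennreal (1 - add_prob v h L) * X' v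
      \<le> ennreal (add_prob v h L) * 1 + ennreal (1 - add_prob v h L) * 1"
      by (intro add_mono mult_left_mono X1 v add_vote_in_space) auto
    then show "ennreal (add_prob v h L) * X' (add_vote X v h) + ennreal (1 - add_prob v h L) * X' v \<le> 1"
      using split1[OF add_prob_bounds, of v h L 1] by simp
  qed
  have BZ1: "(\<integral>\<^sup>+h. Z h \<partial>B T) \<le> 1" for T
  proof -
    have "(\<integral>\<^sup>+h. Z h \<partial>B T) \<le> (\<integral>\<^sup>+h. 1 \<partial>B T)" by (intro nn_integral_mono Z1)
    then show ?thesis using prob_space.emeasure_space_1[OF space_prob_algebraD(1)[OF B]] by simp
  qed
  have err_a: "err D (majority X v) \<le> a" unfolding a_def E_def by (rule err_majority_le[OF D])
  have Wr: "0 \<le> 2 * \<delta> * real (Suc k) + W * (1 - c / 2)" using \<delta>0 W0 c by simp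
  have "(\<integral>\<^sup>+L. ennreal (go_prob v L) * (\<integral>\<^sup>+h. Z h \<partial>B (kept v L)) \<partial>measure_pmf R)
      + (\<integral>\<^sup>+L. ennreal (1 - go_prob v L) \<partial>measure_pmf R) * indicator ?bad (majority X v)
    \<le> ennreal (2 * \<delta> * real (Suc k) + W * (1 - c / 2))"
  proof (cases "a \<le> \<theta>\<^sub>1 / 4")
    \<comment> \<open>Few examples are accepted: stopping is correct because the majority errs
      rarely, and the test goes on only with probability \<delta>.\<close>
    case True
    then have "majority X v \<notin> ?bad" using err_a \<theta>(1) \<theta>\<^sub>1 by auto
    then have "indicator ?bad (majority X v) = (0 :: ennreal)" by (rule indicator_simps(2))
    then have "(\<integral>\<^sup>+L. ennreal (go_prob v L) * (\<integral>\<^sup>+h. Z h \<partial>B (kept v L)) \<partial>measure_pmf R)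
      + (\<integral>\<^sup>+L. ennreal (1 - go_prob v L) \<partial>measure_pmf R) * indicator ?bad (majority X v)
      = (\<integral>\<^sup>+L. ennreal (go_prob v L) * (\<integral>\<^sup>+h. Z h \<partial>B (kept v L)) \<partial>measure_pmf R)"
      by (simp only: mult_zero_right add_0_right)
    also have "\<dots> \<le> (\<integral>\<^sup>+L. ennreal (go_prob v L) * 1 \<partial>measure_pmf R)"
      by (intro nn_integral_mono mult_left_mono BZ1) auto
    also have "\<dots> \<le> ennreal \<delta>"
      unfolding mult_1_right go_prob_def R_def
      by (rule order_trans[OF soft_test_mean_low[OF weight_bounds \<theta>\<^sub>1 N True[unfolded a_def]] ennreal_leI[OF \<delta>1]])
    also have "\<dots> \<le> ennreal (2 * \<delta> * real (Suc k) + W * (1 - c / 2))"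
    proof (rule ennreal_leI)
      have "\<delta> \<le> 2 * \<delta> * real (Suc k)" using \<delta>0 by (simp add: algebra_simps)
      moreover have "0 \<le> W * (1 - c / 2)" using W0 c by simp
      ultimately show "\<delta> \<le> 2 * \<delta> * real (Suc k) + W * (1 - c / 2)" by linarith
    qed
    finally show ?thesis .
  next
    case False
    then have a: "\<theta>\<^sub>1 / 4 \<le> a" "0 < a" using \<theta>\<^sub>1 by auto
    have ne: "set_pmf (noisy D) \<inter> Collect (accepts K v) \<noteq> {}"
    proof -
      have "measure_pmf.prob (noisy D) (Collect (accepts K v)) \<noteq> 0"
        using a(2) by (simp add: a_def E_def expectation_weight)
      then show ?thesis by (simp add: measure_pmf_zero_iff)
    qed
    \<comment> \<open>Here the accepted mass is at least \<open>\<theta>\<^sub>1 / 4\<close>, so a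
      hypothesis that is accurate for the reweighted law has an edge large enough to pass the
      test.\<close>
    define good where "good h \<longleftrightarrow> err (reweighted E v) h \<le> \<alpha>" for h
    have good_edge: "5 * \<theta>\<^sub>2 / 4 \<le> measure_pmf.expectation E (edge v h)" if "good h" for h
    proof -
      have "5 * \<theta>\<^sub>2 / 4 \<le> (1 - 2 * \<alpha>) * a"
        by (rule order_trans[OF \<theta>(2)]) (use a \<alpha> in \<open>intro mult_left_mono; simp\<close>)
      also have "\<dots> \<le> measure_pmf.expectation E (edge v h)"
        unfolding a_def E_def by (rule edge_ge_if_accurate[OF ne]) (use that in \<open>simp add: good_def E_def\<close>)
      finally show ?thesis .
    qed
    define b0 where "b0 = 2 * \<delta> * real k"
    have b0: "0 \<le> b0" using \<delta>0 by (simp add: b0_def)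
    \<comment> \<open>Three cases. A tiny edge is kept with probability at most \<delta>. Any larger
      edge halves the weight if the hypothesis is kept, and an accurate hypothesis is kept except
      with probability \<delta>. A hypothesis that is not accurate but has such an edge does no harm
      either way.\<close>
    have Zle: "Z h \<le> ennreal (\<delta> + b0 + (if good h then W / 2 else W))" for h
    proof (cases "measure_pmf.expectation E (edge v h) \<le> \<theta>\<^sub>2 / 4")
      case True
      then have ng: "\<not> good h" using good_edge[of h] \<theta>\<^sub>2 by auto
      have "Z h \<le> (\<integral>\<^sup>+L. ennreal (add_prob v h L) * 1 + 1 * X' v \<partial>measure_pmf R)"
        unfolding Z_eq by (intro nn_integral_mono add_mono mult_mono X1 add_vote_in_space) (auto simp: add_prob_bounds)
      also have "\<dots> = (\<integral>\<^sup>+L. ennreal (add_prob v h L) \<partial>measure_pmf R) + X' v"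
        by (simp add: nn_integral_add)
      also have "\<dots> \<le> ennreal \<delta> + ennreal (b0 + W)"
      proof (rule add_mono)
        show "(\<integral>\<^sup>+L. ennreal (add_prob v h L) \<partial>measure_pmf R) \<le> ennreal \<delta>"
          unfolding add_prob_def R_def
          by (rule order_trans[OF soft_test_mean_low[OF edge_bounds \<theta>\<^sub>2 N True] ennreal_leI[OF \<delta>]])
        show "X' v \<le> ennreal (b0 + W)" using IH[OF v] by (simp add: b0_def W_def)
      qed
      finally show ?thesis using ng \<delta>0 b0 W0 by (simp add: add.assoc)
    next
      case False
      \<comment> \<open>The edge exceeds \<open>2 / K\<close> and the boundary costs at most
        \<open>1 / K\<close>, so the potential drops by \<open>1 / K\<close>: exactly what halves
        the weight.\<close>
      have pot: "K * potential D (add_vote X v h) \<le> K * potential D v - 1"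
      proof -
        have "2 / real K \<le> measure_pmf.expectation (noisy D) (edge v h)" using False \<theta>(4) by (simp add: E_def)
        then have "potential D (add_vote X v h) \<le> potential D v - 1 / K"
          using potential_add_vote_le[OF D v(2), of h] K by (simp add: field_simps)
        then have "K * potential D (add_vote X v h) \<le> K * (potential D v - 1 / K)"
          by (intro mult_left_mono) auto
        then show ?thesis using K by (simp add: algebra_simps)
      qed
      have Xadd: "X' (add_vote X v h) \<le> ennreal (b0 + W / 2)"
      proof (rule order_trans[OF IH[OF add_vote_in_space bounded_votes_add_vote[OF v(2)]]], rule ennreal_leI)
        have "2 powr (real K * potential D (add_vote X v h)) \<le> 2 powr (real K * potential D v - 1)"
          using pot by (intro powr_mono) auto
        also have "\<dots> = 2 powr (real K * potential D v) / 2" by (simp add: powr_diff)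
        finally have "2 powr (real K * potential D (add_vote X v h)) * (1 - c / 2) ^ k \<le> 2 powr (real K * potential D v) / 2 * (1 - c / 2) ^ k"
          using c by (intro mult_right_mono) auto
        then show "2 * \<delta> * real k + 2 powr (real K * potential D (add_vote X v h)) * (1 - c / 2) ^ k \<le> b0 + W / 2"
          by (simp add: b0_def W_def)
      qed
      show ?thesis
      proof (cases "good h")
        case True
        have "Z h \<le> (\<integral>\<^sup>+L. 1 * ennreal (b0 + W / 2) + ennreal (1 - add_prob v h L) * 1 \<partial>measure_pmf R)"
          unfolding Z_eq
          by (intro nn_integral_mono add_mono mult_mono Xadd X1 v) (auto simp: add_prob_bounds)
        also have "\<dots> = ennreal (b0 + W / 2) + (\<integral>\<^sup>+L. ennreal (1 - add_prob v h L) \<partial>measure_pmf R)"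
          by (simp add: nn_integral_add)
        also have "\<dots> \<le> ennreal (b0 + W / 2) + ennreal \<delta>"
          unfolding add_prob_def R_def
          by (intro add_left_mono order_trans[OF soft_test_mean_high[OF edge_bounds \<theta>\<^sub>2 N good_edge[OF True]] ennreal_leI[OF \<delta>]])
        finally show ?thesis using True \<delta>0 b0 W0 by (simp add: ac_simps flip: ennreal_plus)
      next
        case ng: False
        have "Z h \<le> ennreal (b0 + W)"
          unfolding Z_eq
        proof (rule nn_integral_pmf_const_le)
          fix L
          have "X' (add_vote X v h) \<le> ennreal (b0 + W)"
            by (rule order_trans[OF Xadd]) (use W0 in \<open>auto intro: ennreal_leI\<close>)
          moreover have "X' v \<le> ennreal (b0 + W)" using IH[OF v] by (simp add: b0_def W_def)
          ultimately have "ennreal (add_prob v h L) * X' (add_vote X v h) + ennreal (1 - add_prob v h L) * X' v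
            \<le> ennreal (add_prob v h L) * ennreal (b0 + W) + ennreal (1 - add_prob v h L) * ennreal (b0 + W)"
            by (intro add_mono mult_left_mono) auto
          then show "ennreal (add_prob v h L) * X' (add_vote X v h) + ennreal (1 - add_prob v h L) * X' v \<le> ennreal (b0 + W)"
            by (simp only: split1[OF add_prob_bounds])
        qed
        also have "\<dots> \<le> ennreal (\<delta> + b0 + (if good h then W / 2 else W))"
          using ng \<delta>0 by (intro ennreal_leI) auto
        finally show ?thesis .
      qed
    qed
    let ?badr = "{h \<in> space (hyp_space X). \<alpha> < err (reweighted (noisy D) v) h}"
    note Dv = data_distribution_reweighted[OF D ne] realizable_reweighted[OF real ne]
    have badr: "?badr \<in> sets (hyp_space X)" using err_measurable[OF Dv(1)] by measurable
    \<comment> \<open>Half of \<open>W\<close> is always charged, the other half only when the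
      hypothesis is bad. As that has probability at most \<open>1 - c\<close>, the total is
      \<open>W / 2 + W / 2 * (1 - c) = W * (1 - c / 2)\<close>.\<close>
    have BZ: "(\<integral>\<^sup>+h. Z h \<partial>B T) \<le> ennreal (\<delta> + b0 + W / 2) + ennreal (W / 2) * emeasure (B T) ?badr" for T
    proof -
      note BD = space_prob_algebraD[OF B[of T]]
      have badB: "?badr \<in> sets (B T)" using badr BD by simp
      have "(\<integral>\<^sup>+h. Z h \<partial>B T) \<le> (\<integral>\<^sup>+h. ennreal (\<delta> + b0 + W / 2) + ennreal (W / 2) * indicator ?badr h \<partial>B T)"
      proof (rule nn_integral_mono)
        fix h assume "h \<in> space (B T)"
        then have "h \<in> space (hyp_space X)" using BD by simp
        then have "ennreal (\<delta> + b0 + (if good h then W / 2 else W)) \<le> ennreal (\<delta> + b0 + W / 2) + ennreal (W / 2) * indicator ?badr h"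
          using \<delta>0 b0 W0 by (auto simp: good_def E_def indicator_def simp flip: ennreal_plus)
        then show "Z h \<le> ennreal (\<delta> + b0 + W / 2) + ennreal (W / 2) * indicator ?badr h"
          using Zle[of h] by (rule order_trans[rotated])
      qed
      also have "\<dots> = ennreal (\<delta> + b0 + W / 2) + ennreal (W / 2) * emeasure (B T) ?badr"
        using badB prob_space.emeasure_space_1[OF BD(1)]
        by (subst nn_integral_add) (auto simp: nn_integral_cmult)
      finally show ?thesis .
    qed
    have kept_bad: "(\<integral>\<^sup>+L. ennreal (go_prob v L) * emeasure (B (kept v L)) ?badr \<partial>measure_pmf R) \<le> ennreal (1 - c)"
    proof -
      have "(\<integral>\<^sup>+L. ennreal (go_prob v L) * emeasure (B (kept v L)) ?badr \<partial>measure_pmf R)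
        \<le> (\<integral>\<^sup>+L. (if 0 < go_prob v L then emeasure (B (kept v L)) ?badr else 0) \<partial>measure_pmf R)"
      proof (rule nn_integral_mono)
        fix L
        have "ennreal (go_prob v L) * emeasure (B (kept v L)) ?badr \<le> 1 * emeasure (B (kept v L)) ?badr"
          using go_prob_bounds[of v L] by (intro mult_right_mono) auto
        then show "ennreal (go_prob v L) * emeasure (B (kept v L)) ?badr \<le> (if 0 < go_prob v L then emeasure (B (kept v L)) ?badr else 0)"
          using go_prob_bounds(1)[of v L] by auto
      qed
      also have "\<dots> \<le> (\<integral>\<^sup>+T. emeasure (B T) ?badr \<partial>(replicate_pmf m (reweighted (noisy D) v)))"
        unfolding R_def E_def by (rule nn_integral_kept_le[OF ne])
      also have "\<dots> \<le> ennreal (1 - c)" by (rule weak[OF Dv])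
      finally show ?thesis .
    qed
    have "(\<integral>\<^sup>+L. ennreal (go_prob v L) * (\<integral>\<^sup>+h. Z h \<partial>B (kept v L)) \<partial>measure_pmf R)
      \<le> (\<integral>\<^sup>+L. ennreal (\<delta> + b0 + W / 2) + ennreal (W / 2) * (ennreal (go_prob v L) * emeasure (B (kept v L)) ?badr) \<partial>measure_pmf R)"
    proof (rule nn_integral_mono)
      fix L
      have "ennreal (go_prob v L) * (\<integral>\<^sup>+h. Z h \<partial>B (kept v L))
        \<le> ennreal (go_prob v L) * (ennreal (\<delta> + b0 + W / 2) + ennreal (W / 2) * emeasure (B (kept v L)) ?badr)"
        by (intro mult_left_mono BZ) auto
      also have "\<dots> = ennreal (go_prob v L) * ennreal (\<delta> + b0 + W / 2) + ennreal (W / 2) * (ennreal (go_prob v L) * emeasure (B (kept v L)) ?badr)"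
        by (simp add: distrib_left mult_ac)
      also have "\<dots> \<le> 1 * ennreal (\<delta> + b0 + W / 2) + ennreal (W / 2) * (ennreal (go_prob v L) * emeasure (B (kept v L)) ?badr)"
        using go_prob_bounds[of v L] by (intro add_right_mono mult_right_mono) auto
      finally show "ennreal (go_prob v L) * (\<integral>\<^sup>+h. Z h \<partial>B (kept v L))
        \<le> ennreal (\<delta> + b0 + W / 2) + ennreal (W / 2) * (ennreal (go_prob v L) * emeasure (B (kept v L)) ?badr)" by simp
    qed
    also have "\<dots> = ennreal (\<delta> + b0 + W / 2) + ennreal (W / 2) * (\<integral>\<^sup>+L. ennreal (go_prob v L) * emeasure (B (kept v L)) ?badr \<partial>measure_pmf R)"
      by (simp add: nn_integral_add nn_integral_cmult)
    also have "\<dots> \<le> ennreal (\<delta> + b0 + W / 2) + ennreal (W / 2) * ennreal (1 - c)"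
      by (intro add_left_mono mult_left_mono kept_bad) auto
    also have "\<dots> = ennreal (\<delta> + b0 + W * (1 - c / 2))"
    proof -
      have "ennreal (\<delta> + b0 + W / 2) + ennreal (W / 2) * ennreal (1 - c) = ennreal (\<delta> + b0 + W / 2 + W / 2 * (1 - c))"
        using \<delta>0 b0 W0 c by (simp flip: ennreal_mult ennreal_plus)
      also have "\<delta> + b0 + W / 2 + W / 2 * (1 - c) = \<delta> + b0 + W * (1 - c / 2)" by (simp add: field_simps)
      finally show ?thesis .
    qed
    finally have first: "(\<integral>\<^sup>+L. ennreal (go_prob v L) * (\<integral>\<^sup>+h. Z h \<partial>B (kept v L)) \<partial>measure_pmf R) \<le> ennreal (\<delta> + b0 + W * (1 - c / 2))" .
    \<comment> \<open>Stopping matters only if the majority is bad. Then its error, and with it the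
      acceptance rate, is above \<open>5 * \<theta>\<^sub>1 / 4\<close>, and the test stops with
      probability at most \<delta>. This is the second \<delta> of the round.\<close>
    have second: "(\<integral>\<^sup>+L. ennreal (1 - go_prob v L) \<partial>measure_pmf R) * indicator ?bad (majority X v) \<le> ennreal \<delta>"
    proof (cases "majority X v \<in> ?bad")
      case True
      then have "5 * \<theta>\<^sub>1 / 4 \<le> measure_pmf.expectation E (weight v)" using err_a \<theta>(1) by (simp add: a_def)
      from soft_test_mean_high[OF weight_bounds \<theta>\<^sub>1 N this]
      have "(\<integral>\<^sup>+L. ennreal (1 - go_prob v L) \<partial>measure_pmf R) \<le> ennreal \<delta>"
        unfolding go_prob_def R_def by (rule order_trans) (rule ennreal_leI[OF \<delta>1])
      then show ?thesis using True by simp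
    qed simp
    have "ennreal (\<delta> + b0 + W * (1 - c / 2)) + ennreal \<delta> = ennreal (2 * \<delta> * real (Suc k) + W * (1 - c / 2))"
    proof -
      have "0 \<le> W * (1 - c / 2)" using W0 c by simp
      then have "ennreal (\<delta> + b0 + W * (1 - c / 2)) + ennreal \<delta> = ennreal (\<delta> + b0 + W * (1 - c / 2) + \<delta>)"
        using \<delta>0 b0 by (simp flip: ennreal_plus)
      also have "\<delta> + b0 + W * (1 - c / 2) + \<delta> = 2 * \<delta> * real (Suc k) + W * (1 - c / 2)"
        by (simp add: b0_def algebra_simps)
      finally show ?thesis .
    qed
    then show ?thesis using add_mono[OF first second] by simp
  qed
  then show ?case using main by (simp add: W_def E_def mult_ac)
qed

end

section \<open>From integrals to learners\<close>

lemma ennreal_expectation: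
  assumes "\<And>x. x \<in> set_pmf P \<Longrightarrow> 0 \<le> f x \<and> f x \<le> (1::real)"
  shows "ennreal (measure_pmf.expectation P f) = (\<integral>\<^sup>+x. ennreal (f x) \<partial>measure_pmf P)"
proof (rule nn_integral_eq_integral[symmetric])
  show "integrable (measure_pmf P) f"
    by (rule measure_pmf.integrable_const_bound[where B = 1]) (use assms in \<open>auto simp: AE_measure_pmf_iff\<close>)
qed (use assms in \<open>auto simp: AE_measure_pmf_iff\<close>)

lemma instability_expectation:
  assumes "\<And>S. S \<in> set_pmf P \<Longrightarrow> A S \<in> space (prob_algebra M)"
  shows "instability P A = ennreal (measure_pmf.expectation (pair_pmf P P) (\<lambda>(S, S'). tv_dist (A S) (A S')))"
proof -
  have "0 \<le> tv_dist (A S) (A S') \<and> tv_dist (A S) (A S') \<le> 1" if "S \<in> set_pmf P" "S' \<in> set_pmf P" for S S'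
    using assms that by (intro conjI tv_dist_nonneg tv_dist_le_1 space_prob_algebraD(1))
  then show ?thesis
    by (subst ennreal_expectation) (auto simp: instability_def nn_integral_pair_pmf')
qed

lemma set_replicate_pmf_subset:
  "data_distribution X D \<Longrightarrow> set_pmf (replicate_pmf n D) \<subseteq> {S. length S = n \<and> set S \<subseteq> X \<times> UNIV}"
  by (auto simp: data_distribution_def set_replicate_pmf)

lemma expected_failure:
  assumes A: "learning_rule X n A" and D: "data_distribution X D"
  shows "(\<integral>\<^sup>+S. emeasure (A S) E \<partial>(replicate_pmf n D))
    = ennreal (measure_pmf.expectation (replicate_pmf n D) (\<lambda>S. measure (A S) E))"
proof -
  have p: "prob_space (A S)" if "S \<in> set_pmf (replicate_pmf n D)" for S
    using A set_replicate_pmf_subset[OF D] that space_prob_algebraD(1) unfolding learning_rule_def by blast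
  have "(\<integral>\<^sup>+S. emeasure (A S) E \<partial>(replicate_pmf n D)) = (\<integral>\<^sup>+S. ennreal (measure (A S) E) \<partial>(replicate_pmf n D))"
    using p by (intro nn_integral_cong_AE AE_pmfI) (simp add: finite_measure.emeasure_eq_measure prob_space_def)
  also have "\<dots> = ennreal (measure_pmf.expectation (replicate_pmf n D) (\<lambda>S. measure (A S) E))"
    using p by (intro ennreal_expectation[symmetric]) (auto simp: prob_space.prob_le_1)
  finally show ?thesis .
qed

lemma tv_indistinguishable_iff:
  assumes A: "learning_rule X n A" and \<rho>: "0 \<le> \<rho>"
  shows "tv_indistinguishable X n \<rho> A \<longleftrightarrow> (\<forall>D. data_distribution X D \<longrightarrow> instability (replicate_pmf n D) A \<le> ennreal \<rho>)"
proof -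
  have "instability (replicate_pmf n D) A
    = ennreal (measure_pmf.expectation (pair_pmf (replicate_pmf n D) (replicate_pmf n D)) (\<lambda>(S, S'). tv_dist (A S) (A S')))"
    if "data_distribution X D" for D
    using A set_replicate_pmf_subset[OF that] unfolding learning_rule_def by (intro instability_expectation) blast
  then show ?thesis using \<rho> by (simp add: tv_indistinguishable_def)
qed

lemma accurate_iff:
  assumes A: "learning_rule X n A" and \<beta>: "0 \<le> \<beta>"
  shows "accurate X H n \<alpha> \<beta> A \<longleftrightarrow> (\<forall>D. data_distribution X D \<and> realizable H D \<longrightarrow>
    (\<integral>\<^sup>+S. emeasure (A S) {h \<in> space (hyp_space X). err D h > \<alpha>} \<partial>(replicate_pmf n D)) \<le> ennreal \<beta>)"
  using \<beta> by (auto simp: accurate_def expected_failure[OF A])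

lemma nn_integral_bind_pmf_measure:
  assumes "\<And>d. F d \<in> space (prob_algebra M)" "E \<in> sets M"
  shows "(\<integral>\<^sup>+S. emeasure (measure_pmf (G S) \<bind> F) E \<partial>measure_pmf P) = (\<integral>\<^sup>+d. emeasure (F d) E \<partial>(bind_pmf P G))"
  by (simp add: emeasure_bind_pmf_measure[OF assms])

text \<open>The averaged learner fails with probability at most \<rho> + \<beta>, hence succeeds
  with probability at least \<open>c\<close>, and its stability depends on \<open>l\<close> alone.
  Boosting it for \<open>k\<close> rounds with two lists of \<open>N\<close> examples each explains
  the size \<open>2 * N * k\<close>.\<close>

lemma amplification:
  fixes A :: "'x learner" and \<alpha> \<beta> \<rho> c :: real
  assumes X: "countable X" and A: "learning_rule X n A" and tv: "tv_indistinguishable X n \<rho> A" and acc: "accurate X H n \<alpha> \<beta> A"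
    and \<rho>: "0 \<le> \<rho>" and \<beta>: "0 \<le> \<beta>" and c: "0 < c" "c \<le> 1" "\<rho> + \<beta> \<le> 1 - c" and \<alpha>: "\<alpha> < 1 / 2"
    and pos: "0 < l" "0 < N" "0 < K" "0 < \<theta>\<^sub>1" "0 < \<theta>\<^sub>2"
    and \<theta>: "5 * \<theta>\<^sub>1 / 4 \<le> \<alpha>'" "5 * \<theta>\<^sub>2 / 4 \<le> (1 - 2 * \<alpha>) * (\<theta>\<^sub>1 / 4)" "\<theta>\<^sub>2 \<le> \<theta>\<^sub>1" "2 / real K \<le> \<theta>\<^sub>2 / 4"
    and N: "4 * real l * real n \<le> real N * \<theta>\<^sub>1"
    and stable: "real k * (8 / (\<theta>\<^sub>1 * sqrt N) + 8 / sqrt l + 8 / (\<theta>\<^sub>2 * sqrt N)) \<le> \<rho>'"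
    and fail: "2 * exp (- (real N * \<theta>\<^sub>2\<^sup>2 / 32)) * real k + 2 powr (real K * real K) * (1 - c / 2) ^ k \<le> \<beta>'"
  shows "\<exists>A'. learning_rule X (2 * N * k) A' \<and> tv_indistinguishable X (2 * N * k) \<rho>' A' \<and> accurate X H (2 * N * k) \<alpha>' \<beta>' A'"
proof -
  define I where "I = {S. length S = n \<and> set S \<subseteq> X \<times> (UNIV :: bool set)}"
  have "I \<subseteq> lists (X \<times> UNIV)" by (auto simp: I_def)
  moreover have "countable (lists (X \<times> (UNIV :: bool set)))" using X by (intro countable_lists countable_SIGMA) auto
  ultimately have I: "countable I" by (rule countable_subset)
  have AI: "A S \<in> space (prob_algebra (hyp_space X))" if "S \<in> I" for S using A that by (auto simp: I_def learning_rule_def)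
  have h0: "(\<lambda>x\<in>X. False) \<in> space (hyp_space X)" by (simp add: hyp_space_def space_PiM)
  obtain B0 where B0: "\<And>ps. B0 ps \<in> space (prob_algebra (hyp_space X))"
    "\<And>P. set_pmf P \<subseteq> I \<Longrightarrow> instability (replicate_pmf l (pair_pmf P P)) B0 \<le> ennreal (8 / sqrt l)"
    "\<And>P E. set_pmf P \<subseteq> I \<Longrightarrow> E \<in> sets (hyp_space X) \<Longrightarrow>
      (\<integral>\<^sup>+ps. emeasure (B0 ps) E \<partial>(replicate_pmf l (pair_pmf P P)))
        \<le> instability P A + (\<integral>\<^sup>+S. emeasure (A S) E \<partial>measure_pmf P)"
    using overlap_average[of I A "hyp_space X" "\<lambda>x\<in>X. False" l, OF I AI h0 pos(1)] by blast
  \<comment> \<open>\<open>l\<close> pairs of samples of size \<open>n\<close>; the hypothesis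
    \<open>4 * l * n \<le> N * \<theta>\<^sub>1\<close> is then the locale condition on
    \<open>m\<close>.\<close>
  define m where "m = l * (n + n)"
  have "simulable m (\<lambda>D. replicate_pmf l (pair_pmf (replicate_pmf n D) (replicate_pmf n D :: ('x \<times> bool) list pmf)))"
    unfolding m_def by (intro simulable_replicate simulable_pair simulable_replicate_pmf)
  then obtain G where G: "\<And>D :: ('x \<times> bool) pmf. replicate_pmf l (pair_pmf (replicate_pmf n D) (replicate_pmf n D)) = bind_pmf (replicate_pmf m D) G"
    unfolding simulable_def by blast
  define B where "B T = measure_pmf (G T) \<bind> B0" for T
  have B: "B T \<in> space (prob_algebra (hyp_space X))" for T
    unfolding B_def by (rule bind_pmf_measure_in_prob_algebra[OF B0(1)])
  have sub: "set_pmf (replicate_pmf n D) \<subseteq> I" if "data_distribution X D" for D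
    using set_replicate_pmf_subset[OF that] by (simp add: I_def)
  have B_stable: "instability (replicate_pmf m D) B \<le> ennreal (8 / sqrt l)" if "data_distribution X D" for D
    unfolding B_def using B0(2)[OF sub[OF that]] unfolding G
    by (rule order_trans[OF instability_bind_pmf[OF B0(1)]])
  have B_weak: "(\<integral>\<^sup>+T. emeasure (B T) {h \<in> space (hyp_space X). \<alpha> < err D h} \<partial>(replicate_pmf m D)) \<le> ennreal (1 - c)"
    if D: "data_distribution X D" "realizable H D" for D
  proof -
    have E: "{h \<in> space (hyp_space X). \<alpha> < err D h} \<in> sets (hyp_space X)" using err_measurable[OF D(1)] by measurable
    have "(\<integral>\<^sup>+T. emeasure (B T) {h \<in> space (hyp_space X). \<alpha> < err D h} \<partial>(replicate_pmf m D))
      \<le> instability (replicate_pmf n D) A + (\<integral>\<^sup>+S. emeasure (A S) {h \<in> space (hyp_space X). \<alpha> < err D h} \<partial>(replicate_pmf n D))"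
      unfolding B_def nn_integral_bind_pmf_measure[OF B0(1) E] G[symmetric] by (rule B0(3)[OF sub[OF D(1)] E])
    also have "\<dots> \<le> ennreal \<rho> + ennreal \<beta>"
      using tv acc D unfolding tv_indistinguishable_iff[OF A \<rho>] accurate_iff[OF A \<beta>] by (intro add_mono) auto
    also have "\<dots> \<le> ennreal (1 - c)" using \<rho> \<beta> c by (simp add: ennreal_leI flip: ennreal_plus)
    finally show ?thesis .
  qed
  interpret boosting X B m N K \<theta>\<^sub>1 \<theta>\<^sub>2
    by unfold_locales (use B pos N in \<open>auto simp: m_def algebra_simps\<close>)
  define v0 :: "'x \<Rightarrow> int" where "v0 = (\<lambda>x\<in>X. 0)"
  have v0: "v0 \<in> space (vote_space X)" "bounded_votes v0"
    by (auto simp: v0_def vote_space_def space_PiM bounded_votes_def intro: exI[of _ 0])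
  have "simulable (k * (N * 1 + N * 1)) (\<lambda>D. replicate_pmf k (round_law (noisy D)))"
    unfolding round_law_def noisy_def by (intro simulable_replicate simulable_pair simulable_noise)
  moreover have "k * (N * 1 + N * 1) = 2 * N * k" by simp
  ultimately have "simulable (2 * N * k) (\<lambda>D. replicate_pmf k (round_law (noisy D)))" by (simp only:)
  then obtain G' where G': "\<And>D. replicate_pmf k (round_law (noisy D)) = bind_pmf (replicate_pmf (2 * N * k) D) G'"
    unfolding simulable_def by blast
  \<comment> \<open>\<open>G'\<close> also draws the noise, so \<open>A'\<close> reads plain
    examples only; the noise was counted as data in the stability bound and becomes internal
    here.\<close>
  define A' where "A' S = measure_pmf (G' S) \<bind> boost v0" for S
  have bo: "boost v0 cs \<in> space (prob_algebra (hyp_space X))" for cs by (rule boost_in_prob_algebra[OF v0(1)])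
  have A': "learning_rule X (2 * N * k) A'"
    unfolding learning_rule_def A'_def using bind_pmf_measure_in_prob_algebra[of "boost v0", OF bo] by blast
  have "0 \<le> real k * (8 / (\<theta>\<^sub>1 * sqrt N) + 8 / sqrt l + 8 / (\<theta>\<^sub>2 * sqrt N))" using pos by simp
  then have \<rho>': "0 \<le> \<rho>'" using stable by simp
  have "0 \<le> 2 * exp (- (real N * \<theta>\<^sub>2\<^sup>2 / 32)) * real k + 2 powr (real K * real K) * (1 - c / 2) ^ k" using c by simp
  then have \<beta>': "0 \<le> \<beta>'" using fail by simp
  have "tv_indistinguishable X (2 * N * k) \<rho>' A'"
    unfolding tv_indistinguishable_iff[OF A' \<rho>']
  proof (intro allI impI)
    fix D :: "('x \<times> bool) pmf" assume D: "data_distribution X D"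
    have "instability (replicate_pmf (2 * N * k) D) A' \<le> instability (replicate_pmf k (round_law (noisy D))) (boost v0)"
      unfolding A'_def G' by (rule instability_bind_pmf[OF bo])
    also have "\<dots> \<le> ennreal (real k * (8 / (\<theta>\<^sub>1 * sqrt N) + 8 / sqrt l + 8 / (\<theta>\<^sub>2 * sqrt N)))"
      by (intro instability_boost_le B_stable data_distribution_reweighted D v0) auto
    also have "\<dots> \<le> ennreal \<rho>'" by (rule ennreal_leI[OF stable])
    finally show "instability (replicate_pmf (2 * N * k) D) A' \<le> ennreal \<rho>'" .
  qed
  moreover have "accurate X H (2 * N * k) \<alpha>' \<beta>' A'"
    unfolding accurate_iff[OF A' \<beta>']
  proof (intro allI impI, elim conjE)
    fix D assume D: "data_distribution X D" "realizable H D"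
    have E: "{h \<in> space (hyp_space X). \<alpha>' < err D h} \<in> sets (hyp_space X)" using err_measurable[OF D(1)] by measurable
    have "(\<integral>\<^sup>+S. emeasure (A' S) {h \<in> space (hyp_space X). \<alpha>' < err D h} \<partial>(replicate_pmf (2 * N * k) D))
      = (\<integral>\<^sup>+cs. emeasure (boost v0 cs) {h \<in> space (hyp_space X). \<alpha>' < err D h} \<partial>(replicate_pmf k (round_law (noisy D))))"
      unfolding A'_def nn_integral_bind_pmf_measure[OF bo E] G' ..
    also have "\<dots> \<le> ennreal (2 * exp (- (real N * \<theta>\<^sub>2\<^sup>2 / 32)) * real k + 2 powr (real K * potential D v0) * (1 - c / 2) ^ k)"
      by (rule boost_failure_le[OF D B_weak c(1,2) \<alpha> \<theta> order_refl v0])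
    also have "\<dots> \<le> ennreal \<beta>'"
    proof (rule ennreal_leI, rule order_trans[OF _ fail], intro add_left_mono mult_right_mono powr_mono mult_left_mono)
      show "potential D v0 \<le> K" unfolding v0_def by (rule potential_0_le[OF D(1)])
    qed (use c in auto)
    finally show "(\<integral>\<^sup>+S. emeasure (A' S) {h \<in> space (hyp_space X). \<alpha>' < err D h} \<partial>(replicate_pmf (2 * N * k) D)) \<le> ennreal \<beta>'" .
  qed
  ultimately show ?thesis using A' by blast
qed

section \<open>Choice of the parameters\<close>

lemma real_nat_ceiling_bounds: "0 \<le> x \<Longrightarrow> x \<le> real (nat \<lceil>x\<rceil>)" "0 \<le> x \<Longrightarrow> real (nat \<lceil>x\<rceil>) \<le> x + 1"
  by linarith+

text \<open>Everything is measured in \<open>w = (1 / \<alpha>') * (1 + ln (1 / \<beta>'))\<close>,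
  which is at least 1: \<open>K = O(w)\<close>, \<open>k = O(w^2)\<close>, \<open>l = O(w^4)\<close>
  and \<open>N / n = O(w^6)\<close>, which gives the exponent 8. The dependence on \<sigma>,
  \<open>c\<close> and \<rho>' goes into \<open>C\<close>.\<close>

lemma amplification_parameters:
  fixes \<sigma> c \<rho>' :: real
  assumes \<sigma>: "0 < \<sigma>" "\<sigma> \<le> 1" and c: "0 < c" "c \<le> 1" and \<rho>': "0 < \<rho>'" "\<rho>' < 1"
  obtains C where "0 < C" "\<And>\<alpha>' \<beta>' n. 0 < \<alpha>' \<Longrightarrow> \<alpha>' < 1 \<Longrightarrow> 0 < \<beta>' \<Longrightarrow> \<beta>' < 1 \<Longrightarrow> 1 \<le> n \<Longrightarrow>
    \<exists>l N K k. 0 < l \<and> 0 < N \<and> 0 < K \<and> 2 / real K \<le> \<alpha>' * \<sigma> / 16 / 4 \<and> 4 * real l * real n \<le> real N * (\<alpha>' / 2)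
      \<and> real k * (8 / (\<alpha>' / 2 * sqrt N) + 8 / sqrt l + 8 / (\<alpha>' * \<sigma> / 16 * sqrt N)) \<le> \<rho>'
      \<and> 2 * exp (- (real N * (\<alpha>' * \<sigma> / 16)\<^sup>2 / 32)) * real k + 2 powr (real K * real K) * (1 - c / 2) ^ k \<le> \<beta>'
      \<and> real (2 * N * k) \<le> C * (1 / \<alpha>' * (1 + ln (1 / \<beta>'))) ^ 8 * real n"
proof -
  \<comment> \<open>The constants in front of these powers for \<open>K\<close>, \<open>k\<close>,
    \<open>l\<close> and \<open>N / n\<close>. For instance 129 is \<open>8 * 16\<close> from
    \<open>K = 8 / \<theta>\<close>, plus 1 for rounding up.\<close>
  define C1 C2 C3 C4 where "C1 = 129 / \<sigma>" and "C2 = 2 / c * (C1\<^sup>2 + 1) + 1" and "C3 = (24 * C2 / \<rho>')\<^sup>2 + 1"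
    and "C4 = (384 * C2 / (\<sigma> * \<rho>'))\<^sup>2 + 8 * C3 + 32 * (4 * C2 + 1) * (16 / \<sigma>)\<^sup>2 + 1"
  have C1: "0 < C1" using \<sigma> by (simp add: C1_def)
  have C2: "0 < C2" using c by (simp add: C2_def add_nonneg_pos)
  have C3: "0 < C3" by (simp add: C3_def add_nonneg_pos)
  have C4: "0 < C4" unfolding C4_def using C2 C3 \<sigma> by (intro add_nonneg_pos add_nonneg_nonneg mult_nonneg_nonneg) auto
  show thesis
  proof (rule that[of "2 * C4 * C2"])
    show "0 < 2 * C4 * C2" using C2 C4 by simp
    fix \<alpha>' \<beta>' :: real and n :: nat
    assume \<alpha>': "0 < \<alpha>'" "\<alpha>' < 1" and \<beta>': "0 < \<beta>'" "\<beta>' < 1" and n: "1 \<le> n"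
    define x z where "x = 1 / \<alpha>'" and "z = ln (1 / \<beta>')"
    define w where "w = x * (1 + z)"
    have x: "1 < x" using \<alpha>' by (simp add: x_def)
    have z: "0 < z" using \<beta>' by (simp add: z_def)
    have w1: "1 \<le> w" using mult_mono[of 1 x 1 "1 + z"] x z by (simp add: w_def)
    have xw: "x \<le> w" using mult_left_mono[of 1 "1 + z" x] x z by (simp add: w_def)
    have zw: "1 + z \<le> w" using mult_right_mono[of 1 x "1 + z"] x z by (simp add: w_def)
    have wpow: "w ^ a \<le> w ^ b" if "a \<le> b" for a b using power_increasing[OF that w1] .
    define \<theta> where "\<theta> = \<alpha>' * \<sigma> / 16"
    have \<theta>: "0 < \<theta>" using \<alpha>' \<sigma> by (simp add: \<theta>_def)
    have \<theta>_le: "\<theta> \<le> \<alpha>' / 2" using \<alpha>' \<sigma> mult_left_mono[of \<sigma> 1 \<alpha>'] by (simp add: \<theta>_def)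
    have \<theta>x: "1 / \<theta> = 16 * x / \<sigma>" by (simp add: \<theta>_def x_def)
    have \<theta>w: "1 / \<theta> \<le> 16 / \<sigma> * w" unfolding \<theta>x using xw \<sigma> by (simp add: field_simps)
    \<comment> \<open>The least \<open>K\<close> with \<open>2 / K\<close> at most
      \<theta>\<open>/4\<close>, so that the boundary effect is small against the edge.\<close>
    define K where "K = nat \<lceil>8 / \<theta>\<rceil>"
    have K_ge: "8 / \<theta> \<le> real K" unfolding K_def using \<theta> by (intro real_nat_ceiling_bounds) simp
    then have K0: "0 < K" using \<theta> by (intro gr0I) (auto simp: field_simps)
    have "real K \<le> 8 / \<theta> + 1" unfolding K_def using \<theta> by (intro real_nat_ceiling_bounds) simp
    also have "8 / \<theta> = 8 * (1 / \<theta>)" by simp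
    also have "8 * (1 / \<theta>) + 1 \<le> 8 * (16 / \<sigma> * w) + w / \<sigma>"
    proof -
      have "\<sigma> * 1 \<le> 1 * w" using w1 \<sigma> by (intro mult_mono) auto
      then have "1 \<le> w / \<sigma>" using \<sigma> by (simp add: field_simps)
      then show ?thesis using \<theta>w by linarith
    qed
    also have "\<dots> = C1 * w" by (simp add: C1_def field_simps)
    finally have K_le: "real K \<le> C1 * w" .
    \<comment> \<open>Makes \<open>exp (- c * y / 2)\<close> equal to
      \<open>2 powr (- K * K) * \<beta>' / 2\<close>: it cancels the initial weight and leaves half
      of the allowed failure.\<close>
    define y where "y = 2 / c * (real K * real K * ln 2 + ln (2 / \<beta>'))"
    have ln2b: "ln (2 / \<beta>') = ln 2 + z" using \<beta>' by (simp add: z_def ln_div)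
    have ln2: "0 < ln (2::real)" "ln (2::real) \<le> 1" using ln_le_minus_one[of "2::real"] by auto
    have y0: "0 \<le> y" unfolding y_def ln2b using c z by (intro mult_nonneg_nonneg add_nonneg_nonneg) auto
    define k where "k = nat \<lceil>y\<rceil>"
    have k_ge: "y \<le> real k" unfolding k_def by (rule real_nat_ceiling_bounds(1)[OF y0])
    have "real k \<le> y + 1" unfolding k_def by (rule real_nat_ceiling_bounds(2)[OF y0])
    also have "y \<le> 2 / c * ((C1 * w)\<^sup>2 + w)"
      unfolding y_def
    proof (rule mult_left_mono)
      have "real K * real K * ln 2 \<le> (C1 * w) * (C1 * w) * 1"
        using K_le ln2 C1 w1 by (intro mult_mono) auto
      then show "real K * real K * ln 2 + ln (2 / \<beta>') \<le> (C1 * w)\<^sup>2 + w"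
        using ln2b ln2 zw by (simp add: power2_eq_square)
    qed (use c in simp)
    also have "2 / c * ((C1 * w)\<^sup>2 + w) + 1 \<le> 2 / c * ((C1 * w)\<^sup>2 + w\<^sup>2) + w\<^sup>2"
      using wpow[of 1 2] wpow[of 0 2] c by (intro add_mono mult_left_mono) auto
    also have "\<dots> = C2 * w\<^sup>2" by (simp add: C2_def power_mult_distrib algebra_simps)
    finally have k_le: "real k \<le> C2 * w\<^sup>2" by simp
    have k1: "0 < k"
    proof -
      have "0 < y" unfolding y_def ln2b using c z ln2 by (intro mult_pos_pos add_nonneg_pos) auto
      then show ?thesis using k_ge by (intro gr0I) auto
    qed
    \<comment> \<open>The weak learner gets a third of the stability budget:
      \<open>k * 8 / sqrt l\<close> is at most \<rho>'\<open>/3\<close>.\<close>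
    define l where "l = nat \<lceil>(24 * real k / \<rho>')\<^sup>2\<rceil>"
    have l_ge: "(24 * real k / \<rho>')\<^sup>2 \<le> real l" unfolding l_def by (intro real_nat_ceiling_bounds) simp
    have l0: "0 < l"
    proof -
      have "0 < (24 * real k / \<rho>')\<^sup>2" using k1 \<rho>' by simp
      then show ?thesis using l_ge by (intro gr0I) auto
    qed
    have "real l \<le> (24 * real k / \<rho>')\<^sup>2 + 1" unfolding l_def by (intro real_nat_ceiling_bounds) simp
    also have "\<dots> \<le> (24 * (C2 * w\<^sup>2) / \<rho>')\<^sup>2 + w ^ 4"
      using k_le \<rho>' wpow[of 0 4] by (intro add_mono power_mono divide_right_mono mult_left_mono) auto
    also have "\<dots> = C3 * w ^ 4" by (simp add: C3_def power_mult_distrib power_divide algebra_simps flip: power_mult)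
    finally have l_le: "real l \<le> C3 * w ^ 4" .
    \<comment> \<open>One summand for each demand on \<open>N\<close>: stability of both tests, a
      third of the budget each; enough accepted examples for training; and tails of at most
      \<open>exp (- (4 * k + z))\<close>.\<close>
    define u where "u = (24 * real k / (\<rho>' * \<theta>))\<^sup>2 + 8 * real l * x + 32 * (4 * real k + z) / \<theta>\<^sup>2"
    have u0: "0 \<le> u" unfolding u_def using x z by simp
    define N0 where "N0 = nat \<lceil>u\<rceil>"
    have N0_ge: "u \<le> real N0" unfolding N0_def by (rule real_nat_ceiling_bounds(1)[OF u0])
    have "real N0 \<le> u + 1" unfolding N0_def by (rule real_nat_ceiling_bounds(2)[OF u0])
    also have "u \<le> (384 * C2 / (\<sigma> * \<rho>'))\<^sup>2 * w ^ 6 + 8 * C3 * w ^ 6 + 32 * (4 * C2 + 1) * (16 / \<sigma>)\<^sup>2 * w ^ 6"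
      unfolding u_def
    proof (intro add_mono)
      have "24 * real k / (\<rho>' * \<theta>) = 24 * real k / \<rho>' * (1 / \<theta>)" by simp
      also have "\<dots> \<le> 24 * (C2 * w\<^sup>2) / \<rho>' * (16 / \<sigma> * w)"
        using k_le \<rho>' \<theta>w \<theta> C2 by (intro mult_mono divide_right_mono mult_left_mono) auto
      also have "\<dots> = 384 * C2 / (\<sigma> * \<rho>') * w ^ 3" by (simp add: power2_eq_square power3_eq_cube ac_simps)
      finally have "(24 * real k / (\<rho>' * \<theta>))\<^sup>2 \<le> (384 * C2 / (\<sigma> * \<rho>') * w ^ 3)\<^sup>2"
        using \<rho>' \<theta> by (intro power_mono) auto
      then show "(24 * real k / (\<rho>' * \<theta>))\<^sup>2 \<le> (384 * C2 / (\<sigma> * \<rho>'))\<^sup>2 * w ^ 6"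
        by (simp only: power_mult_distrib[of _ "w ^ 3"] power_mult[symmetric]) simp
      have "8 * real l * x \<le> 8 * (C3 * w ^ 4) * w" using l_le xw x C3 w1 by (intro mult_mono) auto
      also have "\<dots> = 8 * C3 * w ^ 5" by (simp add: eval_nat_numeral)
      also have "\<dots> \<le> 8 * C3 * w ^ 6" using wpow[of 5 6] C3 by (intro mult_left_mono) auto
      finally show "8 * real l * x \<le> 8 * C3 * w ^ 6" .
      have "4 * real k + z \<le> 4 * (C2 * w\<^sup>2) + w\<^sup>2" using k_le zw wpow[of 1 2] by simp
      then have "32 * (4 * real k + z) * (1 / \<theta>)\<^sup>2 \<le> 32 * (4 * (C2 * w\<^sup>2) + w\<^sup>2) * (16 / \<sigma> * w)\<^sup>2"
        using \<theta>w \<theta> C2 z by (intro mult_mono power_mono) auto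
      also have "\<dots> = 32 * (4 * C2 + 1) * (16 / \<sigma>)\<^sup>2 * w ^ 4"
        by (simp add: power_mult_distrib algebra_simps eval_nat_numeral)
      also have "\<dots> \<le> 32 * (4 * C2 + 1) * (16 / \<sigma>)\<^sup>2 * w ^ 6"
        using wpow[of 4 6] C2 by (intro mult_left_mono) auto
      finally show "32 * (4 * real k + z) / \<theta>\<^sup>2 \<le> 32 * (4 * C2 + 1) * (16 / \<sigma>)\<^sup>2 * w ^ 6"
        by (simp add: power_divide)
    qed
    also have "(384 * C2 / (\<sigma> * \<rho>'))\<^sup>2 * w ^ 6 + 8 * C3 * w ^ 6 + 32 * (4 * C2 + 1) * (16 / \<sigma>)\<^sup>2 * w ^ 6 + 1 \<le> C4 * w ^ 6"
      using wpow[of 0 6] by (simp add: C4_def algebra_simps)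
    finally have N0_le: "real N0 \<le> C4 * w ^ 6" by simp
    \<comment> \<open>Making \<open>N\<close> a multiple of \<open>n\<close> keeps the final bound
      linear in \<open>n\<close>; the other two demands survive because \<open>n\<close> is at least
      1.\<close>
    define N where "N = n * N0"
    have t1: "0 \<le> (24 * real k / (\<rho>' * \<theta>))\<^sup>2" and t2: "0 \<le> 8 * real l * x" and t3: "0 \<le> 32 * (4 * real k + z) / \<theta>\<^sup>2"
      using x z by auto
    have "real N0 \<le> real N"
      unfolding N_def using n mult_right_mono[of 1 "real n" "real N0"] by simp
    then have N_ge: "(24 * real k / (\<rho>' * \<theta>))\<^sup>2 \<le> real N" "32 * (4 * real k + z) / \<theta>\<^sup>2 \<le> real N"
      using N0_ge t1 t2 t3 unfolding u_def by linarith+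
    have N0: "0 < N"
    proof -
      have "0 < (24 * real k / (\<rho>' * \<theta>))\<^sup>2" using k1 \<rho>' \<theta> by simp
      then show ?thesis using N_ge(1) by (intro gr0I) auto
    qed
    have g1: "2 / real K \<le> \<theta> / 4" using K_ge K0 \<theta> by (simp add: field_simps)
    have g2: "4 * real l * real n \<le> real N * (\<alpha>' / 2)"
    proof -
      have "8 * real l * x \<le> real N0" using N0_ge t1 t3 unfolding u_def by linarith
      then have "8 * real l \<le> real N0 * \<alpha>'" using \<alpha>' by (simp add: x_def field_simps)
      then have "real n * (8 * real l) \<le> real n * (real N0 * \<alpha>')" by (intro mult_left_mono) auto
      then show ?thesis by (simp add: N_def algebra_simps)
    qed
    have sl: "24 * real k / \<rho>' \<le> sqrt l" using l_ge \<rho>' by (intro real_le_rsqrt)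
    have sN: "24 * real k / (\<rho>' * \<theta>) \<le> sqrt N" using N_ge(1) by (intro real_le_rsqrt)
    have g3: "real k * (8 / (\<alpha>' / 2 * sqrt N) + 8 / sqrt l + 8 / (\<theta> * sqrt N)) \<le> \<rho>'"
    proof -
      have sN0: "0 < sqrt N" and sl0: "0 < sqrt l" using N0 l0 by auto
      have a: "real k * (8 / (\<theta> * sqrt N)) \<le> \<rho>' / 3"
        using sN \<theta> \<rho>' sN0 by (simp add: field_simps)
      have b: "real k * (8 / sqrt l) \<le> \<rho>' / 3"
        using sl \<rho>' sl0 by (simp add: field_simps)
      have "8 / (\<alpha>' / 2 * sqrt N) \<le> 8 / (\<theta> * sqrt N)"
        using \<theta>_le \<theta> sN0 by (intro divide_left_mono mult_right_mono) auto
      then have "real k * (8 / (\<alpha>' / 2 * sqrt N)) \<le> real k * (8 / (\<theta> * sqrt N))" by (rule mult_left_mono) simp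
      then show ?thesis using a b by (simp add: distrib_left)
    qed
    have g4: "2 * exp (- (real N * \<theta>\<^sup>2 / 32)) * real k + 2 powr (real K * real K) * (1 - c / 2) ^ k \<le> \<beta>'"
    proof -
      have "4 * real k + z \<le> real N * \<theta>\<^sup>2 / 32" using N_ge(2) \<theta> by (simp add: field_simps)
      then have "exp (- (real N * \<theta>\<^sup>2 / 32)) \<le> exp (- z) * exp (- (4 * real k))" by (simp flip: exp_add)
      \<comment> \<open>The factor \<open>exp (- z)\<close> is \<beta>', and
        \<open>exp (- 4 * k)\<close> is at most \<open>1 / (4 * k)\<close>, which pays for the union
        bound over the rounds.\<close>
      also have "\<dots> \<le> \<beta>' * (1 / (4 * real k))"
      proof (rule mult_mono)
        show "exp (- z) \<le> \<beta>'" using \<beta>' by (simp add: z_def ln_div)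
        have "4 * real k \<le> exp (4 * real k)" using exp_ge_add_one_self[of "4 * real k"] by linarith
        then show "exp (- (4 * real k)) \<le> 1 / (4 * real k)" using k1 by (simp add: exp_minus field_simps)
      qed (use \<beta>' in auto)
      finally have e1: "2 * exp (- (real N * \<theta>\<^sup>2 / 32)) * real k \<le> \<beta>' / 2" using k1 by (simp add: field_simps)
      have "1 - c / 2 \<le> exp (- (c / 2))" using exp_ge_add_one_self[of "- (c / 2)"] by simp
      then have "(1 - c / 2) ^ k \<le> exp (- (c / 2)) ^ k" using c by (intro power_mono) auto
      also have "\<dots> = exp (- (c / 2 * real k))" by (simp add: exp_of_nat_mult[symmetric] mult.commute)
      also have "\<dots> \<le> exp (- (real K * real K * ln 2 + ln (2 / \<beta>')))"
      proof -
        have "c / 2 * y \<le> c / 2 * real k" using k_ge c by (intro mult_left_mono) auto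
        then show ?thesis using c by (simp add: y_def)
      qed
      finally have "2 powr (real K * real K) * (1 - c / 2) ^ k \<le> exp (real K * real K * ln 2) * exp (- (real K * real K * ln 2 + ln (2 / \<beta>')))"
        by (intro mult_mono) (use c in \<open>auto simp: powr_def\<close>)
      also have "\<dots> = exp (- ln (2 / \<beta>'))" by (simp flip: exp_add)
      also have "\<dots> = \<beta>' / 2" using \<beta>' by (simp add: exp_minus)
      finally show ?thesis using e1 by simp
    qed
    have g5: "real (2 * N * k) \<le> 2 * C4 * C2 * (1 / \<alpha>' * (1 + ln (1 / \<beta>'))) ^ 8 * real n"
    proof -
      have "real (2 * N * k) = 2 * real N0 * real k * real n" by (simp add: N_def algebra_simps)
      also have "\<dots> \<le> 2 * (C4 * w ^ 6) * (C2 * w\<^sup>2) * real n"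
        using N0_le k_le C4 w1 by (intro mult_right_mono mult_mono) auto
      also have "\<dots> = 2 * C4 * C2 * w ^ 8 * real n" by (simp add: eval_nat_numeral)
      finally show ?thesis by (simp add: w_def x_def z_def)
    qed
    show "\<exists>l N K k. 0 < l \<and> 0 < N \<and> 0 < K \<and> 2 / real K \<le> \<alpha>' * \<sigma> / 16 / 4 \<and> 4 * real l * real n \<le> real N * (\<alpha>' / 2)
      \<and> real k * (8 / (\<alpha>' / 2 * sqrt N) + 8 / sqrt l + 8 / (\<alpha>' * \<sigma> / 16 * sqrt N)) \<le> \<rho>'
      \<and> 2 * exp (- (real N * (\<alpha>' * \<sigma> / 16)\<^sup>2 / 32)) * real k + 2 powr (real K * real K) * (1 - c / 2) ^ k \<le> \<beta>'
      \<and> real (2 * N * k) \<le> 2 * C4 * C2 * (1 / \<alpha>' * (1 + ln (1 / \<beta>'))) ^ 8 * real n"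
      using l0 N0 K0 g1 g2 g3 g4 g5 unfolding \<theta>_def by blast
  qed
qed

section \<open>Polynomial bound and conclusion\<close>

text \<open>Trades the binomial expansion for two monomials, so that the coefficients of the final
  polynomial are 0 or 1; 256 is \<open>2^8\<close>.\<close>

lemma one_plus_power8_le: "0 \<le> z \<Longrightarrow> (1 + z) ^ 8 \<le> 256 * (1 + z ^ 8)" for z :: real
proof -
  assume z: "0 \<le> z"
  have "(1 + z) ^ 8 \<le> (2 * max 1 z) ^ 8" using z by (intro power_mono) auto
  also have "\<dots> = 256 * (max 1 z) ^ 8" by (simp add: power_mult_distrib)
  also have "(max 1 z) ^ 8 \<le> 1 + z ^ 8" using z by (auto simp: max_def)
  finally show ?thesis by simp
qed

lemma polynomial3_bound: "polynomial3 (\<lambda>x y z. y ^ 8 * (1 + z ^ 8))"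
  unfolding polynomial3_def
proof (intro exI allI)
  fix x y z :: real
  show "y ^ 8 * (1 + z ^ 8) = (\<Sum>i\<le>8::nat. \<Sum>j\<le>8::nat. \<Sum>k\<le>8::nat. (if i = 0 then 1 else 0) * (if j = 8 then 1 else 0) * (if k = 0 \<or> k = 8 then 1 else 0) * x ^ i * y ^ j * z ^ k)"
    by (simp add: eval_nat_numeral algebra_simps)
qed

text \<open>With \<open>e^2 = 2 * \<rho> / (\<rho> + 1)\<close> the bound on \<beta> is
  \<open>(1 - e)^2\<close>, so \<open>e < 1 - sqrt \<beta>\<close>. As \<rho> + 1 is at most 2,
  \<rho> is at most \<open>e^2\<close>, hence at most \<open>(1 - sqrt \<beta>)^2\<close>; adding
  \<beta> gives the claim.\<close>

lemma accuracy_margin: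
  fixes \<beta> \<rho> :: real
  assumes \<beta>: "0 < \<beta>" and \<rho>: "0 < \<rho>" "\<rho> < 1" and lt: "\<beta> < 2 * \<rho> / (\<rho> + 1) - 2 * sqrt (2 * \<rho> / (\<rho> + 1)) + 1"
  shows "\<beta> < 1" "\<rho> + \<beta> \<le> 1 - (2 * sqrt \<beta> - 2 * \<beta>)"
proof -
  define e where "e = sqrt (2 * \<rho> / (\<rho> + 1))"
  have e2: "e\<^sup>2 = 2 * \<rho> / (\<rho> + 1)" using \<rho> by (simp add: e_def)
  have e0: "0 \<le> e" using \<rho> by (simp add: e_def)
  have "e\<^sup>2 < 1" unfolding e2 using \<rho> by (simp add: field_simps)
  then have e1: "e < 1" using e0 by (simp add: power2_less_imp_less abs_square_less_1)
  have "\<beta> < (1 - e)\<^sup>2" using lt unfolding e_def[symmetric] e2[symmetric] by (simp add: power2_eq_square algebra_simps)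
  then have s: "sqrt \<beta> < 1 - e" using real_sqrt_less_mono[of \<beta> "(1 - e)\<^sup>2"] e1 by simp
  then have "sqrt \<beta> < 1" using e0 by linarith
  then show "\<beta> < 1" by simp
  have "\<rho> \<le> 2 * \<rho> / (\<rho> + 1)"
  proof -
    have "\<rho> * \<rho> \<le> \<rho> * 1" using \<rho> by (intro mult_left_mono) auto
    then show ?thesis using \<rho> by (simp add: field_simps)
  qed
  also have "\<dots> = e\<^sup>2" by (simp add: e2)
  also have "\<dots> \<le> (1 - sqrt \<beta>)\<^sup>2" using s e0 by (intro power_mono) auto
  also have "\<dots> = 1 - 2 * sqrt \<beta> + \<beta>" using \<beta> by (simp add: power2_diff)
  finally show "\<rho> + \<beta> \<le> 1 - (2 * sqrt \<beta> - 2 * \<beta>)" by simp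
qed

theorem corollary3:
  shows "\<exists>p. polynomial3 p \<and>
    (\<forall>\<alpha> \<beta> \<rho>'. \<alpha> \<in> {0<..<1/2} \<longrightarrow> \<beta> > 0 \<longrightarrow> \<rho>' \<in> {0<..<1} \<longrightarrow>
      (\<exists>C>0. \<forall>(X::'x set) H n A \<rho> \<alpha>' \<beta>'.
        countable X \<longrightarrow> H \<subseteq> space (hyp_space X) \<longrightarrow> n \<ge> 1 \<longrightarrow>
        \<rho> \<in> {0<..<1} \<longrightarrow>
        \<beta> < 2 * \<rho> / (\<rho> + 1) - 2 * sqrt (2 * \<rho> / (\<rho> + 1)) + 1 \<longrightarrow>
        \<alpha>' \<in> {0<..<1} \<longrightarrow> \<beta>' \<in> {0<..<1} \<longrightarrow>
        learning_rule X n A \<longrightarrow> tv_indistinguishable X n \<rho> A \<longrightarrow> accurate X H n \<alpha> \<beta> A \<longrightarrow>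
        (\<exists>n' A'.
          learning_rule X n' A' \<and> tv_indistinguishable X n' \<rho>' A' \<and> accurate X H n' \<alpha>' \<beta>' A' \<and>
          real n' \<le> C * p (1 / \<rho>) (1 / \<alpha>') (ln (1 / \<beta>')) * real n)))"
proof (rule exI[of _ "\<lambda>x y z. y ^ 8 * (1 + z ^ 8)"], intro conjI polynomial3_bound allI impI)
  fix \<alpha> \<beta> \<rho>' :: real
  assume \<alpha>: "\<alpha> \<in> {0<..<1/2}" and \<beta>: "\<beta> > 0" and \<rho>': "\<rho>' \<in> {0<..<1}"
  show "\<exists>C>0. \<forall>(X::'x set) H n A \<rho> \<alpha>' \<beta>'.
        countable X \<longrightarrow> H \<subseteq> space (hyp_space X) \<longrightarrow> n \<ge> 1 \<longrightarrow>
        \<rho> \<in> {0<..<1} \<longrightarrow>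
        \<beta> < 2 * \<rho> / (\<rho> + 1) - 2 * sqrt (2 * \<rho> / (\<rho> + 1)) + 1 \<longrightarrow>
        \<alpha>' \<in> {0<..<1} \<longrightarrow> \<beta>' \<in> {0<..<1} \<longrightarrow>
        learning_rule X n A \<longrightarrow> tv_indistinguishable X n \<rho> A \<longrightarrow> accurate X H n \<alpha> \<beta> A \<longrightarrow>
        (\<exists>n' A'.
          learning_rule X n' A' \<and> tv_indistinguishable X n' \<rho>' A' \<and> accurate X H n' \<alpha>' \<beta>' A' \<and>
          real n' \<le> C * ((1 / \<alpha>') ^ 8 * (1 + (ln (1 / \<beta>')) ^ 8)) * real n)"
  proof (cases "\<beta> < 1")
    \<comment> \<open>No \<rho> admits such a \<beta>, so the claim is vacuous and any
      \<open>C\<close> will do.\<close>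
    case False
    then show ?thesis by (intro exI[of _ 1]) (use accuracy_margin(1)[OF \<beta>] in auto)
  next
    case True
    define c where "c = 2 * sqrt \<beta> - 2 * \<beta>"
    have sq: "sqrt \<beta> * sqrt \<beta> = \<beta>" "0 < sqrt \<beta>" "sqrt \<beta> < 1" using \<beta> True by auto
    have c_eq: "c = 2 * (sqrt \<beta> * (1 - sqrt \<beta>))" using sq(1) by (simp add: c_def algebra_simps)
    have c: "0 < c" "c \<le> 1"
    proof -
      show "0 < c" unfolding c_eq using sq by simp
      have "(1 - 2 * sqrt \<beta>)\<^sup>2 = 1 - 4 * sqrt \<beta> + 4 * \<beta>"
        using \<beta> by (simp add: power2_diff power_mult_distrib)
      then show "c \<le> 1" using zero_le_power2[of "1 - 2 * sqrt \<beta>"] unfolding c_def by linarith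
    qed
    have \<rho>': "0 < \<rho>'" "\<rho>' < 1" using \<rho>' by auto
    have \<sigma>: "0 < 1 - 2 * \<alpha>" "1 - 2 * \<alpha> \<le> 1" using \<alpha> by auto
    obtain C where C: "0 < C" and params: "\<And>\<alpha>' \<beta>' n. 0 < \<alpha>' \<Longrightarrow> \<alpha>' < 1 \<Longrightarrow> 0 < \<beta>' \<Longrightarrow> \<beta>' < 1 \<Longrightarrow> 1 \<le> n \<Longrightarrow>
      \<exists>l N K k. 0 < l \<and> 0 < N \<and> 0 < K \<and> 2 / real K \<le> \<alpha>' * (1 - 2 * \<alpha>) / 16 / 4 \<and> 4 * real l * real n \<le> real N * (\<alpha>' / 2)
        \<and> real k * (8 / (\<alpha>' / 2 * sqrt N) + 8 / sqrt l + 8 / (\<alpha>' * (1 - 2 * \<alpha>) / 16 * sqrt N)) \<le> \<rho>'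
        \<and> 2 * exp (- (real N * (\<alpha>' * (1 - 2 * \<alpha>) / 16)\<^sup>2 / 32)) * real k + 2 powr (real K * real K) * (1 - c / 2) ^ k \<le> \<beta>'
        \<and> real (2 * N * k) \<le> C * (1 / \<alpha>' * (1 + ln (1 / \<beta>'))) ^ 8 * real n"
      using amplification_parameters[OF \<sigma> c \<rho>'(1,2)] by blast
    show ?thesis
    proof (rule exI[of _ "C * 256"], intro conjI allI impI)
      show "0 < C * 256" using C by simp
      fix X :: "'x set" and H n A and \<rho> \<alpha>' \<beta>' :: real
      assume X: "countable X" and n: "1 \<le> n" and \<rho>: "\<rho> \<in> {0<..<1}"
        and lt: "\<beta> < 2 * \<rho> / (\<rho> + 1) - 2 * sqrt (2 * \<rho> / (\<rho> + 1)) + 1"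
        and \<alpha>': "\<alpha>' \<in> {0<..<1}" and \<beta>': "\<beta>' \<in> {0<..<1}"
        and A: "learning_rule X n A" "tv_indistinguishable X n \<rho> A" "accurate X H n \<alpha> \<beta> A"
      obtain l N K k where P: "0 < l" "0 < N" "0 < K" "2 / real K \<le> \<alpha>' * (1 - 2 * \<alpha>) / 16 / 4" "4 * real l * real n \<le> real N * (\<alpha>' / 2)"
        "real k * (8 / (\<alpha>' / 2 * sqrt N) + 8 / sqrt l + 8 / (\<alpha>' * (1 - 2 * \<alpha>) / 16 * sqrt N)) \<le> \<rho>'"
        "2 * exp (- (real N * (\<alpha>' * (1 - 2 * \<alpha>) / 16)\<^sup>2 / 32)) * real k + 2 powr (real K * real K) * (1 - c / 2) ^ k \<le> \<beta>'"
        "real (2 * N * k) \<le> C * (1 / \<alpha>' * (1 + ln (1 / \<beta>'))) ^ 8 * real n"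
        using params[of \<alpha>' \<beta>' n] \<alpha>' \<beta>' n by auto
      have margin: "\<rho> + \<beta> \<le> 1 - c" unfolding c_def using accuracy_margin(2)[OF \<beta> _ _ lt] \<rho> by simp
      \<comment> \<open>The thresholds are \<open>\<theta>\<^sub>1 = \<alpha>' / 2\<close> and
        \<open>\<theta>\<^sub>2 = \<alpha>' * (1 - 2 * \<alpha>) / 16\<close>; the factor 1/16
        leaves room for the edge \<open>(1 - 2 * \<alpha>) * \<alpha>' / 8\<close> to exceed
        \<open>5 * \<theta>\<^sub>2 / 4\<close>.\<close>
      have \<theta>: "0 < \<alpha>' / 2" "0 < \<alpha>' * (1 - 2 * \<alpha>) / 16" "5 * (\<alpha>' / 2) / 4 \<le> \<alpha>'"
        "5 * (\<alpha>' * (1 - 2 * \<alpha>) / 16) / 4 \<le> (1 - 2 * \<alpha>) * (\<alpha>' / 2 / 4)" "\<alpha>' * (1 - 2 * \<alpha>) / 16 \<le> \<alpha>' / 2"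
        using \<alpha>' \<sigma> mult_left_mono[of "1 - 2 * \<alpha>" 1 \<alpha>'] by (auto simp: mult.commute)
      have half: "\<alpha> < 1 / 2" and nonneg: "0 \<le> \<rho>" "0 \<le> \<beta>" using \<alpha> \<rho> \<beta> by auto
      obtain A' where A': "learning_rule X (2 * N * k) A'" "tv_indistinguishable X (2 * N * k) \<rho>' A'" "accurate X H (2 * N * k) \<alpha>' \<beta>' A'"
        using amplification[OF X A nonneg c margin half P(1-3) \<theta>(1-5) P(4-7)] by blast
      have z: "0 \<le> ln (1 / \<beta>')" using \<beta>' by simp
      have "(1 / \<alpha>' * (1 + ln (1 / \<beta>'))) ^ 8 = (1 / \<alpha>') ^ 8 * (1 + ln (1 / \<beta>')) ^ 8" by (rule power_mult_distrib)
      also have "\<dots> \<le> (1 / \<alpha>') ^ 8 * (256 * (1 + ln (1 / \<beta>') ^ 8))"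
        using \<alpha>' by (intro mult_left_mono one_plus_power8_le z) auto
      finally have "C * (1 / \<alpha>' * (1 + ln (1 / \<beta>'))) ^ 8 * real n \<le> C * ((1 / \<alpha>') ^ 8 * (256 * (1 + ln (1 / \<beta>') ^ 8))) * real n"
        using C by (intro mult_right_mono mult_left_mono) auto
      then have "real (2 * N * k) \<le> C * 256 * ((1 / \<alpha>') ^ 8 * (1 + ln (1 / \<beta>') ^ 8)) * real n"
        using P(8) by (simp add: mult_ac)
      then show "\<exists>n' A'. learning_rule X n' A' \<and> tv_indistinguishable X n' \<rho>' A' \<and> accurate X H n' \<alpha>' \<beta>' A' \<and>
          real n' \<le> C * 256 * ((1 / \<alpha>') ^ 8 * (1 + (ln (1 / \<beta>')) ^ 8)) * real n"
        using A' by blast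
    qed
  qed
qed

end
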